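(* Let $r\geq t\geq 3$, let $F$ be a graph with chromatic number $t$, and let $0<\epsilon<1$. There exists $\delta>0$ (depending only on $F$, $r$ and $\epsilon$) such that the following holds. Let $n_1\geq\cdots\geq n_r$ with $n_{t-1}\geq 1/\delta$, let $\mathcal{V}=(V_1,\ldots,V_r)$ with $|V_i|=n_i$, and let $G$ be an $F$-free spanning subgraph of $K_{n_1,\ldots,n_r}$ with $e(G)\geq f(n_1,\ldots,n_r,1,t)-\delta n_{t-1}^2$. Then there is a spanning subgraph $G'$ of $G$ with $e(G')\geq e(G)-\epsilon n_{t-1}^2$ (i.e. obtained by removing at most $\epsilon n_{t-1}^2$ edges), a set $X$ and a $(t-1)$-partition $\mathcal{P}$ of $V$ such that $\mathcal{P}$ is an $(X,\epsilon)$-stable partition of $G'$, and the integral part (with respect to $\mathcal{V}_X$) of every class of $\mathcal{P}_X$ has size larger than $(1-\epsilon)n_{t-1}$.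
   Context: $V=V_1\cup\cdots\cup V_r$ (disjoint), $K_{n_1,\ldots,n_r}$ is the complete $r$-partite graph with parts $V_i$. For $I\subseteq[r]$, $n_I=\sum_{i\in I}n_i$, and $f(n_1,\ldots,n_r,1,t)=\max_{\mathcal{Q}}\sum n_In_{I'}$, the maximum over partitions $\mathcal{Q}$ of $[r]$ into $t-1$ parts, the sum over unordered pairs of distinct parts. For a partition $\mathcal{P}=(P_1,\ldots,P_{t-1})$ of $V$, $K_{n_1,\ldots,n_r}[\mathcal{P}]$ is the subgraph of $K_{n_1,\ldots,n_r}$ of edges joining different classes of $\mathcal{P}$. For $X\subseteq V$: $\mathcal{P}_X=(P_1\setminus X,\ldots,P_{t-1}\setminus X)$ and $\mathcal{V}_X=(V_1\setminus X,\ldots,V_r\setminus X)$. For a partition $\mathcal{P}=(P_j)$ and $\mathcal{V}=(V_i)$ of the same set: $V_i$ is integral in $P_j$ if $V_i\subseteq P_j$, partial in $P_j$ if $V_i\cap P_j\neq\emptyset$, $V_i\not\subseteq P_j$; $V_i$ is a partial class if partial in some $P_j$. The integral part of $P_j$ is the union of the $V_i$ integral in $P_j$, the partial part the union of $V_i\cap P_j$ over $V_i$ partial in $P_j$; $P_j$ is partial if its partial part is nonempty, integral otherwise. $\mathcal{P}$ is stable to $\mathcal{V}$ if: (1) each $P_j$ has at most one $V_i$ partial in it; (2) integral parts of partial classes of $\mathcal{P}$ all have equal size, at most the size of every integral class of $\mathcal{P}$; (3) the integral part of every class of $\mathcal{P}$ has size at least that of every partial class of $\mathcal{V}$; (4)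 for every $j$ and $V_i$ integral in $P_j$, $|P_j\setminus V_i|$ is at most the size of the integral part of every $P_{j'}$, $j'\neq j$. Two graphs $H,F'$ on the same vertex set: $F'$ is $\alpha$-close to $H$ if $|N_H(v)\triangle N_{F'}(v)|\leq\alpha$ for every vertex $v$. For a spanning subgraph $G$ of $K_{n_1,\ldots,n_r}$, a $(t-1)$-partition $\mathcal{P}$ of $V$ is an $(X,\epsilon)$-stable partition of $G$ if $X\subseteq V$, $|X|\leq\epsilon n_{t-1}$, $G-X$ is $\epsilon n_{t-1}$-close to $K_{n_1,\ldots,n_r}[\mathcal{P}]-X$, and $\mathcal{P}_X$ is stable to $\mathcal{V}_X$.
   Formalization: In the definition of stable, an empty V_i\X is not counted as integral in any P_j; read literally it would be integral in every P_j, and condition (4) would force all classes of P_X to be integral and of equal size, which makes the claim false. *)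

theory Defs
  imports Complex_Main "HOL-Library.Disjoint_Sets"
begin

record 'a sgraph =
  verts :: "'a set"
  edges :: "'a set set"

definition simple_graph :: "'a sgraph \<Rightarrow> bool" where
  "simple_graph G \<longleftrightarrow>
     finite (verts G) \<and> (\<forall>e\<in>edges G. e \<subseteq> verts G \<and> card e = 2)"

definition neighbourhood :: "'a sgraph \<Rightarrow> 'a \<Rightarrow> 'a set" where
  "neighbourhood G v = {u. {v, u} \<in> edges G}"

definition proper_colouring :: "'a sgraph \<Rightarrow> nat \<Rightarrow> ('a \<Rightarrow> nat) \<Rightarrow> bool" where
  "proper_colouring G k c \<longleftrightarrow>
     c ` verts G \<subseteq> {..<k} \<and> (\<forall>u v. {u, v} \<in> edges G \<longrightarrow> c u \<noteq> c v)"

definition chromatic_number :: "'a sgraph \<Rightarrow> nat" where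
  "chromatic_number G = (LEAST k. \<exists>c. proper_colouring G k c)"

text \<open>Copies of \<open>F\<close> are not required to be induced.\<close>

definition contains_copy :: "'a sgraph \<Rightarrow> 'b sgraph \<Rightarrow> bool" where
  "contains_copy G F \<longleftrightarrow>
     (\<exists>\<phi>. inj_on \<phi> (verts F) \<and> \<phi> ` verts F \<subseteq> verts G \<and> (\<forall>e\<in>edges F. \<phi> ` e \<in> edges G))"

definition free_of :: "'b sgraph \<Rightarrow> 'a sgraph \<Rightarrow> bool" where
  "free_of F G \<longleftrightarrow> \<not> contains_copy G F"

definition spanning_subgraph :: "'a sgraph \<Rightarrow> 'a sgraph \<Rightarrow> bool" where
  "spanning_subgraph H G \<longleftrightarrow> verts H = verts G \<and> edges H \<subseteq> edges G"

definition delete_verts :: "'a sgraph \<Rightarrow> 'a set \<Rightarrow> 'a sgraph" where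
  "delete_verts G X = \<lparr>verts = verts G - X, edges = {e \<in> edges G. e \<inter> X = {}}\<rparr>"

text \<open>
  A partition \<open>(A\<^sub>1, \<dots>, A\<^sub>k)\<close> is a family \<open>A\<close> of sets, of which only the values on
  \<open>{1..k}\<close> matter. Classes may be empty, since deleting a vertex set \<open>X\<close> can use up a whole
  class.
\<close>

definition indexed_partition :: "'a set \<Rightarrow> nat \<Rightarrow> (nat \<Rightarrow> 'a set) \<Rightarrow> bool" where
  "indexed_partition S k A \<longleftrightarrow> disjoint_family_on A {1..k} \<and> (\<Union>i\<in>{1..k}. A i) = S"

definition delete_family :: "(nat \<Rightarrow> 'a set) \<Rightarrow> 'a set \<Rightarrow> nat \<Rightarrow> 'a set" where
  "delete_family A X = (\<lambda>i. A i - X)"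

definition complete_multipartite :: "nat \<Rightarrow> (nat \<Rightarrow> 'a set) \<Rightarrow> 'a sgraph" where
  "complete_multipartite r V =
     \<lparr>verts = (\<Union>i\<in>{1..r}. V i),
      edges = {{u, v} | u v i j. i \<in> {1..r} \<and> j \<in> {1..r} \<and> i \<noteq> j \<and> u \<in> V i \<and> v \<in> V j}\<rparr>"

text \<open>The graph \<open>K[\<P>]\<close>, for a partition \<open>\<P>\<close> of the vertices into \<open>k\<close> classes.\<close>

definition cross_subgraph :: "'a sgraph \<Rightarrow> nat \<Rightarrow> (nat \<Rightarrow> 'a set) \<Rightarrow> 'a sgraph" where
  "cross_subgraph K k P =
     \<lparr>verts = verts K,
      edges = {e \<in> edges K. \<exists>i\<in>{1..k}. \<exists>j\<in>{1..k}. \<exists>u\<in>P i. \<exists>v\<in>P j. i \<noteq> j \<and> e = {u, v}}\<rparr>"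

text \<open>
  \<open>turan_f n r t\<close> is \<open>f(n\<^sub>1, \<dots>, n\<^sub>r, 1, t)\<close>; an unordered pair of distinct parts of \<open>Q\<close> is a
  two-element subset of \<open>Q\<close>.
\<close>

definition turan_f :: "(nat \<Rightarrow> nat) \<Rightarrow> nat \<Rightarrow> nat \<Rightarrow> nat" where
  "turan_f n r t =
     Max {(\<Sum>p | p \<subseteq> Q \<and> card p = 2. \<Prod>I\<in>p. \<Sum>i\<in>I. n i) | Q.
            partition_on {1..r} Q \<and> card Q = t - 1}"

text \<open>
  Empty members of a family \<open>V\<close> do not count as classes. Without \<open>A \<noteq> {}\<close> below, an empty
  \<open>V i\<close> would be integral in every \<open>P j\<close>, and the last condition of \<open>stable\<close> would
  then force all the classes of \<open>P\<close> to be integral and of equal size.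
\<close>

definition integral_in :: "'a set \<Rightarrow> 'a set \<Rightarrow> bool" where
  "integral_in A B \<longleftrightarrow> A \<noteq> {} \<and> A \<subseteq> B"

definition partial_in :: "'a set \<Rightarrow> 'a set \<Rightarrow> bool" where
  "partial_in A B \<longleftrightarrow> A \<inter> B \<noteq> {} \<and> \<not> A \<subseteq> B"

definition integral_part :: "nat \<Rightarrow> (nat \<Rightarrow> 'a set) \<Rightarrow> 'a set \<Rightarrow> 'a set" where
  "integral_part r V B = (\<Union>i\<in>{i\<in>{1..r}. integral_in (V i) B}. V i)"

definition partial_part :: "nat \<Rightarrow> (nat \<Rightarrow> 'a set) \<Rightarrow> 'a set \<Rightarrow> 'a set" where
  "partial_part r V B = (\<Union>i\<in>{i\<in>{1..r}. partial_in (V i) B}. V i \<inter> B)"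

text \<open>
  The word ``partial'' is used for the classes of both partitions: \<open>is_partial r V (P j)\<close> is
  about a class of \<open>\<P>\<close>, \<open>is_partial_class k P (V i)\<close> about a class of \<open>\<V>\<close>.
\<close>

definition is_partial :: "nat \<Rightarrow> (nat \<Rightarrow> 'a set) \<Rightarrow> 'a set \<Rightarrow> bool" where
  "is_partial r V B \<longleftrightarrow> partial_part r V B \<noteq> {}"

definition is_partial_class :: "nat \<Rightarrow> (nat \<Rightarrow> 'a set) \<Rightarrow> 'a set \<Rightarrow> bool" where
  "is_partial_class k P A \<longleftrightarrow> (\<exists>j\<in>{1..k}. partial_in A (P j))"

definition stable :: "nat \<Rightarrow> (nat \<Rightarrow> 'a set) \<Rightarrow> nat \<Rightarrow> (nat \<Rightarrow> 'a set) \<Rightarrow> bool" where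
  "stable k P r V \<longleftrightarrow>
     (\<forall>j\<in>{1..k}. card {i\<in>{1..r}. partial_in (V i) (P j)} \<le> 1) \<and>
     (\<forall>j\<in>{1..k}. \<forall>j'\<in>{1..k}. is_partial r V (P j) \<longrightarrow>
        (if is_partial r V (P j')
         then card (integral_part r V (P j)) = card (integral_part r V (P j'))
         else card (integral_part r V (P j)) \<le> card (P j'))) \<and>
     (\<forall>j\<in>{1..k}. \<forall>i\<in>{1..r}. is_partial_class k P (V i) \<longrightarrow>
        card (V i) \<le> card (integral_part r V (P j))) \<and>
     (\<forall>j\<in>{1..k}. \<forall>i\<in>{1..r}. integral_in (V i) (P j) \<longrightarrow>
        (\<forall>j'\<in>{1..k}. j' \<noteq> j \<longrightarrow> card (P j - V i) \<le> card (integral_part r V (P j'))))"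

definition close_to :: "real \<Rightarrow> 'a sgraph \<Rightarrow> 'a sgraph \<Rightarrow> bool" where
  "close_to \<alpha> F' H \<longleftrightarrow>
     verts F' = verts H \<and>
     (\<forall>v\<in>verts H. real (card (sym_diff (neighbourhood H v) (neighbourhood F' v))) \<le> \<alpha>)"

text \<open>
  \<open>\<P>\<close> is an \<open>(X, \<epsilon>)\<close>-stable partition of the spanning subgraph \<open>G\<close> of
  \<open>complete_multipartite r V\<close>; here \<open>n\<^bsub>t-1\<^esub>\<close> is \<open>card (V (t - 1))\<close>.
\<close>

definition stable_partition ::
  "nat \<Rightarrow> nat \<Rightarrow> (nat \<Rightarrow> 'a set) \<Rightarrow> 'a set \<Rightarrow> real \<Rightarrow> 'a sgraph \<Rightarrow> (nat \<Rightarrow> 'a set) \<Rightarrow> bool" where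
  "stable_partition r t V X \<epsilon> G P \<longleftrightarrow>
     indexed_partition (verts G) (t - 1) P \<and>
     X \<subseteq> verts G \<and>
     real (card X) \<le> \<epsilon> * real (card (V (t - 1))) \<and>
     close_to (\<epsilon> * real (card (V (t - 1))))
       (delete_verts G X)
       (delete_verts (cross_subgraph (complete_multipartite r V) (t - 1) P) X) \<and>
     stable (t - 1) (delete_family P X) r (delete_family V X)"

end

theory Submission
  imports Defs "HOL-Library.FuncSet"
begin

text \<open>
  Write \<open>k = t - 1\<close> and \<open>m = n\<^sub>k\<close>. Sampling one vertex from each class turns \<open>G\<close> into a random graph on the
  index set, in which the pair \<open>i, j\<close> gets the weight \<open>n\<^sub>i n\<^sub>j\<close>; the average weight of the non-edges is the
  number of missing edges of \<open>G\<close>. By \<open>F\<close>-freeness almost no transversal contains a \<open>K\<^sub>t\<close>, and Furedi's proof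
  of Turan stability shows that a \<open>K\<^sub>t\<close>-free transversal misses at least the weight inside the classes of
  some \<open>k\<close>-colouring. The optimal such weight is only \<open>O(m\<^sup>2)\<close>, however large \<open>n\<^sub>1\<close> may be, so almost every
  transversal induces a complete \<open>k\<close>-partite graph of nearly optimal type.

  Fix a transversal \<open>y\<close> such that almost all mixtures of \<open>y\<close> with a second transversal are of this kind. Every
  vertex is coloured by its adjacencies to \<open>y\<close>, and adjacency agrees with having different colours up to few
  pairs. Every choice of one well-represented colour for each class is then a nearly optimal
  \<open>k\<close>-colouring of the index set, and exchange arguments give the stability conditions up to a small
  error. Deleting a few more vertices makes them exact. No edge has to be removed.
\<close>

subsection \<open>Complete multipartite subgraphs of dense products\<close>

text \<open>Class sizes need not be comparable with \<open>m\<close>: the first \<open>k - 1\<close>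
  may be arbitrarily larger, those after \<open>k\<close> arbitrarily smaller, and the constant must
  not depend on the ratios. Small classes leave no room for density arguments and may weigh less
  than every exchange tolerance, so they go into \<open>X\<close> whole. How small is settled by a
  pigeonhole over \<open>r + 1\<close> thresholds, each negligible for the \<open>\<delta>\<close>
  that the preceding one demands. For large classes, a fraction \<open>\<beta>\<close> of
  exceptional transversals only bounds the wrong pairs by \<open>\<beta> * (w i * w j)\<close>,
  which need not be of order \<open>m^2\<close>. But once \<open>w i\<close> exceeds
  \<open>L * m\<close>, a single non-edge at \<open>V i\<close> costs a transversal more than any
  near-optimal colouring does; so \<open>V i\<close> gets a colour of its own, its wrong pairs are
  non-edges, and the excess over the optimum bounds their number in absolute terms. Any wrong pair
  in a transversal weighs at least \<open>c^2\<close>, with \<open>c\<close> a lower bound for the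
  class weights, and this is above the tolerance. Good transversals are therefore complete
  \<open>k\<close>-partite without any error, which is why one reference transversal can determine
  the colours.\<close>

lemma sum_card_swap:
  assumes "finite A" "finite B"
  shows "(\<Sum>a\<in>A. card {b\<in>B. R a b}) = (\<Sum>b\<in>B. card {a\<in>A. R a b})"
proof -
  have "(\<Sum>a\<in>A. card {b\<in>B. R a b}) = (\<Sum>a\<in>A. \<Sum>b\<in>B. if R a b then 1 else 0)"
    using assms by (intro sum.cong) (simp_all add: sum.inter_filter[symmetric])
  also have "\<dots> = (\<Sum>b\<in>B. \<Sum>a\<in>A. if R a b then 1 else 0)" by (rule sum.swap)
  also have "\<dots> = (\<Sum>b\<in>B. card {a\<in>A. R a b})"
    using assms by (intro sum.cong) (simp_all add: sum.inter_filter[symmetric])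
  finally show ?thesis .
qed

lemma sum_if_mem_const:
  assumes "finite A" "S \<subseteq> A"
  shows "(\<Sum>a\<in>A. if a \<in> S then c else 0) = real (card S) * c"
  using assms by (simp add: sum.If_cases Int_absorb1)

text \<open>Kovari-Sos-Turan counting through a sample of bounded size. The elements related to a
  fraction \<open>\<eta> / 2\<close> of \<open>W\<close> make up a fraction
  \<open>\<eta> / 2\<close> of \<open>A\<close>, so \<open>M\<close> of them can be fixed as
  \<open>A0\<close>. At least a fraction \<open>\<eta> / 4\<close> of \<open>W\<close> is then
  related to \<open>s\<close> or more elements of \<open>A0\<close>, and the final pigeonhole runs
  over at most \<open>2 ^ M\<close> subsets, a number independent of \<open>card A\<close>.\<close>

lemma dense_relation_common_neighbours:
  fixes \<eta> :: real and s M :: nat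
  assumes "finite A" "finite W" "W \<noteq> {}" "\<eta> > 0"
    and M: "real M * \<eta> \<ge> 4 * real s" "M > 0" and A: "real (card A) * \<eta> \<ge> 2 * real M"
    and dens: "real (\<Sum>a\<in>A. card {w\<in>W. R a w}) \<ge> \<eta> * real (card A) * real (card W)"
  shows "\<exists>S\<subseteq>A. card S = s \<and> real (card {w\<in>W. \<forall>a\<in>S. R a w}) \<ge> \<eta> / 4 / 2 ^ M * real (card W)"
proof -
  have W: "card W > 0" using assms by (simp add: card_gt_0_iff)
  define A1 where "A1 = {a\<in>A. real (card {w\<in>W. R a w}) \<ge> \<eta> / 2 * real (card W)}"
  have "real (\<Sum>a\<in>A. card {w\<in>W. R a w})
      \<le> (\<Sum>a\<in>A. (if a \<in> A1 then real (card W) else 0) + \<eta> / 2 * real (card W))"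
    unfolding of_nat_sum
  proof (rule sum_mono)
    fix a assume "a \<in> A"
    have "card {w\<in>W. R a w} \<le> card W" using assms by (intro card_mono) auto
    then show "real (card {w\<in>W. R a w}) \<le> (if a \<in> A1 then real (card W) else 0) + \<eta> / 2 * real (card W)"
      using \<open>a \<in> A\<close> \<open>\<eta> > 0\<close> by (auto simp: A1_def intro: add_increasing2)
  qed
  also have "\<dots> = real (card A1) * real (card W) + real (card A) * (\<eta> / 2 * real (card W))"
    using sum_if_mem_const[OF \<open>finite A\<close>, of A1 "real (card W)"] by (simp add: sum.distrib A1_def)
  finally have "(real (card A) * (\<eta> / 2)) * real (card W) \<le> real (card A1) * real (card W)"
    using dens by (simp add: algebra_simps)
  then have "real (card A) * (\<eta> / 2) \<le> real (card A1)" using W by simp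
  then have "M \<le> card A1" using A by linarith
  then obtain A0 where A0: "A0 \<subseteq> A1" "card A0 = M" "finite A0"
    by (meson obtain_subset_with_card_n)
  have A0A: "A0 \<subseteq> A" using A0 by (auto simp: A1_def)
  define W1 where "W1 = {w\<in>W. s \<le> card {a\<in>A0. R a w}}"
  have "real M * (\<eta> / 2 * real (card W)) \<le> (\<Sum>a\<in>A0. real (card {w\<in>W. R a w}))"
  proof -
    have "(\<Sum>a\<in>A0. \<eta> / 2 * real (card W)) \<le> (\<Sum>a\<in>A0. real (card {w\<in>W. R a w}))"
      using A0(1) by (intro sum_mono) (unfold A1_def, blast)
    then show ?thesis using A0(2) by simp
  qed
  also have "\<dots> = real (\<Sum>w\<in>W. card {a\<in>A0. R a w})"
    unfolding of_nat_sum[symmetric] by (subst sum_card_swap[OF \<open>finite A0\<close> \<open>finite W\<close>]) (rule refl)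
  also have "\<dots> \<le> (\<Sum>w\<in>W. (if w \<in> W1 then real M else 0) + real s)"
    unfolding of_nat_sum
  proof (rule sum_mono)
    fix w assume "w \<in> W"
    have "card {a\<in>A0. R a w} \<le> M" using A0 by (metis (no_types, lifting) card_mono mem_Collect_eq subsetI)
    then show "real (card {a\<in>A0. R a w}) \<le> (if w \<in> W1 then real M else 0) + real s"
      using \<open>w \<in> W\<close> by (auto simp: W1_def)
  qed
  also have "\<dots> = real (card W1) * real M + real (card W) * real s"
    using sum_if_mem_const[OF \<open>finite W\<close>, of W1 "real M"] by (simp add: sum.distrib W1_def)
  also have "\<dots> \<le> real (card W1) * real M + real (card W) * (real M * \<eta> / 4)"
    using M by (intro add_left_mono mult_left_mono) auto
  finally have "real M * (\<eta> / 4 * real (card W)) \<le> real M * real (card W1)"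
    by (simp add: algebra_simps)
  then have W1: "\<eta> / 4 * real (card W) \<le> real (card W1)" using M by simp
  have "\<forall>w\<in>W1. \<exists>S. S \<subseteq> {a\<in>A0. R a w} \<and> card S = s"
    unfolding W1_def by (metis (mono_tags, lifting) mem_Collect_eq obtain_subset_with_card_n)
  then obtain g where g: "\<And>w. w \<in> W1 \<Longrightarrow> g w \<subseteq> {a\<in>A0. R a w} \<and> card (g w) = s" by metis
  show ?thesis
  proof (rule ccontr)
    assume neg: "\<not> ?thesis"
    have less: "real (card {w\<in>W. \<forall>a\<in>S. R a w}) < \<eta> / 4 / 2 ^ M * real (card W)"
      if "S \<subseteq> A" "card S = s" for S
    proof (rule ccontr)
      assume "\<not> real (card {w\<in>W. \<forall>a\<in>S. R a w}) < \<eta> / 4 / 2 ^ M * real (card W)"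
      then have "\<eta> / 4 / 2 ^ M * real (card W) \<le> real (card {w\<in>W. \<forall>a\<in>S. R a w})" by (simp only: not_less)
      then show False using that neg by blast
    qed
    have "card W1 \<le> (\<Sum>S\<in>{S\<in>Pow A0. card S = s}. card {w\<in>W. \<forall>a\<in>S. R a w})"
    proof -
      have "W1 \<subseteq> (\<Union>S\<in>{S\<in>Pow A0. card S = s}. {w\<in>W. \<forall>a\<in>S. R a w})"
      proof
        fix w assume "w \<in> W1"
        then show "w \<in> (\<Union>S\<in>{S\<in>Pow A0. card S = s}. {w\<in>W. \<forall>a\<in>S. R a w})"
          using g[of w] by (intro UN_I[of "g w"]) (auto simp: W1_def)
      qed
      then have "card W1 \<le> card (\<Union>S\<in>{S\<in>Pow A0. card S = s}. {w\<in>W. \<forall>a\<in>S. R a w})"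
        using \<open>finite W\<close> \<open>finite A0\<close> by (intro card_mono) auto
      also have "\<dots> \<le> (\<Sum>S\<in>{S\<in>Pow A0. card S = s}. card {w\<in>W. \<forall>a\<in>S. R a w})"
        using \<open>finite A0\<close> by (intro card_UN_le) auto
      finally show ?thesis .
    qed
    then have "real (card W1) \<le> (\<Sum>S\<in>{S\<in>Pow A0. card S = s}. real (card {w\<in>W. \<forall>a\<in>S. R a w}))"
      unfolding of_nat_sum[symmetric] by (simp only: of_nat_le_iff)
    moreover have "W1 \<noteq> {}"
    proof
      assume "W1 = {}"
      then show False using W1 W \<open>\<eta> > 0\<close> by (simp add: mult_le_0_iff)
    qed
    then obtain w where "w \<in> W1" by auto
    then have ne: "{S\<in>Pow A0. card S = s} \<noteq> {}" using g[of w] by auto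
    have "(\<Sum>S\<in>{S\<in>Pow A0. card S = s}. real (card {w\<in>W. \<forall>a\<in>S. R a w}))
       < (\<Sum>S\<in>{S\<in>Pow A0. card S = s}. \<eta> / 4 / 2 ^ M * real (card W))"
      using \<open>finite A0\<close> ne less A0A by (intro sum_strict_mono) auto
    also have "\<dots> \<le> (\<Sum>S\<in>Pow A0. \<eta> / 4 / 2 ^ M * real (card W))"
      using \<open>finite A0\<close> \<open>\<eta> > 0\<close> by (intro sum_mono2) auto
    also have "\<dots> = \<eta> / 4 * real (card W)" using A0 by (simp add: card_Pow)
    ultimately show False using W1 by linarith
  qed
qed

text \<open>Erdos' box theorem for \<open>q\<close>-partite hypergraphs, by induction on the number
  of factors. One coordinate \<open>i\<close> is split off and the remaining product plays the role
  of \<open>W\<close> in \<open>dense_relation_common_neighbours\<close>; the tuples that extend by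
  every element of \<open>S0\<close> are dense enough for the induction hypothesis.\<close>

lemma dense_product_contains_box:
  fixes s q :: nat
  shows "\<forall>\<eta>::real>0. \<exists>N0::nat. \<forall>(J :: nat set) (A :: nat \<Rightarrow> 'a set) T.
     finite J \<and> card J = q \<and> (\<forall>j\<in>J. finite (A j) \<and> N0 \<le> card (A j)) \<and> T \<subseteq> PiE J A \<and>
     real (card T) \<ge> \<eta> * (\<Prod>j\<in>J. real (card (A j)))
     \<longrightarrow> (\<exists>S. (\<forall>j\<in>J. S j \<subseteq> A j \<and> card (S j) = s) \<and> PiE J S \<subseteq> T)"
proof (induction q)
  case 0
  show ?case
  proof (intro allI impI exI[of _ 0])
    fix \<eta> :: real and J :: "nat set" and A :: "nat \<Rightarrow> 'a set" and T
    assume "\<eta> > 0" and *: "finite J \<and> card J = 0 \<and> (\<forall>j\<in>J. finite (A j) \<and> 0 \<le> card (A j)) \<and> T \<subseteq> PiE J A \<and>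
     real (card T) \<ge> \<eta> * (\<Prod>j\<in>J. real (card (A j)))"
    then have J: "J = {}" using card_0_eq by blast
    \<comment> \<open>The empty product has a single element, so a nonempty \<open>T\<close> is all
      of it.\<close>
    have "T \<noteq> {}" using * \<open>\<eta> > 0\<close> J by auto
    then show "\<exists>S. (\<forall>j\<in>J. S j \<subseteq> A j \<and> card (S j) = s) \<and> PiE J S \<subseteq> T" using * J by auto
  qed
next
  case (Suc q)
  show ?case
  proof (intro allI impI)
    fix \<eta> :: real assume "\<eta> > 0"
    obtain M where M: "real M * \<eta> \<ge> 4 * real s" "M > 0"
    proof -
      obtain M :: nat where "real M \<ge> 4 * real s / \<eta>" using real_arch_simple by blast
      then have "real (Suc M) \<ge> 4 * real s / \<eta>" by simp
      then have "real (Suc M) * \<eta> \<ge> 4 * real s" using \<open>\<eta> > 0\<close> by (simp add: pos_divide_le_eq)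
      then show thesis using that by blast
    qed
    define \<eta>' where "\<eta>' = \<eta> / 4 / 2 ^ M"
    have "\<eta>' > 0" using \<open>\<eta> > 0\<close> by (simp add: \<eta>'_def)
    from Suc.IH[rule_format, OF this]
    obtain N0 :: nat where N0: "\<forall>(J :: nat set) (A :: nat \<Rightarrow> 'a set) T.
        finite J \<and> card J = q \<and> (\<forall>j\<in>J. finite (A j) \<and> N0 \<le> card (A j)) \<and> T \<subseteq> PiE J A \<and>
        real (card T) \<ge> \<eta>' * (\<Prod>j\<in>J. real (card (A j)))
     \<longrightarrow> (\<exists>S. (\<forall>j\<in>J. S j \<subseteq> A j \<and> card (S j) = s) \<and> PiE J S \<subseteq> T)" ..
    obtain N1 :: nat where N1: "real N1 * \<eta> \<ge> 2 * real M"
    proof -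
      obtain N1 :: nat where "real N1 \<ge> 2 * real M / \<eta>" using real_arch_simple by blast
      then have "real N1 * \<eta> \<ge> 2 * real M" using \<open>\<eta> > 0\<close> by (simp add: pos_divide_le_eq)
      then show thesis using that by blast
    qed
    show "\<exists>N0::nat. \<forall>(J :: nat set) (A :: nat \<Rightarrow> 'a set) T.
     finite J \<and> card J = Suc q \<and> (\<forall>j\<in>J. finite (A j) \<and> N0 \<le> card (A j)) \<and> T \<subseteq> PiE J A \<and>
     real (card T) \<ge> \<eta> * (\<Prod>j\<in>J. real (card (A j)))
     \<longrightarrow> (\<exists>S. (\<forall>j\<in>J. S j \<subseteq> A j \<and> card (S j) = s) \<and> PiE J S \<subseteq> T)"
    \<comment> \<open>\<open>N0\<close> serves the induction hypothesis, \<open>N1\<close> leaves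
      room for the sample of size \<open>M\<close> in the split factor, and the 1 makes all factors
      nonempty.\<close>
    proof (intro exI[of _ "N0 + N1 + 1"] allI impI; elim conjE)
      fix J :: "nat set" and A :: "nat \<Rightarrow> 'a set" and T
      assume J: "finite J" "card J = Suc q" and A: "\<forall>j\<in>J. finite (A j) \<and> N0 + N1 + 1 \<le> card (A j)"
        and T: "T \<subseteq> PiE J A" "real (card T) \<ge> \<eta> * (\<Prod>j\<in>J. real (card (A j)))"
      obtain i J' where J': "J = insert i J'" "i \<notin> J'" "card J' = q" "finite J'"
        using J by (metis card_Suc_eq_finite)
      define W where "W = PiE J' A"
      have finW: "finite W" unfolding W_def using J' A by (intro finite_PiE) auto
      have "A j \<noteq> {}" if "j \<in> J" for j using A that by fastforce
      then have Wne: "W \<noteq> {}" unfolding W_def using J' by (auto simp: PiE_eq_empty_iff)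
      have cW: "real (card W) = (\<Prod>j\<in>J'. real (card (A j)))"
        unfolding W_def using J' by (simp add: card_PiE)
      have finA: "finite (A i)" using A J' by auto
      define R where "R = (\<lambda>a w. w(i := a) \<in> T)"
      have inj: "inj_on (\<lambda>(y, g). g(i := y)) (A i \<times> W)"
        unfolding inj_on_def W_def
        apply (clarsimp simp: fun_eq_iff)
        by (metis J'(2) PiE_arb)
      have Timg: "T = (\<lambda>(y, g). g(i := y)) ` {(a, w). a \<in> A i \<and> w \<in> W \<and> R a w}"
        using T(1) unfolding J'(1) PiE_insert_eq W_def[symmetric] R_def by (fastforce simp: image_iff)
      have "card T = card {(a, w). a \<in> A i \<and> w \<in> W \<and> R a w}"
        unfolding Timg by (rule card_image) (rule inj_on_subset[OF inj], auto)
      also have "{(a, w). a \<in> A i \<and> w \<in> W \<and> R a w} = Sigma (A i) (\<lambda>a. {w\<in>W. R a w})" by auto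
      also have "card \<dots> = (\<Sum>a\<in>A i. card {w\<in>W. R a w})"
        using finA finW by (subst card_SigmaI) auto
      finally have cT: "card T = (\<Sum>a\<in>A i. card {w\<in>W. R a w})" .
      have "real (card T) \<ge> \<eta> * real (card (A i)) * real (card W)"
        using T(2) unfolding cW J'(1) using J' by (simp add: mult.assoc)
      then have dens: "real (\<Sum>a\<in>A i. card {w\<in>W. R a w}) \<ge> \<eta> * real (card (A i)) * real (card W)"
        unfolding cT .
      have "N1 \<le> card (A i)" using A J' by auto
      then have "real N1 * \<eta> \<le> real (card (A i)) * \<eta>" using \<open>\<eta> > 0\<close> by (intro mult_right_mono) auto
      then have "real (card (A i)) * \<eta> \<ge> 2 * real M" using N1 by linarith
      from dense_relation_common_neighbours[OF finA finW Wne \<open>\<eta> > 0\<close> M this dens]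
      obtain S0 where S0: "S0 \<subseteq> A i" "card S0 = s"
        "real (card {w\<in>W. \<forall>a\<in>S0. R a w}) \<ge> \<eta>' * real (card W)" unfolding \<eta>'_def by auto
      have "\<forall>j\<in>J'. finite (A j) \<and> N0 \<le> card (A j)" using A J'(1) by fastforce
      with J' S0(3)[unfolded cW] have "\<exists>S. (\<forall>j\<in>J'. S j \<subseteq> A j \<and> card (S j) = s) \<and> PiE J' S \<subseteq> {w\<in>W. \<forall>a\<in>S0. R a w}"
        unfolding W_def by (intro N0[rule_format]) auto
      then obtain S where S: "\<forall>j\<in>J'. S j \<subseteq> A j \<and> card (S j) = s" "PiE J' S \<subseteq> {w\<in>W. \<forall>a\<in>S0. R a w}"
        by blast
      show "\<exists>S. (\<forall>j\<in>J. S j \<subseteq> A j \<and> card (S j) = s) \<and> PiE J S \<subseteq> T"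
      proof (intro exI[of _ "S(i := S0)"] conjI ballI)
        fix j assume "j \<in> J"
        then show "(S(i := S0)) j \<subseteq> A j" "card ((S(i := S0)) j) = s" using S S0 J' by auto
      next
        have "PiE J' (S(i := S0)) = PiE J' S" using J'(2) by (intro PiE_cong) auto
        then show "PiE J (S(i := S0)) \<subseteq> T"
          unfolding J'(1) PiE_insert_eq using S(2) by (auto simp: R_def)
      qed
    qed
  qed
qed

text \<open>Every part is as large as the whole of \<open>F\<close>, so one bijection
  \<open>g j\<close> per part is enough: a vertex goes to its image under the bijection that belongs
  to its colour. The sizes of the colour classes never enter.\<close>

lemma contains_copy_if_blow_up:
  fixes F :: "'b sgraph" and G :: "'a sgraph"
  assumes F: "simple_graph F" "chromatic_number F = t"
    and J: "finite J" "card J = t" and dis: "disjoint_family_on S J"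
    and S: "\<And>j. j \<in> J \<Longrightarrow> S j \<subseteq> verts G \<and> card (S j) = card (verts F) \<and> finite (S j)"
    and adj: "\<And>i j u v. i \<in> J \<Longrightarrow> j \<in> J \<Longrightarrow> i \<noteq> j \<Longrightarrow> u \<in> S i \<Longrightarrow> v \<in> S j \<Longrightarrow> {u, v} \<in> edges G"
  shows "contains_copy G F"
proof -
  have fin: "finite (verts F)" and ed: "\<And>e. e \<in> edges F \<Longrightarrow> e \<subseteq> verts F \<and> card e = 2"
    using F by (auto simp: simple_graph_def)
  obtain h where h: "inj_on h (verts F)" "h ` verts F = {..<card (verts F)}"
    using ex_bij_betw_finite_nat[OF fin] by (auto simp: bij_betw_def atLeast0LessThan)
  \<comment> \<open>An injective numbering is proper, so the \<open>LEAST\<close> in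
    \<open>chromatic_number\<close> ranges over a nonempty set and is attained.\<close>
  have "proper_colouring F (card (verts F)) h"
    unfolding proper_colouring_def
  proof (intro conjI allI impI)
    fix u v assume "{u, v} \<in> edges F"
    then have "{u, v} \<subseteq> verts F" "card {u, v} = 2" using ed by auto
    then show "h u \<noteq> h v" using h(1) by (auto simp: inj_on_def card_2_iff doubleton_eq_iff)
  qed (use h in auto)
  then have "\<exists>k. \<exists>c. proper_colouring F k c" by blast
  then have "\<exists>c. proper_colouring F (chromatic_number F) c"
    unfolding chromatic_number_def by (rule LeastI_ex)
  then obtain c where c: "proper_colouring F t c" using F by auto
  obtain b where b: "bij_betw b {..<t} J"
    using J by (metis atLeast0LessThan ex_bij_betw_nat_finite)
  have "\<forall>j\<in>J. \<exists>g. bij_betw g (verts F) (S j)"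
    using S fin by (simp add: finite_same_card_bij)
  then obtain g where g: "\<And>j. j \<in> J \<Longrightarrow> bij_betw (g j) (verts F) (S j)" by metis
  define \<phi> where "\<phi> v = g (b (c v)) v" for v
  have bc: "b (c v) \<in> J" if "v \<in> verts F" for v
    using that c b by (auto simp: proper_colouring_def bij_betw_def)
  have \<phi>S: "\<phi> v \<in> S (b (c v))" if "v \<in> verts F" for v
    using g[OF bc[OF that]] that by (auto simp: \<phi>_def bij_betw_def)
  have bcne: "b (c u) \<noteq> b (c v)" if "c u \<noteq> c v" "u \<in> verts F" "v \<in> verts F" for u v
    using that c b by (auto simp: proper_colouring_def bij_betw_def inj_on_def image_subset_iff)
  show ?thesis
    unfolding contains_copy_def
  proof (intro exI[of _ \<phi>] conjI ballI)
    show "inj_on \<phi> (verts F)"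
    proof (rule inj_onI)
      fix u v assume uv: "u \<in> verts F" "v \<in> verts F" "\<phi> u = \<phi> v"
      have "b (c u) = b (c v)"
        using \<phi>S[OF uv(1)] \<phi>S[OF uv(2)] uv(3) bc[OF uv(1)] bc[OF uv(2)] dis
        by (auto simp: disjoint_family_on_def)
      then show "u = v" using uv g[OF bc[OF uv(2)]] by (auto simp: \<phi>_def bij_betw_def inj_on_def)
    qed
    show "\<phi> ` verts F \<subseteq> verts G" using \<phi>S S bc by blast
    fix e assume e: "e \<in> edges F"
    then obtain u v where uv: "e = {u, v}" "u \<noteq> v" using ed by (meson card_2_iff)
    then have "u \<in> verts F" "v \<in> verts F" "c u \<noteq> c v" using e ed c by (auto simp: proper_colouring_def)
    then have "{\<phi> u, \<phi> v} \<in> edges G" using bcne bc \<phi>S by (intro adj[of "b (c u)" "b (c v)"]) auto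
    then show "\<phi> ` e \<in> edges G" using uv by simp
  qed
qed

subsection \<open>Weighted Turan bounds and near-optimal colourings\<close>

lemma double_sum_Un:
  fixes f :: "'i \<Rightarrow> 'i \<Rightarrow> real"
  assumes "finite N" "finite R" "N \<inter> R = {}"
  shows "(\<Sum>i\<in>N \<union> R. \<Sum>j\<in>N \<union> R. f i j) =
    (\<Sum>i\<in>N. \<Sum>j\<in>N. f i j) + (\<Sum>i\<in>N. \<Sum>j\<in>R. f i j) + (\<Sum>i\<in>R. \<Sum>j\<in>N. f i j) + (\<Sum>i\<in>R. \<Sum>j\<in>R. f i j)"
  using assms by (simp add: sum.union_disjoint sum.distrib algebra_simps)

text \<open>
  Furedi's argument: the non-neighbours of a vertex of maximal weighted degree form the last class, and the
  neighbourhood is coloured by induction.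
\<close>

lemma weighted_partite_bound:
  fixes w :: "'i \<Rightarrow> real"
  assumes "finite S" "\<And>i. i \<in> S \<Longrightarrow> w i \<ge> 0" "\<And>i j. H i j \<Longrightarrow> H j i" "\<And>i. \<not> H i i"
    and "\<And>J. J \<subseteq> S \<Longrightarrow> card J = Suc k \<Longrightarrow> \<exists>i\<in>J. \<exists>j\<in>J. i \<noteq> j \<and> \<not> H i j"
  shows "\<exists>\<sigma>. \<sigma> \<in> S \<rightarrow> {1..k} \<and>
    (\<Sum>i\<in>S. \<Sum>j\<in>S. of_bool (H i j) * (w i * w j)) +
    (\<Sum>i\<in>S. \<Sum>j\<in>S. of_bool (H i j \<and> \<sigma> i = \<sigma> j) * (w i * w j))
    \<le> (\<Sum>i\<in>S. \<Sum>j\<in>S. of_bool (\<sigma> i \<noteq> \<sigma> j) * (w i * w j))"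
  using assms
proof (induction k arbitrary: S)
  case 0
  have "S = {}"
  proof (rule ccontr)
    assume "S \<noteq> {}"
    then obtain i where "i \<in> S" by auto
    then show False using "0.prems"(5)[of "{i}"] by auto
  qed
  then show ?case by simp
next
  case (Suc k)
  show ?case
  proof (cases "S = {}")
    case True
    then show ?thesis by simp
  next
    case False
    define d where "d i = (\<Sum>j\<in>S. of_bool (H i j) * w j)" for i
    obtain i0 where i0: "i0 \<in> S" "\<And>i. i \<in> S \<Longrightarrow> d i \<le> d i0"
    proof -
      have "Max (d ` S) \<in> d ` S" using Suc.prems(1) False by (intro Max_in) auto
      then obtain i where "i \<in> S" "d i = Max (d ` S)" by auto
      then show thesis using Suc.prems(1) by (intro that[of i]) auto
    qed
    define N where "N = {j\<in>S. H i0 j}"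
    define R where "R = S - N"
    have NR: "S = N \<union> R" "N \<inter> R = {}" "finite N" "finite R"
      using Suc.prems(1) by (auto simp: N_def R_def)
    have "\<exists>\<sigma>. \<sigma> \<in> N \<rightarrow> {1..k} \<and>
      (\<Sum>i\<in>N. \<Sum>j\<in>N. of_bool (H i j) * (w i * w j)) +
      (\<Sum>i\<in>N. \<Sum>j\<in>N. of_bool (H i j \<and> \<sigma> i = \<sigma> j) * (w i * w j))
      \<le> (\<Sum>i\<in>N. \<Sum>j\<in>N. of_bool (\<sigma> i \<noteq> \<sigma> j) * (w i * w j))"
    proof (rule Suc.IH)
      fix J assume J: "J \<subseteq> N" "card J = Suc k"
      have "i0 \<notin> J" "finite J" using J Suc.prems(4) NR(3) finite_subset by (auto simp: N_def)
      then have "card (insert i0 J) = Suc (Suc k)" using J by simp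
      moreover have "insert i0 J \<subseteq> S" using J i0 by (auto simp: N_def)
      ultimately obtain i j where "i \<in> insert i0 J" "j \<in> insert i0 J" "i \<noteq> j" "\<not> H i j"
        using Suc.prems(5) by blast
      then show "\<exists>i\<in>J. \<exists>j\<in>J. i \<noteq> j \<and> \<not> H i j"
        using J(1) Suc.prems(3) by (auto simp: N_def subset_iff)
    qed (use Suc.prems NR in auto)
    then obtain \<sigma> where \<sigma>: "\<sigma> \<in> N \<rightarrow> {1..k}"
      "(\<Sum>i\<in>N. \<Sum>j\<in>N. of_bool (H i j) * (w i * w j)) +
      (\<Sum>i\<in>N. \<Sum>j\<in>N. of_bool (H i j \<and> \<sigma> i = \<sigma> j) * (w i * w j))
      \<le> (\<Sum>i\<in>N. \<Sum>j\<in>N. of_bool (\<sigma> i \<noteq> \<sigma> j) * (w i * w j))" by blast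
    define \<tau> where "\<tau> i = (if i \<in> N then \<sigma> i else Suc k)" for i
    have \<tau>N: "\<tau> i = \<sigma> i" if "i \<in> N" for i using that by (simp add: \<tau>_def)
    have \<tau>R: "\<tau> i = Suc k" if "i \<in> R" for i using that NR by (auto simp: \<tau>_def)
    have ne: "\<sigma> i \<noteq> Suc k" if "i \<in> N" for i using funcset_mem[OF \<sigma>(1) that] by auto
    define b where "b = (\<Sum>i\<in>R. \<Sum>j\<in>N. of_bool (H i j) * (w i * w j))"
    define c where "c = (\<Sum>i\<in>R. \<Sum>j\<in>R. of_bool (H i j) * (w i * w j))"
    have b': "(\<Sum>i\<in>N. \<Sum>j\<in>R. of_bool (H i j) * (w i * w j)) = b"
      unfolding b_def by (subst sum.swap) (use Suc.prems(3) in \<open>auto intro!: sum.cong simp: mult.commute\<close>)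
    \<comment> \<open>Pairs meeting \<open>R\<close> contribute \<open>2 * b + c\<close> to the edge
      weight and another \<open>c\<close> to the weight of edges inside the new class. The total
      \<open>2 * (b + c)\<close> is covered by the cross pairs between \<open>R\<close> and
      \<open>N\<close>, because no degree in \<open>R\<close> exceeds that of \<open>i0\<close>,
      which is the weight of \<open>N\<close>.\<close>
    have bc: "b + c \<le> (\<Sum>i\<in>R. w i) * (\<Sum>j\<in>N. w j)"
    proof -
      have "b + c = (\<Sum>i\<in>R. w i * d i)"
      proof -
        have "d i = (\<Sum>j\<in>N. of_bool (H i j) * w j) + (\<Sum>j\<in>R. of_bool (H i j) * w j)" for i
          unfolding d_def NR(1) using NR by (intro sum.union_disjoint) auto
        then show ?thesis
          unfolding b_def c_def by (simp only: distrib_left sum.distrib sum_distrib_left mult.left_commute)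
      qed
      also have "\<dots> \<le> (\<Sum>i\<in>R. w i * d i0)"
        using i0 Suc.prems(2) by (intro sum_mono mult_left_mono) (auto simp: R_def)
      also have "d i0 = (\<Sum>j\<in>N. w j)"
        unfolding d_def N_def using Suc.prems(1)
        by (simp add: sum.inter_filter[symmetric] of_bool_def if_distrib[of "\<lambda>x. x * _"] cong: if_cong)
      finally show ?thesis by (simp add: sum_distrib_right)
    qed
    have e1: "(\<Sum>i\<in>S. \<Sum>j\<in>S. of_bool (H i j) * (w i * w j)) =
        (\<Sum>i\<in>N. \<Sum>j\<in>N. of_bool (H i j) * (w i * w j)) + b + b + c"
      unfolding NR(1) double_sum_Un[OF NR(3,4,2)] b' b_def[symmetric] c_def[symmetric] by simp
    have e2: "(\<Sum>i\<in>S. \<Sum>j\<in>S. of_bool (H i j \<and> \<tau> i = \<tau> j) * (w i * w j)) =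
        (\<Sum>i\<in>N. \<Sum>j\<in>N. of_bool (H i j \<and> \<sigma> i = \<sigma> j) * (w i * w j)) + c"
      unfolding NR(1) double_sum_Un[OF NR(3,4,2)] c_def using \<tau>N \<tau>R ne
      by (simp add: ne[symmetric] cong: sum.cong)
    have e3: "(\<Sum>i\<in>S. \<Sum>j\<in>S. of_bool (\<tau> i \<noteq> \<tau> j) * (w i * w j)) =
        (\<Sum>i\<in>N. \<Sum>j\<in>N. of_bool (\<sigma> i \<noteq> \<sigma> j) * (w i * w j)) + 2 * ((\<Sum>i\<in>R. w i) * (\<Sum>j\<in>N. w j))"
      unfolding NR(1) double_sum_Un[OF NR(3,4,2)] using \<tau>N \<tau>R ne ne[symmetric]
      by (simp add: sum_product sum.swap[of _ N R] mult.commute cong: sum.cong)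
    have "\<tau> \<in> S \<rightarrow> {1..Suc k}" using \<sigma>(1) by (fastforce simp: \<tau>_def)
    moreover have "(\<Sum>i\<in>S. \<Sum>j\<in>S. of_bool (H i j) * (w i * w j)) +
      (\<Sum>i\<in>S. \<Sum>j\<in>S. of_bool (H i j \<and> \<tau> i = \<tau> j) * (w i * w j))
      \<le> (\<Sum>i\<in>S. \<Sum>j\<in>S. of_bool (\<tau> i \<noteq> \<tau> j) * (w i * w j))"
      unfolding e1 e2 e3 using \<sigma>(2) bc by linarith
    ultimately show ?thesis by blast
  qed
qed

text \<open>Ordered pairs are summed, so every unordered pair counts twice. \<open>miss\<close> and
  \<open>missing\<close> are normalised in the same way; the factor 2 surfaces only in the
  comparison with \<open>turan_f\<close> and the edge count.\<close>

definition inside :: "nat set \<Rightarrow> (nat \<Rightarrow> real) \<Rightarrow> (nat \<Rightarrow> nat) \<Rightarrow> real" where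
  "inside B w \<sigma> = (\<Sum>i\<in>B. \<Sum>j\<in>B. of_bool (i \<noteq> j \<and> \<sigma> i = \<sigma> j) * (w i * w j))"

definition class_weight :: "nat set \<Rightarrow> (nat \<Rightarrow> real) \<Rightarrow> (nat \<Rightarrow> nat) \<Rightarrow> nat \<Rightarrow> real" where
  "class_weight B w \<sigma> a = (\<Sum>i | i \<in> B \<and> \<sigma> i = a. w i)"

text \<open>The subtracted sum is the same for all colourings, so comparing two colourings amounts
  to comparing sums of squared class weights, and an exchange between two classes involves only two
  terms.\<close>

lemma inside_conv_class_weight:
  assumes "finite B" "finite C" "\<sigma> \<in> B \<rightarrow> C"
  shows "inside B w \<sigma> = (\<Sum>a\<in>C. (class_weight B w \<sigma> a)\<^sup>2) - (\<Sum>i\<in>B. (w i)\<^sup>2)"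
proof -
  have cw: "class_weight B w \<sigma> a = (\<Sum>i\<in>B. of_bool (\<sigma> i = a) * w i)" for a
    unfolding class_weight_def using assms(1)
    by (simp add: sum.inter_filter of_bool_def if_distrib[of "\<lambda>x. x * _"] cong: if_cong)
  have "(\<Sum>a\<in>C. (class_weight B w \<sigma> a)\<^sup>2) =
      (\<Sum>a\<in>C. \<Sum>i\<in>B. \<Sum>j\<in>B. of_bool (\<sigma> i = a \<and> \<sigma> j = a) * (w i * w j))"
    unfolding cw power2_eq_square sum_product by (intro sum.cong refl) (auto simp: of_bool_def)
  also have "\<dots> = (\<Sum>i\<in>B. \<Sum>j\<in>B. \<Sum>a\<in>C. of_bool (\<sigma> i = a \<and> \<sigma> j = a) * (w i * w j))"
    by (subst sum.swap, rule sum.cong[OF refl], rule sum.swap)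
  also have "\<dots> = (\<Sum>i\<in>B. \<Sum>j\<in>B. of_bool (i \<noteq> j \<and> \<sigma> i = \<sigma> j) * (w i * w j) + of_bool (i = j) * (w i * w j))"
  proof (intro sum.cong refl)
    fix i j assume "i \<in> B" "j \<in> B"
    then have "\<sigma> i \<in> C" using assms by auto
    have "(\<Sum>a\<in>C. of_bool (\<sigma> i = a \<and> \<sigma> j = a) * (w i * w j)) =
      (\<Sum>a\<in>C. if a = \<sigma> i then of_bool (\<sigma> i = \<sigma> j) * (w i * w j) else 0)"
      by (intro sum.cong) auto
    also have "\<dots> = of_bool (\<sigma> i = \<sigma> j) * (w i * w j)"
      using \<open>\<sigma> i \<in> C\<close> assms(2) by simp
    finally show "(\<Sum>a\<in>C. of_bool (\<sigma> i = a \<and> \<sigma> j = a) * (w i * w j)) =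
      of_bool (i \<noteq> j \<and> \<sigma> i = \<sigma> j) * (w i * w j) + of_bool (i = j) * (w i * w j)" by auto
  qed
  also have "\<dots> = inside B w \<sigma> + (\<Sum>i\<in>B. \<Sum>j\<in>B. of_bool (i = j) * (w i * w j))"
    by (simp add: inside_def sum.distrib)
  also have "(\<Sum>i\<in>B. \<Sum>j\<in>B. of_bool (i = j) * (w i * w j)) = (\<Sum>i\<in>B. \<Sum>j\<in>B. if i = j then (w i)\<^sup>2 else 0)"
    by (intro sum.cong) (auto simp: power2_eq_square)
  also have "\<dots> = (\<Sum>i\<in>B. (w i)\<^sup>2)" using assms(1) by simp
  finally show ?thesis by simp
qed

text \<open>\<open>supp i\<close> stands for the colours well represented in class \<open>i\<close>.
  The tolerance has the form \<open>\<Lambda> * c\<close> because an exchange bounds a weight times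
  a difference, and the weight is at least \<open>c\<close>; division leaves the additive error
  \<open>\<Lambda>\<close>. By \<open>2 * \<Lambda> < c\<close>, two such errors together do not
  outweigh a single class.\<close>

locale near_optimal_supports =
  fixes B :: "nat set" and k :: nat and w :: "nat \<Rightarrow> real" and supp :: "nat \<Rightarrow> nat set" and \<Lambda> c :: real
  assumes finB: "finite B" and kB: "{1..k} \<subseteq> B"
    and wc: "\<And>i. i \<in> B \<Longrightarrow> c \<le> w i" and c: "0 < c" "2 * \<Lambda> < c" "0 \<le> \<Lambda>"
    and supp: "\<And>i. i \<in> B \<Longrightarrow> supp i \<noteq> {} \<and> supp i \<subseteq> {1..k}"
    and near_opt: "\<And>\<sigma> \<tau>. \<sigma> \<in> Pi B supp \<Longrightarrow> \<tau> \<in> B \<rightarrow> {1..k} \<Longrightarrow> inside B w \<sigma> \<le> inside B w \<tau> + \<Lambda> * c"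
begin

text \<open>Among the choices from the supports, the weight of class \<open>a\<close> lies between
  this value, which counts what is forced into \<open>a\<close>, and \<open>full_weight a\<close>,
  which counts what may go there.\<close>

definition integral_weight :: "nat \<Rightarrow> real" where
  "integral_weight a = (\<Sum>i | i \<in> B \<and> supp i = {a}. w i)"

definition full_weight :: "nat \<Rightarrow> real" where
  "full_weight a = (\<Sum>i | i \<in> B \<and> a \<in> supp i. w i)"

lemma w_pos: "i \<in> B \<Longrightarrow> 0 < w i"
  using wc c by force

lemma two_class_exchange:
  assumes \<sigma>: "\<sigma> \<in> Pi B supp" and \<tau>: "\<tau> \<in> B \<rightarrow> {1..k}" and ab: "a \<in> {1..k}" "b \<in> {1..k}" "a \<noteq> b"
    and same: "\<And>x. x \<noteq> a \<Longrightarrow> x \<noteq> b \<Longrightarrow> class_weight B w \<tau> x = class_weight B w \<sigma> x"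
  shows "(class_weight B w \<sigma> a)\<^sup>2 + (class_weight B w \<sigma> b)\<^sup>2
     \<le> (class_weight B w \<tau> a)\<^sup>2 + (class_weight B w \<tau> b)\<^sup>2 + \<Lambda> * c"
proof -
  have \<sigma>': "\<sigma> \<in> B \<rightarrow> {1..k}" using \<sigma> supp by (fastforce simp: Pi_iff)
  have split: "(\<Sum>x\<in>{1..k}. f x) = f a + f b + (\<Sum>x\<in>{1..k} - {a} - {b}. f x)" for f :: "nat \<Rightarrow> real"
  proof -
    have "sum f {1..k} = f a + sum f ({1..k} - {a})" using ab by (intro sum.remove) auto
    moreover have "sum f ({1..k} - {a}) = f b + sum f ({1..k} - {a} - {b})" using ab by (intro sum.remove) auto
    ultimately show ?thesis by simp
  qed
  have "(\<Sum>x\<in>{1..k} - {a} - {b}. (class_weight B w \<tau> x)\<^sup>2) = (\<Sum>x\<in>{1..k} - {a} - {b}. (class_weight B w \<sigma> x)\<^sup>2)"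
    using same by (intro sum.cong) auto
  then show ?thesis
    using near_opt[OF \<sigma> \<tau>]
    unfolding inside_conv_class_weight[OF finB finite_atLeastAtMost \<sigma>']
      inside_conv_class_weight[OF finB finite_atLeastAtMost \<tau>] split by linarith
qed

text \<open>Moving \<open>i\<close> trades its products with the rest of its class for its products
  with class \<open>b\<close>. The change is \<open>2 * w i\<close> times the difference of the two
  weights, and \<open>c \<le> w i\<close> allows division.\<close>

lemma move_one_class:
  assumes \<sigma>: "\<sigma> \<in> Pi B supp" and i: "i \<in> B" and b: "b \<in> {1..k}" "b \<noteq> \<sigma> i"
  shows "class_weight B w \<sigma> (\<sigma> i) - w i \<le> class_weight B w \<sigma> b + \<Lambda>"
proof -
  define \<tau> where "\<tau> = \<sigma>(i := b)"
  have \<sigma>': "\<sigma> \<in> B \<rightarrow> {1..k}" using \<sigma> supp by (fastforce simp: Pi_iff)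
  then have \<tau>: "\<tau> \<in> B \<rightarrow> {1..k}" using b by (auto simp: \<tau>_def)
  have a: "\<sigma> i \<in> {1..k}" using \<sigma>' i by auto
  have "{j \<in> B. \<sigma> j = \<sigma> i} = insert i {j \<in> B. \<tau> j = \<sigma> i}" "i \<notin> {j \<in> B. \<tau> j = \<sigma> i}"
    using b i by (auto simp: \<tau>_def)
  then have 1: "class_weight B w \<sigma> (\<sigma> i) = w i + class_weight B w \<tau> (\<sigma> i)"
    unfolding class_weight_def using finB by simp
  have "{j \<in> B. \<tau> j = b} = insert i {j \<in> B. \<sigma> j = b}" "i \<notin> {j \<in> B. \<sigma> j = b}"
    using b i by (auto simp: \<tau>_def)
  then have 2: "class_weight B w \<tau> b = w i + class_weight B w \<sigma> b"
    unfolding class_weight_def using finB by simp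
  have "class_weight B w \<tau> x = class_weight B w \<sigma> x" if "x \<noteq> \<sigma> i" "x \<noteq> b" for x
    unfolding class_weight_def using that by (intro sum.cong) (auto simp: \<tau>_def)
  from two_class_exchange[OF \<sigma> \<tau> a b(1) b(2)[symmetric] this] 
  have "2 * (w i * (class_weight B w \<tau> (\<sigma> i) - class_weight B w \<sigma> b)) \<le> \<Lambda> * c"
    unfolding 1 2 by (simp add: power2_eq_square algebra_simps)
  also have "\<dots> \<le> \<Lambda> * w i" using c wc[OF i] by (intro mult_left_mono) auto
  finally have "w i * (2 * (class_weight B w \<tau> (\<sigma> i) - class_weight B w \<sigma> b)) \<le> w i * \<Lambda>"
    by (simp add: algebra_simps)
  then have "2 * (class_weight B w \<tau> (\<sigma> i) - class_weight B w \<sigma> b) \<le> \<Lambda>"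
    using w_pos[OF i] by (rule mult_left_le_imp_le)
  then have "class_weight B w \<tau> (\<sigma> i) - class_weight B w \<sigma> b \<le> \<Lambda>" using c(3) by argo
  then show ?thesis unfolding 1 by simp
qed

text \<open>Compare the colouring that puts as much as possible into \<open>a\<close> and as little as possible into \<open>b\<close>.\<close>

lemma full_weight_le:
  assumes i: "i \<in> B" "a \<in> supp i" and b: "b \<in> {1..k}" "b \<noteq> a"
  shows "full_weight a - w i \<le> integral_weight b + \<Lambda>"
proof -
  define \<sigma> where "\<sigma> j = (if a \<in> supp j then a else if supp j = {b} then b else SOME x. x \<in> supp j - {b})" for j
  have some: "(SOME x. x \<in> supp j - {b}) \<in> supp j - {b}" if "j \<in> B" "supp j \<noteq> {b}" for j
  proof -
    have "\<exists>x. x \<in> supp j - {b}" using supp[OF that(1)] that(2) by (metis Diff_iff ex_in_conv singleton_iff subsetI subset_singletonD)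
    then show ?thesis by (rule someI_ex)
  qed
  have \<sigma>: "\<sigma> \<in> Pi B supp" using some by (auto simp: \<sigma>_def)
  have "\<sigma> i = a" using i by (simp add: \<sigma>_def)
  then have "class_weight B w \<sigma> a - w i \<le> class_weight B w \<sigma> b + \<Lambda>"
    using move_one_class[OF \<sigma> i(1) b(1)] b(2) by simp
  moreover have "full_weight a \<le> class_weight B w \<sigma> a"
    unfolding class_weight_def full_weight_def using finB w_pos
    by (intro sum_mono2) (auto simp: \<sigma>_def less_imp_le)
  moreover have "class_weight B w \<sigma> b \<le> integral_weight b"
    unfolding class_weight_def integral_weight_def using finB w_pos some b
    by (intro sum_mono2) (auto simp: \<sigma>_def less_imp_le split: if_splits)
  ultimately show ?thesis by linarith
qed

lemma integral_weight_add_le_full_weight: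
  assumes "S \<subseteq> B" "\<And>i. i \<in> S \<Longrightarrow> a \<in> supp i \<and> supp i \<noteq> {a}"
  shows "integral_weight a + (\<Sum>i\<in>S. w i) \<le> full_weight a"
proof -
  have "integral_weight a + (\<Sum>i\<in>S. w i) = (\<Sum>i\<in>{i \<in> B. supp i = {a}} \<union> S. w i)"
    unfolding integral_weight_def using assms finB
    by (subst sum.union_disjoint) (auto intro: finite_subset)
  also have "\<dots> \<le> full_weight a"
    unfolding full_weight_def using assms finB w_pos
    by (intro sum_mono2) (auto simp: less_imp_le)
  finally show ?thesis .
qed

text \<open>Approximate form of the second stability condition. The partial index is counted in
  \<open>full_weight a\<close> but not in \<open>integral_weight a\<close>, and so pays for the term
  \<open>w i\<close> lost in \<open>full_weight_le\<close>.\<close>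

lemma partial_integral_weight_le:
  assumes "i \<in> B" "a \<in> supp i" "supp i \<noteq> {a}" "b \<in> {1..k}"
  shows "integral_weight a \<le> integral_weight b + \<Lambda>"
proof (cases "b = a")
  case False
  then show ?thesis
    using full_weight_le[OF assms(1,2,4)] integral_weight_add_le_full_weight[of "{i}" a] assms by simp
qed (use c in simp)

text \<open>The first stability condition, without error. With \<open>b\<close> a second colour of
  \<open>i\<close>, the integral weights of \<open>a\<close> and \<open>b\<close> differ by at most
  \<open>\<Lambda>\<close>, as \<open>i\<close> is partial in both. A second partial index
  \<open>j\<close> would keep its weight in class \<open>a\<close> after \<open>i\<close> has moved
  to \<open>b\<close>, so \<open>w j\<close> would be at most \<open>2 * \<Lambda>\<close>, which is
  less than \<open>c\<close>.\<close>

lemma partial_unique: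
  assumes i: "i \<in> B" "a \<in> supp i" "supp i \<noteq> {a}" and j: "j \<in> B" "a \<in> supp j" "supp j \<noteq> {a}"
  shows "i = j"
proof (rule ccontr)
  assume "i \<noteq> j"
  obtain b where b: "b \<in> supp i" "b \<noteq> a" using i by blast
  have bk: "b \<in> {1..k}" using supp[OF i(1)] b by auto
  have "integral_weight a + (w i + w j) \<le> full_weight a"
    using integral_weight_add_le_full_weight[of "{i, j}" a] i j \<open>i \<noteq> j\<close> by auto
  then have "integral_weight a + w j \<le> integral_weight b + \<Lambda>"
    using full_weight_le[OF i(1,2) bk b(2)] by linarith
  moreover have "integral_weight b \<le> integral_weight a + \<Lambda>"
  proof (rule partial_integral_weight_le[OF i(1) b(1)])
    show "supp i \<noteq> {b}" using i(2) b(2) by auto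
    show "a \<in> {1..k}" using supp[OF i(1)] i(2) by blast
  qed
  ultimately show False using wc[OF j(1)] c by linarith
qed


text \<open>If nothing is forced into \<open>a\<close>, some choice from the supports avoids
  \<open>a\<close>. Then the \<open>k\<close> indices in \<open>{1..k}\<close> share
  \<open>k - 1\<close> colours, two of them collide, and moving one into \<open>a\<close>, which has
  integral weight 0, would be profitable.\<close>

lemma integral_weight_ge:
  assumes a: "a \<in> {1..k}"
  shows "integral_weight a \<ge> c"
proof -
  have "\<exists>i\<in>B. supp i = {a}"
  proof (rule ccontr)
    assume no: "\<not> ?thesis"
    then have J0: "integral_weight a = 0" unfolding integral_weight_def by (intro sum.neutral) auto
    have "\<forall>i\<in>B. \<exists>x. x \<in> supp i \<and> x \<noteq> a" using no supp by blast
    then obtain \<sigma> where \<sigma>: "\<And>i. i \<in> B \<Longrightarrow> \<sigma> i \<in> supp i \<and> \<sigma> i \<noteq> a" by metis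
    have "\<sigma> ` {1..k} \<subseteq> {1..k} - {a}" using \<sigma> supp kB by blast
    then have "card (\<sigma> ` {1..k}) \<le> card ({1..k} - {a})" by (intro card_mono) auto
    also have "\<dots> < card {1..k}" using a by (intro card_Diff1_less) auto
    finally have "\<not> inj_on \<sigma> {1..k}" using card_image by fastforce
    then obtain i j where ij: "i \<in> {1..k}" "j \<in> {1..k}" "i \<noteq> j" "\<sigma> i = \<sigma> j" by (auto simp: inj_on_def)
    have B: "i \<in> B" "j \<in> B" using ij kB by auto
    have "w i + w j = (\<Sum>x\<in>{i, j}. w x)" using ij by simp
    also have "\<dots> \<le> full_weight (\<sigma> i)"
      unfolding full_weight_def using finB B \<sigma>[OF B(1)] \<sigma>[OF B(2)] ij w_pos
      by (intro sum_mono2) (auto simp: less_imp_le)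
    finally have "w j \<le> 0 + \<Lambda>"
      using full_weight_le[OF B(1), of "\<sigma> i" a] \<sigma>[OF B(1)] a J0 by force
    then show False using wc[OF B(2)] c by linarith
  qed
  then obtain i where i: "i \<in> B" "supp i = {a}" by auto
  have "w i = (\<Sum>x\<in>{i}. w x)" by simp
  also have "\<dots> \<le> integral_weight a"
    unfolding integral_weight_def using i finB w_pos by (intro sum_mono2) (auto simp: less_imp_le)
  finally show ?thesis using wc[OF i(1)] by linarith
qed

text \<open>Approximate form of the third stability condition. Let \<open>i\<close> take colour
  \<open>a\<close>. By uniqueness of partial indices, class \<open>a\<close> then consists of
  \<open>i\<close> and the integral part of \<open>a\<close>, while class \<open>b\<close> is
  exactly the integral part of \<open>b\<close>. Moving the integral part of \<open>a\<close> over
  to \<open>b\<close> isolates \<open>i\<close>; the gain is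
  \<open>2 * integral_weight a * (w i - integral_weight b)\<close>, and
  \<open>integral_weight a\<close> is at least \<open>c\<close>.\<close>

lemma partial_weight_le:
  assumes i: "i \<in> B" "a \<in> supp i" "supp i \<noteq> {a}" and d: "d \<in> {1..k}"
  shows "w i \<le> integral_weight d + 2 * \<Lambda>"
proof -
  obtain b where b: "b \<in> supp i" "b \<noteq> a" using i by blast
  have bk: "b \<in> {1..k}" and ak: "a \<in> {1..k}" using supp[OF i(1)] b i by auto
  have ib: "supp i \<noteq> {b}" using i b by auto
  have "\<forall>j\<in>B. \<exists>x. x \<in> supp j" using supp by blast
  then obtain \<sigma>0 where \<sigma>0: "\<And>j. j \<in> B \<Longrightarrow> \<sigma>0 j \<in> supp j" by metis
  define \<sigma> where "\<sigma> = \<sigma>0(i := a)"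
  have \<sigma>: "\<sigma> \<in> Pi B supp" using \<sigma>0 i by (auto simp: \<sigma>_def)
  define \<tau> where "\<tau> j = (if \<sigma> j = a \<and> j \<noteq> i then b else \<sigma> j)" for j
  have \<sigma>': "\<sigma> \<in> B \<rightarrow> {1..k}" using \<sigma> supp by (fastforce simp: Pi_iff)
  have \<tau>: "\<tau> \<in> B \<rightarrow> {1..k}" using \<sigma>' bk by (auto simp: \<tau>_def)
  have sa: "{j \<in> B. \<sigma> j = a} = insert i {j \<in> B. supp j = {a}}"
  proof (intro set_eqI iffI)
    fix j assume "j \<in> {j \<in> B. \<sigma> j = a}"
    then show "j \<in> insert i {j \<in> B. supp j = {a}}"
      using partial_unique[OF i, of j] \<sigma> by (auto simp: Pi_iff)
  next
    fix j assume "j \<in> insert i {j \<in> B. supp j = {a}}"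
    then show "j \<in> {j \<in> B. \<sigma> j = a}" using \<sigma> i by (auto simp: Pi_iff \<sigma>_def)
  qed
  have sb: "{j \<in> B. \<sigma> j = b} = {j \<in> B. supp j = {b}}"
  proof (intro set_eqI iffI)
    fix j assume "j \<in> {j \<in> B. \<sigma> j = b}"
    then show "j \<in> {j \<in> B. supp j = {b}}"
      using partial_unique[OF i(1) b(1) ib, of j] \<sigma> b by (auto simp: Pi_iff \<sigma>_def split: if_splits)
  next
    fix j assume "j \<in> {j \<in> B. supp j = {b}}"
    then show "j \<in> {j \<in> B. \<sigma> j = b}" using \<sigma> by (auto simp: Pi_iff)
  qed
  have 1: "class_weight B w \<sigma> a = w i + integral_weight a"
    unfolding class_weight_def integral_weight_def sa using finB i by simp
  have 2: "class_weight B w \<sigma> b = integral_weight b"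
    unfolding class_weight_def integral_weight_def sb by simp
  have "\<sigma> i = a" by (simp add: \<sigma>_def)
  then have "\<tau> j = a \<longleftrightarrow> j = i" for j using b(2) by (cases "j = i") (simp_all add: \<tau>_def)
  then have "{j \<in> B. \<tau> j = a} = {i}" using i(1) by auto
  then have 3: "class_weight B w \<tau> a = w i" unfolding class_weight_def by simp
  have "{j \<in> B. \<tau> j = b} = {j \<in> B. supp j = {a}} \<union> {j \<in> B. supp j = {b}}"
  proof -
    have "\<sigma> i = a" by (simp add: \<sigma>_def)
    then have "{j \<in> B. \<tau> j = b} = ({j \<in> B. \<sigma> j = a} - {i}) \<union> {j \<in> B. \<sigma> j = b}"
      using b(2) by (intro set_eqI, rename_tac j, case_tac "j = i"; case_tac "\<sigma> j = a"; simp add: \<tau>_def)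
    then show ?thesis unfolding sa sb using i(3) by auto
  qed
  then have 4: "class_weight B w \<tau> b = integral_weight a + integral_weight b"
    unfolding class_weight_def integral_weight_def using finB b
    by (simp add: sum.union_disjoint disjoint_iff)
  have "class_weight B w \<tau> x = class_weight B w \<sigma> x" if "x \<noteq> a" "x \<noteq> b" for x
    unfolding class_weight_def using that by (intro sum.cong) (auto simp: \<tau>_def)
  from two_class_exchange[OF \<sigma> \<tau> ak bk b(2)[symmetric] this]
  have "integral_weight a * (2 * (w i - integral_weight b)) \<le> \<Lambda> * c"
    unfolding 1 2 3 4 by (simp add: power2_eq_square algebra_simps)
  also have "\<dots> \<le> integral_weight a * \<Lambda>"
    using integral_weight_ge[OF ak] c by (simp add: mult.commute mult_left_mono)
  finally have "2 * (w i - integral_weight b) \<le> \<Lambda>" using integral_weight_ge[OF ak] c by simp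
  then have "w i - integral_weight b \<le> \<Lambda>" using c(3) by argo
  moreover have "integral_weight b \<le> integral_weight d + \<Lambda>"
    by (rule partial_integral_weight_le[OF i(1) b(1) ib d])
  ultimately show ?thesis using c by linarith
qed

text \<open>Needed for the fourth stability condition in a partial class: when an integral
  \<open>V i\<close> is removed, the partial piece that stays must not exceed the \<open>V i\<close>
  that left. The bound of \<open>full_weight a - w i\<close> by another integral part, which is
  about that of \<open>a\<close>, says this.\<close>

lemma partial_le_integral:
  assumes j: "j \<in> B" "a \<in> supp j" "supp j \<noteq> {a}" and i: "i \<in> B" "supp i = {a}"
  shows "w j \<le> w i + 2 * \<Lambda>"
proof -
  obtain b where b: "b \<in> supp j" "b \<noteq> a" using j by blast
  have bk: "b \<in> {1..k}" and ak: "a \<in> {1..k}" using supp[OF j(1)] b j by auto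
  have "integral_weight a + w j \<le> full_weight a"
    using integral_weight_add_le_full_weight[of "{j}" a] j by simp
  moreover have "full_weight a - w i \<le> integral_weight b + \<Lambda>"
    using full_weight_le[OF i(1) _ bk b(2)] i by simp
  moreover have "integral_weight b \<le> integral_weight a + \<Lambda>"
    using b j by (intro partial_integral_weight_le[OF j(1) b(1) _ ak]) auto
  ultimately show ?thesis by linarith
qed

text \<open>Source of the bound \<open>(1 - \<epsilon>)\<close> times the size of class
  \<open>k\<close>. If the integral weight of \<open>b\<close> were smaller, no index in
  \<open>{1..k}\<close> could be partial, by \<open>partial_weight_le\<close>, nor integral in
  \<open>b\<close>. So \<open>k\<close> indices would be integral in \<open>k - 1\<close> classes,
  and a class with two of them could profitably give one to \<open>b\<close>.\<close>

lemma integral_weight_lower: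
  assumes m: "\<And>i. i \<in> {1..k} \<Longrightarrow> m \<le> w i" and b: "b \<in> {1..k}"
  shows "integral_weight b \<ge> m - 3 * \<Lambda>"
proof (rule ccontr)
  assume "\<not> ?thesis"
  then have less: "integral_weight b < m - 3 * \<Lambda>" by simp
  have int: "\<exists>a. supp i = {a} \<and> a \<noteq> b \<and> a \<in> {1..k}" if i: "i \<in> {1..k}" for i
  proof -
    have iB: "i \<in> B" using that kB by auto
    obtain a where a: "a \<in> supp i" using supp[OF iB] by auto
    have sa: "supp i = {a}"
    proof (rule ccontr)
      assume "supp i \<noteq> {a}"
      then show False using partial_weight_le[OF iB a _ b] m[OF i] less c by linarith
    qed
    have "a \<noteq> b"
    proof
      assume "a = b"
      then have "(\<Sum>x\<in>{i}. w x) \<le> integral_weight b"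
        unfolding integral_weight_def using sa iB finB w_pos by (intro sum_mono2) (auto simp: less_imp_le)
      then show False using m[OF i] less c by simp
    qed
    then show ?thesis using sa supp[OF iB] by auto
  qed
  then obtain \<sigma> where \<sigma>: "\<And>i. i \<in> {1..k} \<Longrightarrow> supp i = {\<sigma> i} \<and> \<sigma> i \<noteq> b \<and> \<sigma> i \<in> {1..k}" by metis
  have "\<sigma> ` {1..k} \<subseteq> {1..k} - {b}" using \<sigma> by blast
  then have "card (\<sigma> ` {1..k}) \<le> card ({1..k} - {b})" by (intro card_mono) auto
  also have "\<dots> < card {1..k}" using b by (intro card_Diff1_less) auto
  finally have "\<not> inj_on \<sigma> {1..k}" using card_image by fastforce
  then obtain i j where ij: "i \<in> {1..k}" "j \<in> {1..k}" "i \<noteq> j" "\<sigma> i = \<sigma> j" by (auto simp: inj_on_def)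
  have B: "i \<in> B" "j \<in> B" using ij kB by auto
  have "w i + w j = (\<Sum>x\<in>{i, j}. w x)" using ij by simp
  also have "\<dots> \<le> full_weight (\<sigma> i)"
    unfolding full_weight_def using finB B \<sigma>[OF ij(1)] \<sigma>[OF ij(2)] ij w_pos
    by (intro sum_mono2) (auto simp: less_imp_le)
  finally have "w j \<le> integral_weight b + \<Lambda>"
    using full_weight_le[OF B(1), of "\<sigma> i" b] \<sigma>[OF ij(1)] b by force
  then show False using m[OF ij(2)] less c by linarith
qed

end

subsection \<open>Trimming to exact stability\<close>

text \<open>
  Cutting \<open>2 * \<Delta>\<close> off the largest cell of a partial class brings the class down to at most \<open>\<mu>\<close>, and each of
  its cells down to at most the size of the integral classes sharing its colour.
\<close>

lemma stable_trimming:
  fixes p :: "nat \<Rightarrow> nat \<Rightarrow> nat" and supp :: "nat \<Rightarrow> nat set" and \<Delta> k :: nat and B :: "nat set"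
  defines "s \<equiv> \<lambda>i. \<Sum>a\<in>{1..k}. p i a"
    and "I \<equiv> \<lambda>a. \<Sum>i | i \<in> B \<and> supp i = {a}. \<Sum>a\<in>{1..k}. p i a"
  assumes finB: "finite B" and k: "1 \<le> k"
    and supp: "\<And>i. i \<in> B \<Longrightarrow> supp i \<noteq> {} \<and> supp i \<subseteq> {1..k}"
    and pos: "\<And>i a. i \<in> B \<Longrightarrow> a \<in> {1..k} \<Longrightarrow> 0 < p i a \<longleftrightarrow> a \<in> supp i"
    and uniq: "\<And>i j a. i \<in> B \<Longrightarrow> a \<in> supp i \<Longrightarrow> supp i \<noteq> {a} \<Longrightarrow> j \<in> B \<Longrightarrow> a \<in> supp j \<Longrightarrow> supp j \<noteq> {a} \<Longrightarrow> i = j"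
    and ne: "\<And>a. a \<in> {1..k} \<Longrightarrow> \<exists>i\<in>B. supp i = {a}"
    and part_I: "\<And>i a b. i \<in> B \<Longrightarrow> a \<in> supp i \<Longrightarrow> supp i \<noteq> {a} \<Longrightarrow> b \<in> {1..k} \<Longrightarrow> I a \<le> I b + \<Delta>"
    and part_s: "\<And>i a b. i \<in> B \<Longrightarrow> a \<in> supp i \<Longrightarrow> supp i \<noteq> {a} \<Longrightarrow> b \<in> {1..k} \<Longrightarrow> s i \<le> I b + \<Delta>"
    and int_I: "\<And>i a b. i \<in> B \<Longrightarrow> supp i = {a} \<Longrightarrow> b \<in> {1..k} \<Longrightarrow> b \<noteq> a \<Longrightarrow> I a \<le> I b + s i + \<Delta>"
    and part_int: "\<And>i j a. j \<in> B \<Longrightarrow> a \<in> supp j \<Longrightarrow> supp j \<noteq> {a} \<Longrightarrow> i \<in> B \<Longrightarrow> supp i = {a} \<Longrightarrow> s j \<le> s i + \<Delta>"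
    and big: "\<And>i. i \<in> B \<Longrightarrow> (card B + 2 * k) * \<Delta> < s i"
  obtains q \<mu> where
    "\<And>i a. i \<in> B \<Longrightarrow> a \<in> {1..k} \<Longrightarrow> q i a \<le> p i a"
    "\<And>i a. i \<in> B \<Longrightarrow> a \<in> {1..k} \<Longrightarrow> 0 < q i a \<longleftrightarrow> a \<in> supp i"
    "\<And>i. i \<in> B \<Longrightarrow> s i \<le> (\<Sum>a\<in>{1..k}. q i a) + 2 * \<Delta>"
    "\<And>b. b \<in> {1..k} \<Longrightarrow> \<mu> \<le> (\<Sum>i | i \<in> B \<and> supp i = {b}. \<Sum>a\<in>{1..k}. q i a)"
    "\<And>i a. i \<in> B \<Longrightarrow> a \<in> supp i \<Longrightarrow> supp i \<noteq> {a} \<Longrightarrow>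
       (\<Sum>i | i \<in> B \<and> supp i = {a}. \<Sum>a\<in>{1..k}. q i a) = \<mu>"
    "\<And>i a. i \<in> B \<Longrightarrow> a \<in> supp i \<Longrightarrow> supp i \<noteq> {a} \<Longrightarrow> (\<Sum>a\<in>{1..k}. q i a) \<le> \<mu>"
    "\<And>i a. i \<in> B \<Longrightarrow> supp i = {a} \<Longrightarrow> (\<Sum>j\<in>B - {i}. q j a) \<le> \<mu>"
proof -
  \<comment> \<open>Integral parts can only shrink, so the common size for the partial classes is
    the least one.\<close>
  define \<mu> where "\<mu> = Min (I ` {1..k})"
  have \<mu>_le: "\<mu> \<le> I a" if "a \<in> {1..k}" for a unfolding \<mu>_def using that by (intro Min_le) auto
  have "\<mu> \<in> I ` {1..k}" unfolding \<mu>_def using k by (intro Min_in) auto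
  then obtain b0 where b0: "b0 \<in> {1..k}" "I b0 = \<mu>" by auto
  define C where "C a = {i \<in> B. supp i = {a}}" for a
  have finC: "finite (C a)" for a using finB by (simp add: C_def)
  have I_C: "I a = (\<Sum>i\<in>C a. s i)" for a unfolding I_def s_def C_def ..
  define part where "part a \<longleftrightarrow> (\<exists>j\<in>B. a \<in> supp j \<and> supp j \<noteq> {a})" for a
  \<comment> \<open>The largest remainder after one member of the integral part is removed, which is
    what the fourth stability condition bounds when the class has no partial piece.\<close>
  define D where "D a = Max ((\<lambda>i. I a - s i) ` C a)" for a
  have D_ge: "I a - s i \<le> D a" if "i \<in> C a" for a i unfolding D_def using that finC by (intro Max_ge) auto
  have D_in: "\<exists>i\<in>C a. D a = I a - s i" if "a \<in> {1..k}" for a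
  proof -
    have "C a \<noteq> {}" using ne[OF that] by (auto simp: C_def)
    then have "D a \<in> (\<lambda>i. I a - s i) ` C a" unfolding D_def using finC by (intro Max_in) auto
    then show ?thesis by auto
  qed
  have D_le: "D a \<le> \<mu> + \<Delta>" if a: "a \<in> {1..k}" for a
  proof -
    obtain i where i: "i \<in> C a" "D a = I a - s i" using D_in[OF a] by blast
    show ?thesis
    proof (cases "a = b0")
      case True
      then show ?thesis using i b0 by simp
    next
      case False
      have "I a \<le> I b0 + s i + \<Delta>" using i(1) False b0 by (intro int_I) (auto simp: C_def)
      then show ?thesis using i b0 by simp
    qed
  qed
  define pick where "pick a = (SOME i. i \<in> C a)" for a
  have pick: "pick a \<in> C a" if "a \<in> {1..k}" for a
    unfolding pick_def using ne[OF that] by (intro someI_ex[of "\<lambda>i. i \<in> C a"]) (auto simp: C_def)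
  \<comment> \<open>In a partial class the integral part has to become exactly \<open>\<mu>\<close>,
    so one member absorbs the whole surplus. In an integral class every member is cut: whichever one
    is removed, another still carries the cut. Subtraction is truncated, so nothing happens where
    \<open>D a \<le> \<mu>\<close>.\<close>
  define e where "e a i = (if part a then (if i = pick a then I a - \<mu> else 0) else D a - \<mu>)" for a i
  have e_le: "e a i \<le> \<Delta>" if a: "a \<in> {1..k}" for a i
  proof (cases "part a")
    case True
    then obtain j where "j \<in> B" "a \<in> supp j" "supp j \<noteq> {a}" by (auto simp: part_def)
    then have "I a \<le> I b0 + \<Delta>" using b0 by (intro part_I) auto
    then have "I a - \<mu> \<le> \<Delta>" using b0(2) by linarith
    then show ?thesis using True by (simp add: e_def)
  next
    case False
    then show ?thesis using D_le[OF a] by (simp add: e_def)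
  qed
  have big1: "card B * \<Delta> \<le> s i" "\<Delta> \<le> s i" "2 * k * \<Delta> < s i" if "i \<in> B" for i
  proof -
    have b: "card B * \<Delta> + 2 * k * \<Delta> < s i" using big[OF that] by (simp add: algebra_simps)
    have "\<Delta> \<le> card B * \<Delta>" using that finB by (cases "card B") auto
    then show "card B * \<Delta> \<le> s i" "\<Delta> \<le> s i" "2 * k * \<Delta> < s i" using b by linarith+
  qed
  \<comment> \<open>A cell of at least average size. As \<open>s i\<close> exceeds
    \<open>2 * k * \<Delta>\<close>, it survives a cut of \<open>2 * \<Delta>\<close>, so the
    support does not change.\<close>
  define col where "col i = (SOME a. a \<in> {1..k} \<and> s i \<le> k * p i a)" for i
  have col: "col i \<in> {1..k} \<and> s i \<le> k * p i (col i)" for i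
    unfolding col_def
  proof (rule someI_ex)
    have "Max (p i ` {1..k}) \<in> p i ` {1..k}" using k by (intro Max_in) auto
    then obtain a where a: "a \<in> {1..k}" "p i a = Max (p i ` {1..k})" by auto
    have "s i \<le> of_nat (card {1..k}) * p i a"
      unfolding s_def a(2) by (rule sum_bounded_above) auto
    then show "\<exists>a. a \<in> {1..k} \<and> s i \<le> k * p i a" using a(1) by auto
  qed
  define q where "q i a = (if supp i = {a} then p i a - e a i else if a = col i then p i a - 2 * \<Delta> else p i a)" for i a
  define T where "T i = (\<Sum>a\<in>{1..k}. q i a)" for i
  have s_int: "s i = p i a" and T_int: "T i = s i - e a i" and aC: "i \<in> B" "a \<in> {1..k}" "supp i = {a}" if "i \<in> C a" for i a
  proof -
    show i: "i \<in> B" "supp i = {a}" using that by (auto simp: C_def)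
    then show a: "a \<in> {1..k}" using supp by blast
    have p0: "p i x = 0" if "x \<in> {1..k} - {a}" for x using pos[OF i(1), of x] i that by auto
    have "s i = p i a + (\<Sum>x\<in>{1..k} - {a}. p i x)" unfolding s_def using a by (intro sum.remove) auto
    then show s: "s i = p i a" using p0 by simp
    have "T i = q i a + (\<Sum>x\<in>{1..k} - {a}. q i x)" unfolding T_def using a by (intro sum.remove) auto
    also have "(\<Sum>x\<in>{1..k} - {a}. q i x) = 0" using p0 by (intro sum.neutral) (auto simp: q_def)
    finally show "T i = s i - e a i" using i by (simp add: q_def s)
  qed
  have col_pos: "2 * \<Delta> < p i (col i)" if "i \<in> B" for i
  proof -
    have "k * (2 * \<Delta>) = 2 * k * \<Delta>" by simp
    also have "\<dots> < k * p i (col i)" using big1(3)[OF that] col[of i] by linarith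
    finally have "k * (2 * \<Delta>) < k * p i (col i)" .
    then show ?thesis by simp
  qed
  have T_part: "T i = s i - 2 * \<Delta>" "2 * \<Delta> \<le> s i" if "i \<in> B" "a \<in> supp i" "supp i \<noteq> {a}" for i a
  proof -
    have ns: "supp i \<noteq> {x}" for x using that by auto
    have "s i = p i (col i) + (\<Sum>x\<in>{1..k} - {col i}. p i x)" unfolding s_def using col[of i] by (intro sum.remove) auto
    moreover have "T i = q i (col i) + (\<Sum>x\<in>{1..k} - {col i}. q i x)" unfolding T_def using col[of i] by (intro sum.remove) auto
    moreover have "(\<Sum>x\<in>{1..k} - {col i}. q i x) = (\<Sum>x\<in>{1..k} - {col i}. p i x)"
      by (intro sum.cong) (auto simp: q_def ns)
    ultimately show "T i = s i - 2 * \<Delta>" "2 * \<Delta> \<le> s i" using col_pos[OF that(1)] by (auto simp: q_def ns)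
  qed
  have q1: "q i a \<le> p i a \<and> (0 < q i a \<longleftrightarrow> a \<in> supp i)" if i: "i \<in> B" and a: "a \<in> {1..k}" for i a
  proof (cases "supp i = {a}")
    case True
    then have "i \<in> C a" using i by (simp add: C_def)
    have "e a i < p i a"
    proof -
      have "\<Delta> < p i a" if "\<Delta> > 0"
      proof -
        have "\<Delta> \<le> 2 * k * \<Delta>" using k by (cases k) auto
        then show ?thesis using big1(3)[OF i] s_int[OF \<open>i \<in> C a\<close>] by linarith
      qed
      moreover have "0 < p i a" using pos[OF i a] True by simp
      ultimately show ?thesis using e_le[OF a, of i] by (cases "\<Delta> = 0") auto
    qed
    then show ?thesis using True by (simp add: q_def)
  next
    case False
    then show ?thesis using col_pos[OF i] pos[OF i a] by (auto simp: q_def)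
  qed
  have q2: "s i \<le> T i + 2 * \<Delta>" if i: "i \<in> B" for i
  proof -
    obtain a where a: "a \<in> supp i" "a \<in> {1..k}" using supp[OF i] by blast
    show ?thesis
    proof (cases "supp i = {a}")
      case True
      then have "i \<in> C a" using i by (simp add: C_def)
      then show ?thesis using T_int[of i a] e_le[OF a(2), of i] by linarith
    qed (use T_part[OF i a(1)] in linarith)
  qed
  have TC: "(\<Sum>i\<in>C a. T i) = (\<Sum>i\<in>C a. s i - e a i)" for a by (intro sum.cong refl T_int)
  have I'_part: "(\<Sum>i\<in>C a. T i) = \<mu>" if a: "a \<in> {1..k}" and "part a" for a
  proof -
    have "(\<Sum>i\<in>C a. T i) = T (pick a) + (\<Sum>i\<in>C a - {pick a}. T i)"
      using finC pick[OF a] by (intro sum.remove) auto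
    moreover have "I a = s (pick a) + (\<Sum>i\<in>C a - {pick a}. s i)"
      unfolding I_C using finC pick[OF a] by (intro sum.remove) auto
    moreover have "(\<Sum>i\<in>C a - {pick a}. T i) = (\<Sum>i\<in>C a - {pick a}. s i)"
      using T_int \<open>part a\<close> by (intro sum.cong) (auto simp: e_def)
    moreover have "T (pick a) = s (pick a) - (I a - \<mu>)"
      using T_int[OF pick[OF a]] \<open>part a\<close> by (simp add: e_def)
    moreover have "I a - \<mu> \<le> \<Delta>" using e_le[OF a, of "pick a"] \<open>part a\<close> by (simp add: e_def)
    moreover have "\<Delta> \<le> s (pick a)" using big1(2) aC(1)[OF pick[OF a]] by blast
    ultimately show ?thesis using \<mu>_le[OF a] by linarith
  qed
  have I'_ge: "\<mu> \<le> (\<Sum>i\<in>C a. T i)" if a: "a \<in> {1..k}" for a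
  proof (cases "part a")
    case False
    show ?thesis
    proof (cases "D a \<le> \<mu>")
      case True
      then have "(\<Sum>i\<in>C a. T i) = I a" unfolding TC I_C using False by (simp add: e_def)
      then show ?thesis using \<mu>_le[OF a] by simp
    next
      case D: False
      \<comment> \<open>All cuts together cost at most \<open>card B * \<Delta>\<close>, which a
        single member outweighs; so at least \<open>I a - s i = D a\<close> is left, and this is
        above \<open>\<mu>\<close>.\<close>
      obtain i where i: "i \<in> C a" "D a = I a - s i" using D_in[OF a] by blast
      have "I a \<le> (\<Sum>i\<in>C a. T i + \<Delta>)"
        unfolding I_C
      proof (rule sum_mono)
        fix i assume "i \<in> C a"
        then show "s i \<le> T i + \<Delta>" using T_int e_le[OF a, of i] by fastforce
      qed
      also have "\<dots> = (\<Sum>i\<in>C a. T i) + card (C a) * \<Delta>" by (simp add: sum.distrib)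
      also have "card (C a) * \<Delta> \<le> card B * \<Delta>"
        using finB by (intro mult_right_mono card_mono) (auto simp: C_def)
      also have "\<dots> \<le> s i" using big1(1) aC(1)[OF i(1)] by blast
      finally show ?thesis using i D by linarith
    qed
  qed (use I'_part[OF a] in simp)
  have q5: "(\<Sum>j\<in>B - {i}. q j a) \<le> \<mu>" if i: "i \<in> C a" for i a
  proof -
    note iB = aC[OF i]
    define Pa where "Pa = {j \<in> B. a \<in> supp j \<and> supp j \<noteq> {a}}"
    have "(\<Sum>j\<in>B - {i}. q j a) = (\<Sum>j\<in>(C a - {i}) \<union> Pa. q j a)"
    proof (rule sum.mono_neutral_right)
      show "\<forall>j\<in>B - {i} - (C a - {i} \<union> Pa). q j a = 0"
      proof
        fix j assume "j \<in> B - {i} - (C a - {i} \<union> Pa)"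
        then have "j \<in> B" "a \<notin> supp j" by (auto simp: C_def Pa_def)
        then show "q j a = 0" using q1[of j a] iB by auto
      qed
    qed (use finB iB in \<open>auto simp: C_def Pa_def\<close>)
    also have "\<dots> = (\<Sum>j\<in>C a - {i}. q j a) + (\<Sum>j\<in>Pa. q j a)"
      using finB by (intro sum.union_disjoint) (auto simp: C_def Pa_def)
    also have "(\<Sum>j\<in>C a - {i}. q j a) = (\<Sum>j\<in>C a - {i}. T j)"
      by (intro sum.cong refl) (auto simp: q_def T_int s_int C_def)
    finally have split: "(\<Sum>j\<in>B - {i}. q j a) = (\<Sum>j\<in>C a - {i}. T j) + (\<Sum>j\<in>Pa. q j a)" .
    have TI: "(\<Sum>j\<in>C a. T j) = T i + (\<Sum>j\<in>C a - {i}. T j)"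
      using finC i by (intro sum.remove) auto
    show ?thesis
    proof (cases "part a")
      case True
      then obtain j where j: "j \<in> B" "a \<in> supp j" "supp j \<noteq> {a}" by (auto simp: part_def)
      then have Pa: "Pa = {j}" unfolding Pa_def using uniq[OF j] j by blast
      \<comment> \<open>Here both halves of the cut \<open>2 * \<Delta>\<close> are used: one for
        the error in \<open>part_int\<close>, one for the amount that \<open>i\<close> itself may
        have lost.\<close>
      have "q j a \<le> T j" unfolding T_def using iB(2) by (intro member_le_sum) auto
      moreover have "s j \<le> s i + \<Delta>" using part_int[OF j iB(1,3)] .
      ultimately have "q j a \<le> T i"
        using T_part[OF j] T_int[OF i] e_le[OF iB(2), of i] by linarith
      then show ?thesis using split TI I'_part[OF iB(2) True] Pa by simp
    next
      case False
      then have Pa: "Pa = {}" by (auto simp: part_def Pa_def)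
      have Ii: "I a = s i + (\<Sum>j\<in>C a - {i}. s j)" unfolding I_C using finC i by (intro sum.remove) auto
      have Tle: "T j \<le> s j" if "j \<in> C a" for j using T_int[OF that] by simp
      show ?thesis
      proof (cases "D a \<le> \<mu>")
        case True
        have "(\<Sum>j\<in>C a - {i}. T j) \<le> (\<Sum>j\<in>C a - {i}. s j)" using Tle by (intro sum_mono) auto
        then show ?thesis using split Pa Ii D_ge[OF i] True by simp
      next
        case D: False
        show ?thesis
        proof (cases "C a - {i} = {}")
          case True
          show ?thesis unfolding split Pa True by simp
        next
          case False
          then obtain j where j: "j \<in> C a - {i}" by auto
          \<comment> \<open>The remaining member \<open>j\<close> has lost
            \<open>D a - \<mu>\<close>, so the rest is at most
            \<open>I a - s i - (D a - \<mu>)\<close>, hence at most \<open>\<mu>\<close>.\<close>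
          have 1: "(\<Sum>j\<in>C a - {i}. T j) = T j + (\<Sum>j\<in>C a - {i} - {j}. T j)"
            using finC j by (intro sum.remove) auto
          have 2: "(\<Sum>j\<in>C a - {i}. s j) = s j + (\<Sum>j\<in>C a - {i} - {j}. s j)"
            using finC j by (intro sum.remove) auto
          have 3: "(\<Sum>j\<in>C a - {i} - {j}. T j) \<le> (\<Sum>j\<in>C a - {i} - {j}. s j)" using Tle by (intro sum_mono) auto
          have 4: "T j = s j - (D a - \<mu>)" using T_int[of j a] j \<open>\<not> part a\<close> by (simp add: e_def)
          have 5: "D a - \<mu> \<le> s j"
            using D_le[OF iB(2)] big1(2)[of j] j by (auto simp: C_def)
          show ?thesis using split Pa Ii D_ge[OF i] D 1 2 3 4 5 by simp
        qed
      qed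
    qed
  qed
  show thesis
  proof (rule that[of q \<mu>])
    fix i a assume "i \<in> B" "a \<in> {1..k}"
    then show "q i a \<le> p i a" "0 < q i a \<longleftrightarrow> a \<in> supp i" using q1 by auto
  next
    fix i assume "i \<in> B"
    then show "s i \<le> (\<Sum>a\<in>{1..k}. q i a) + 2 * \<Delta>" using q2 unfolding T_def by blast
  next
    fix b assume "b \<in> {1..k}"
    then show "\<mu> \<le> (\<Sum>i | i \<in> B \<and> supp i = {b}. \<Sum>a\<in>{1..k}. q i a)"
      using I'_ge unfolding T_def C_def by blast
  next
    fix i a assume i: "i \<in> B" "a \<in> supp i" "supp i \<noteq> {a}"
    then have "part a" "a \<in> {1..k}" using supp[OF i(1)] by (auto simp: part_def)
    then show "(\<Sum>i | i \<in> B \<and> supp i = {a}. \<Sum>a\<in>{1..k}. q i a) = \<mu>"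
      using I'_part unfolding T_def C_def by blast
    have "s i \<le> I b0 + \<Delta>" using part_s[OF i] b0 by blast
    then show "(\<Sum>a\<in>{1..k}. q i a) \<le> \<mu>" using T_part[OF i] b0 unfolding T_def by linarith
  next
    fix i a assume "i \<in> B" "supp i = {a}"
    then show "(\<Sum>j\<in>B - {i}. q j a) \<le> \<mu>" by (intro q5) (auto simp: C_def)
  qed
qed

text \<open>Transfers the weight inequalities to actual vertex sets. They carry errors up to
  \<open>2 * \<Lambda>\<close>, and passing from class sizes to what \<open>X1\<close> leaves costs
  at most \<open>\<theta>\<close> in each comparison of weights; \<open>\<Delta>\<close> absorbs
  both. The trimming only prescribes cell sizes \<open>q\<close>, so arbitrary subsets of the cells
  with these sizes are kept.\<close>

lemma stable_deletion:
  fixes V :: "nat \<Rightarrow> 'a set" and f :: "'a \<Rightarrow> nat" and \<Delta> :: nat and \<theta> m :: real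
  defines "w \<equiv> \<lambda>i. real (card (V i))"
  assumes near: "near_optimal_supports B k w supp \<Lambda> c" and k: "1 \<le> k"
    and finV: "\<And>i. i \<in> B \<Longrightarrow> finite (V i)" and disj: "disjoint_family_on V B"
    and f: "\<And>i v. i \<in> B \<Longrightarrow> v \<in> V i \<Longrightarrow> f v \<in> {1..k}"
    and X1: "X1 \<subseteq> (\<Union>i\<in>B. V i)" "real (card X1) \<le> \<theta>"
    and cells: "\<And>i a. i \<in> B \<Longrightarrow> a \<in> {1..k} \<Longrightarrow> (\<exists>v\<in>V i - X1. f v = a) \<longleftrightarrow> a \<in> supp i"
    and \<Delta>: "2 * \<Lambda> + 2 * \<theta> \<le> real \<Delta>" "real ((card B + 2 * k) * \<Delta>) + \<theta> < c"
    and m: "\<And>i. i \<in> {1..k} \<Longrightarrow> m \<le> w i"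
  obtains X \<mu> where "X1 \<subseteq> X" "X \<subseteq> (\<Union>i\<in>B. V i)" "real (card X) \<le> \<theta> + 2 * real (card B * \<Delta>)"
    "\<forall>i\<in>B. \<forall>a\<in>{1..k}. (\<exists>v\<in>V i - X. f v = a) \<longleftrightarrow> a \<in> supp i"
    "\<forall>b\<in>{1..k}. \<mu> \<le> (\<Sum>i | i \<in> B \<and> supp i = {b}. card (V i - X))"
    "\<forall>b\<in>{1..k}. m - 3 * \<Lambda> - \<theta> - 2 * real (card B * \<Delta>) \<le> real (\<Sum>i | i \<in> B \<and> supp i = {b}. card (V i - X))"
    "\<forall>i\<in>B. \<forall>a\<in>supp i. supp i \<noteq> {a} \<longrightarrow>
       (\<Sum>i | i \<in> B \<and> supp i = {a}. card (V i - X)) = \<mu> \<and> card (V i - X) \<le> \<mu>"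
    "\<forall>i\<in>B. \<forall>a. supp i = {a} \<longrightarrow> (\<Sum>j\<in>B - {i}. card {v \<in> V j - X. f v = a}) \<le> \<mu>"
proof -
  interpret near_optimal_supports B k w supp \<Lambda> c by fact
  define p where "p i a = card {v \<in> V i - X1. f v = a}" for i a
  define s where "s i = (\<Sum>a\<in>{1..k}. p i a)" for i
  define I where "I a = (\<Sum>i | i \<in> B \<and> supp i = {a}. s i)" for a
  have finX1: "finite X1" using X1(1) finB finV by (meson finite_UN_I finite_subset)
  have split: "card A = (\<Sum>a\<in>{1..k}. card {v \<in> A. f v = a})" if "A \<subseteq> V i" "i \<in> B" for A i
  proof -
    have finA: "finite A" using that finV finite_subset by blast
    have "A = (\<Union>a\<in>{1..k}. {v \<in> A. f v = a})" using that f by blast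
    then have "card A = card (\<Union>a\<in>{1..k}. {v \<in> A. f v = a})" by simp
    also have "\<dots> = (\<Sum>a\<in>{1..k}. card {v \<in> A. f v = a})" using finA by (intro card_UN_disjoint) auto
    finally show ?thesis .
  qed
  have s: "s i = card (V i - X1)" if "i \<in> B" for i
    unfolding s_def p_def using split[of "V i - X1" i] that by simp
  have w_s: "real (s i) \<le> w i" if "i \<in> B" for i
    using s[OF that] finV[OF that] by (simp add: w_def card_mono)
  \<comment> \<open>By disjointness the loss over a whole set of classes is \<open>\<theta>\<close>
    once, not once per class.\<close>
  have lost: "(\<Sum>i\<in>S. w i) \<le> real (\<Sum>i\<in>S. s i) + \<theta>" if "S \<subseteq> B" for S
  proof -
    have finS: "finite S" using that finB finite_subset by blast
    have "(\<Sum>i\<in>S. card (V i)) \<le> (\<Sum>i\<in>S. s i + card (V i \<inter> X1))"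
    proof (rule sum_mono)
      fix i assume "i \<in> S"
      then have i: "i \<in> B" using that by auto
      have "card (V i) = card ((V i - X1) \<union> (V i \<inter> X1))" by (rule arg_cong[of _ _ card]) auto
      also have "\<dots> \<le> card (V i - X1) + card (V i \<inter> X1)" by (rule card_Un_le)
      finally show "card (V i) \<le> s i + card (V i \<inter> X1)" using s[OF i] by simp
    qed
    also have "\<dots> = (\<Sum>i\<in>S. s i) + (\<Sum>i\<in>S. card (V i \<inter> X1))" by (simp add: sum.distrib)
    also have "(\<Sum>i\<in>S. card (V i \<inter> X1)) = card (\<Union>i\<in>S. V i \<inter> X1)"
      using finS finX1 disj that by (subst card_UN_disjoint) (auto simp: disjoint_family_on_def)
    also have "\<dots> \<le> card X1" using finX1 by (intro card_mono) auto
    finally have "(\<Sum>i\<in>S. card (V i)) \<le> (\<Sum>i\<in>S. s i) + card X1" by simp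
    then have "real (\<Sum>i\<in>S. card (V i)) \<le> real ((\<Sum>i\<in>S. s i) + card X1)" by (simp only: of_nat_le_iff)
    then show ?thesis using X1(2) by (simp add: w_def)
  qed
  have lost1: "w i \<le> real (s i) + \<theta>" if "i \<in> B" for i using lost[of "{i}"] that by simp
  have J_I: "integral_weight a \<le> real (I a) + \<theta>" for a
    unfolding integral_weight_def I_def by (rule lost) auto
  have I_J: "real (I a) \<le> integral_weight a" for a
    unfolding integral_weight_def I_def using w_s by (auto intro!: sum_mono)
  have \<theta>0: "0 \<le> \<theta>" using X1(2) by linarith
  show ?thesis
  proof (rule stable_trimming[of B k supp p \<Delta>, OF finB k], goal_cases)
    case (1 i) then show ?case using supp by blast
  next
    case (2 i a)
    have "finite {v \<in> V i - X1. f v = a}" using finV[OF 2(1)] by simp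
    then have "0 < p i a \<longleftrightarrow> {v \<in> V i - X1. f v = a} \<noteq> {}" unfolding p_def by (simp add: card_gt_0_iff)
    then show ?case using cells[OF 2] by blast
  next
    case (3 i j a) then show ?case by (intro partial_unique)
  next
    case (4 a)
    show ?case
    proof (rule ccontr)
      assume "\<not> ?thesis"
      then have "integral_weight a = 0" unfolding integral_weight_def by (intro sum.neutral) auto
      then show False using integral_weight_ge[OF 4] c by simp
    qed
  next
    case (5 i a b)
    have "real (I a) \<le> real (I b + \<Delta>)"
      using partial_integral_weight_le[OF 5] I_J[of a] J_I[of b] \<Delta> \<theta>0 c unfolding of_nat_add by linarith
    then show ?case unfolding I_def s_def by (simp only: of_nat_le_iff)
  next
    case (6 i a b)
    have "real (s i) \<le> real (I b + \<Delta>)"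
      using partial_weight_le[OF 6] w_s[OF 6(1)] J_I[of b] \<Delta> \<theta>0 c unfolding of_nat_add by linarith
    then show ?case unfolding I_def s_def by (simp only: of_nat_le_iff)
  next
    case (7 i a b)
    have "integral_weight a \<le> full_weight a" using integral_weight_add_le_full_weight[of "{}" a] by simp
    then have "real (I a) \<le> real (I b + s i + \<Delta>)"
      using full_weight_le[OF 7(1) _ 7(3,4)] 7(2) lost1[OF 7(1)] I_J[of a] J_I[of b] \<Delta> \<theta>0 c unfolding of_nat_add by simp
    then show ?case unfolding I_def s_def by (simp only: of_nat_le_iff)
  next
    case (8 i j a)
    have "real (s j) \<le> real (s i + \<Delta>)"
      using partial_le_integral[OF 8(1-5)] w_s[OF 8(1)] lost1[OF 8(4)] \<Delta> \<theta>0 c unfolding of_nat_add by linarith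
    then show ?case unfolding s_def by (simp only: of_nat_le_iff)
  next
    case (9 i)
    have "real ((card B + 2 * k) * \<Delta>) < real (s i)"
      using wc[OF 9] lost1[OF 9] \<Delta>(2) by linarith
    then show ?case unfolding s_def by (simp only: of_nat_less_iff)
  next
    case (10 q \<mu>)
    note q = 10(1,2) and qs = 10(3)[folded s_def] and \<mu>1 = 10(4) and \<mu>2 = 10(5,6) and \<mu>3 = 10(7)
    define Q where "Q i a = (SOME S. S \<subseteq> {v \<in> V i - X1. f v = a} \<and> card S = q i a)" for i a
    have Q: "Q i a \<subseteq> {v \<in> V i - X1. f v = a} \<and> card (Q i a) = q i a" if ia: "i \<in> B" "a \<in> {1..k}" for i a
    proof -
      have "q i a \<le> card {v \<in> V i - X1. f v = a}" using q(1)[OF ia] unfolding p_def .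
      then have "\<exists>S. S \<subseteq> {v \<in> V i - X1. f v = a} \<and> card S = q i a" by (meson obtain_subset_with_card_n)
      then show ?thesis unfolding Q_def by (rule someI_ex)
    qed
    define K where "K i = (\<Union>a\<in>{1..k}. Q i a)" for i
    define X where "X = (\<Union>i\<in>B. V i - K i)"
    have K: "K i \<subseteq> V i - X1" if "i \<in> B" for i using Q that unfolding K_def by blast
    have VX: "V i - X = K i" if i: "i \<in> B" for i
    proof (intro set_eqI iffI)
      fix v assume "v \<in> V i - X"
      then show "v \<in> K i" using i unfolding X_def by blast
    next
      fix v assume v: "v \<in> K i"
      then have vi: "v \<in> V i" using K[OF i] by auto
      have "v \<notin> V j - K j" if "j \<in> B" for j
      proof (cases "j = i")
        case False
        then have "V j \<inter> V i = {}" using disj i that unfolding disjoint_family_on_def by simp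
        then show ?thesis using vi by auto
      qed (use v in simp)
      then show "v \<in> V i - X" using vi unfolding X_def by blast
    qed
    have cell: "{v \<in> V i - X. f v = a} = Q i a" if "i \<in> B" "a \<in> {1..k}" for i a
    proof (intro set_eqI iffI)
      fix v assume "v \<in> {v \<in> V i - X. f v = a}"
      then have "v \<in> K i" "f v = a" using VX[OF that(1)] by auto
      then obtain b where "b \<in> {1..k}" "v \<in> Q i b" unfolding K_def by blast
      then show "v \<in> Q i a" using Q[OF that(1), of b] \<open>f v = a\<close> by auto
    next
      fix v assume v: "v \<in> Q i a"
      then have "v \<in> K i" using that(2) unfolding K_def by blast
      then show "v \<in> {v \<in> V i - X. f v = a}" using VX[OF that(1)] Q[OF that] v by auto
    qed
    have cK: "card (V i - X) = (\<Sum>a\<in>{1..k}. q i a)" if "i \<in> B" for i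
      using split[of "V i - X" i] cell Q that by simp
    have sumK: "(\<Sum>i | i \<in> B \<and> supp i = {b}. card (V i - X)) = (\<Sum>i | i \<in> B \<and> supp i = {b}. \<Sum>a\<in>{1..k}. q i a)" for b
      using cK by (intro sum.cong) auto
    show thesis
    proof (rule that[of X \<mu>]; (intro ballI allI impI conjI)?)
      show "X1 \<subseteq> X" using X1(1) K unfolding X_def by blast
      show "X \<subseteq> (\<Union>i\<in>B. V i)" unfolding X_def by blast
      have "X \<subseteq> X1 \<union> (\<Union>i\<in>B. V i - X1 - K i)" unfolding X_def by blast
      then have "card X \<le> card (X1 \<union> (\<Union>i\<in>B. V i - X1 - K i))"
        using finX1 finB finV by (intro card_mono) auto
      also have "\<dots> \<le> card X1 + card (\<Union>i\<in>B. V i - X1 - K i)" by (rule card_Un_le)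
      also have "card (\<Union>i\<in>B. V i - X1 - K i) \<le> (\<Sum>i\<in>B. card (V i - X1 - K i))"
        using finB by (intro card_UN_le)
      also have "\<dots> \<le> (\<Sum>i\<in>B. 2 * \<Delta>)"
      proof (rule sum_mono)
        fix i assume i: "i \<in> B"
        have "card (V i - X1 - K i) = card (V i - X1) - card (K i)"
          using finV[OF i] K[OF i] finite_subset by (intro card_Diff_subset) auto
        then show "card (V i - X1 - K i) \<le> 2 * \<Delta>" using qs[OF i] cK[OF i] VX[OF i] s[OF i] by simp
      qed
      finally have "card X \<le> card X1 + card B * (2 * \<Delta>)" by simp
      then have "real (card X) \<le> real (card X1 + card B * (2 * \<Delta>))" by (simp only: of_nat_le_iff)
      then show "real (card X) \<le> \<theta> + 2 * real (card B * \<Delta>)" using X1(2) by simp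
    next
      fix i a assume ia: "i \<in> B" "a \<in> {1..k}"
      have "Q i a \<subseteq> V i" using Q[OF ia] by auto
      then have "finite (Q i a)" using finV[OF ia(1)] by (rule finite_subset)
      then have "0 < card (Q i a) \<longleftrightarrow> Q i a \<noteq> {}" by (simp add: card_gt_0_iff)
      then have "0 < q i a \<longleftrightarrow> Q i a \<noteq> {}" using Q[OF ia] by simp
      then have "a \<in> supp i \<longleftrightarrow> {v \<in> V i - X. f v = a} \<noteq> {}" using q[OF ia] cell[OF ia] by simp
      then show "(\<exists>v\<in>V i - X. f v = a) \<longleftrightarrow> a \<in> supp i" by blast
    next
      fix b assume b: "b \<in> {1..k}"
      then show "\<mu> \<le> (\<Sum>i | i \<in> B \<and> supp i = {b}. card (V i - X))" unfolding sumK by (rule \<mu>1)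
      have "I b \<le> (\<Sum>i | i \<in> B \<and> supp i = {b}. card (V i - X) + 2 * \<Delta>)"
        unfolding I_def using qs cK by (intro sum_mono) auto
      also have "\<dots> = (\<Sum>i | i \<in> B \<and> supp i = {b}. card (V i - X)) + card {i \<in> B. supp i = {b}} * (2 * \<Delta>)"
        by (simp add: sum.distrib)
      also have "\<dots> \<le> (\<Sum>i | i \<in> B \<and> supp i = {b}. card (V i - X)) + card B * (2 * \<Delta>)"
        using finB by (intro add_left_mono mult_right_mono card_mono) auto
      finally have "real (I b) \<le> real ((\<Sum>i | i \<in> B \<and> supp i = {b}. card (V i - X)) + card B * (2 * \<Delta>))"
        by (simp only: of_nat_le_iff)
      then have "real (I b) \<le> real (\<Sum>i | i \<in> B \<and> supp i = {b}. card (V i - X)) + 2 * real (card B * \<Delta>)"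
        by simp
      moreover have "m - 3 * \<Lambda> \<le> integral_weight b" using integral_weight_lower[OF m b] .
      ultimately show "m - 3 * \<Lambda> - \<theta> - 2 * real (card B * \<Delta>) \<le> real (\<Sum>i | i \<in> B \<and> supp i = {b}. card (V i - X))"
        using J_I[of b] by linarith
    next
      fix i a assume i: "i \<in> B" "a \<in> supp i" "supp i \<noteq> {a}"
      show "(\<Sum>i | i \<in> B \<and> supp i = {a}. card (V i - X)) = \<mu>" "card (V i - X) \<le> \<mu>"
        unfolding sumK using \<mu>2[OF i] cK[OF i(1)] by auto
    next
      fix i a assume i: "i \<in> B" "supp i = {a}"
      then have "a \<in> {1..k}" using supp by blast
      then have "(\<Sum>j\<in>B - {i}. card {v \<in> V j - X. f v = a}) = (\<Sum>j\<in>B - {i}. q j a)"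
        using cell Q by (intro sum.cong) auto
      then show "(\<Sum>j\<in>B - {i}. card {v \<in> V j - X. f v = a}) \<le> \<mu>" using \<mu>3[OF i] by simp
    qed
  qed
qed

subsection \<open>Transversals\<close>

lemma card_image_eq_if_same_kernel:
  fixes f g :: "'a \<Rightarrow> 'b"
  assumes "finite S" "\<And>l l'. l \<in> S \<Longrightarrow> l' \<in> S \<Longrightarrow> f l = f l' \<longleftrightarrow> g l = g l'"
  shows "card (f ` S) = card (g ` S)"
proof -
  have le: "card (h ` S) \<le> card (f ` S)"
    if "\<And>l l'. l \<in> S \<Longrightarrow> l' \<in> S \<Longrightarrow> f l = f l' \<Longrightarrow> h l = h l'" for f h :: "'a \<Rightarrow> 'b"
  proof -
    define p where "p x = (SOME l. l \<in> S \<and> f l = x)" for x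
    have p: "p (f l) \<in> S \<and> f (p (f l)) = f l" if "l \<in> S" for l
      unfolding p_def using that by (intro someI_ex[of "\<lambda>l'. l' \<in> S \<and> f l' = f l"]) auto
    have "h ` S \<subseteq> (\<lambda>x. h (p x)) ` f ` S"
    proof
      fix y assume "y \<in> h ` S"
      then obtain l where l: "l \<in> S" "y = h l" by auto
      then have "h (p (f l)) = y" using that[of "p (f l)" l] p[OF l(1)] by simp
      then show "y \<in> (\<lambda>x. h (p x)) ` f ` S" using l(1) by blast
    qed
    then show ?thesis using assms(1) by (meson card_image_le card_mono finite_imageI le_trans)
  qed
  show ?thesis
  proof (rule antisym)
    show "card (f ` S) \<le> card (g ` S)" using assms(2) by (intro le) simp
    show "card (g ` S) \<le> card (f ` S)" using assms(2) by (intro le) simp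
  qed
qed

lemma inside_cong_kernel:
  assumes "\<And>i j. i \<in> B \<Longrightarrow> j \<in> B \<Longrightarrow> i \<noteq> j \<Longrightarrow> \<sigma> i = \<sigma> j \<longleftrightarrow> \<tau> i = \<tau> j"
  shows "inside B w \<sigma> = inside B w \<tau>"
  unfolding inside_def using assms by (intro sum.cong refl) (auto simp: of_bool_def)

lemma inside_ge_pair:
  assumes "finite B" "\<And>i. i \<in> B \<Longrightarrow> 0 \<le> w i" "i \<in> B" "j \<in> B" "i \<noteq> j" "\<sigma> i = \<sigma> j"
  shows "w i * w j \<le> inside B w \<sigma>"
proof -
  have "w i * w j = of_bool (i \<noteq> j \<and> \<sigma> i = \<sigma> j) * (w i * w j)" using assms by simp
  also have "\<dots> \<le> (\<Sum>j\<in>B. of_bool (i \<noteq> j \<and> \<sigma> i = \<sigma> j) * (w i * w j))"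
    using assms by (intro member_le_sum) auto
  also have "\<dots> \<le> inside B w \<sigma>"
    unfolding inside_def using assms by (intro member_le_sum) (auto intro!: sum_nonneg)
  finally show ?thesis .
qed

text \<open>The case of singleton supports: every index is integral,
  \<open>integral_weight a\<close> is the weight of colour class \<open>a\<close>, and
  \<open>integral_weight_ge\<close> makes it positive.\<close>

lemma near_optimal_imp_surj:
  assumes "finite B" "{1..k} \<subseteq> B" "\<And>i. i \<in> B \<Longrightarrow> c \<le> w i" "0 < c" "2 * \<Lambda> < c" "0 \<le> \<Lambda>"
    and \<sigma>: "\<sigma> \<in> B \<rightarrow> {1..k}" and opt: "\<And>\<tau>. \<tau> \<in> B \<rightarrow> {1..k} \<Longrightarrow> inside B w \<sigma> \<le> inside B w \<tau> + \<Lambda> * c"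
  shows "\<sigma> ` B = {1..k}"
proof -
  interpret near_optimal_supports B k w "\<lambda>i. {\<sigma> i}" \<Lambda> c
  proof
    fix \<sigma>' \<tau> assume "\<sigma>' \<in> (\<Pi> i\<in>B. {\<sigma> i})" "\<tau> \<in> B \<rightarrow> {1..k}"
    moreover from this have "inside B w \<sigma>' = inside B w \<sigma>" by (intro inside_cong_kernel) (auto simp: Pi_iff)
    ultimately show "inside B w \<sigma>' \<le> inside B w \<tau> + \<Lambda> * c" using opt by simp
  qed (use assms in auto)
  have "a \<in> \<sigma> ` B" if "a \<in> {1..k}" for a
  proof (rule ccontr)
    assume "a \<notin> \<sigma> ` B"
    then have "integral_weight a = 0" unfolding integral_weight_def by (intro sum.neutral) auto
    then show False using integral_weight_ge[OF that] assms by simp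
  qed
  then show ?thesis using \<sigma> by auto
qed

definition mix :: "nat set \<Rightarrow> (nat \<Rightarrow> 'a) \<Rightarrow> (nat \<Rightarrow> 'a) \<Rightarrow> nat \<Rightarrow> 'a" where
  "mix J y z = (\<lambda>i. if i \<in> J then z i else y i)"

locale transversals =
  fixes B :: "nat set" and V :: "nat \<Rightarrow> 'a set" and adj :: "'a \<Rightarrow> 'a \<Rightarrow> bool"
  assumes finB: "finite B" and finV: "\<And>i. i \<in> B \<Longrightarrow> finite (V i)" and V_ne: "\<And>i. i \<in> B \<Longrightarrow> V i \<noteq> {}"
    and disj: "disjoint_family_on V B" and adj_sym: "adj u v \<Longrightarrow> adj v u"
begin

abbreviation \<Omega> :: "(nat \<Rightarrow> 'a) set" where "\<Omega> \<equiv> PiE B V"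

definition w :: "nat \<Rightarrow> real" where "w i = real (card (V i))"

lemma w_pos: "i \<in> B \<Longrightarrow> 0 < w i"
  using finV V_ne by (simp add: w_def card_gt_0_iff)

lemma fin\<Omega>: "finite \<Omega>"
  using finB finV by (intro finite_PiE) auto

lemma \<Omega>_ne: "\<Omega> \<noteq> {}"
  using V_ne by (simp add: PiE_eq_empty_iff)

text \<open>Every pair extends to the same number \<open>N\<close> of transversals, so the density
  of a set of pairs is a frequency among transversals. The identity is multiplied out to avoid
  quotients.\<close>

lemma card_pair_transversals:
  assumes ij: "i \<in> B" "j \<in> B" "i \<noteq> j" and M: "M \<subseteq> V i \<times> V j"
  shows "real (card {x \<in> \<Omega>. (x i, x j) \<in> M}) * (w i * w j) = real (card M) * real (card \<Omega>)"
proof -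
  have finM: "finite M" using M finV ij by (meson finite_SigmaI finite_subset)
  define N where "N = (\<Prod>l\<in>B - {i} - {j}. card (V l))"
  have \<Omega>: "card \<Omega> = card (V i) * (card (V j) * N)"
    using finB ij by (simp add: card_PiE N_def prod.remove[of B i] prod.remove[of "B - {i}" j])
  have "{x \<in> \<Omega>. (x i, x j) \<in> M} = (\<Union>p\<in>M. {x \<in> \<Omega>. (x i, x j) = p})" by auto
  also have "card \<dots> = (\<Sum>p\<in>M. card {x \<in> \<Omega>. (x i, x j) = p})"
    using fin\<Omega> finM by (intro card_UN_disjoint) auto
  also have "\<dots> = (\<Sum>p\<in>M. N)"
  proof (intro sum.cong refl)
    fix p assume "p \<in> M"
    then obtain u v where p: "p = (u, v)" "u \<in> V i" "v \<in> V j" using M by auto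
    have "{x \<in> \<Omega>. (x i, x j) = p} = PiE B (V(i := {u}, j := {v}))"
      using p ij by (fastforce simp: PiE_iff split: if_splits)
    also have "card \<dots> = N"
      using finB ij by (simp add: card_PiE N_def prod.remove[of B i] prod.remove[of "B - {i}" j])
    finally show "card {x \<in> \<Omega>. (x i, x j) = p} = N" .
  qed
  finally have "card {x \<in> \<Omega>. (x i, x j) \<in> M} = card M * N" by simp
  then show ?thesis unfolding \<Omega> w_def by simp
qed

lemma mix_in: "y \<in> \<Omega> \<Longrightarrow> z \<in> \<Omega> \<Longrightarrow> mix J y z \<in> \<Omega>"
  by (auto simp: PiE_iff mix_def extensional_def)

text \<open>Exchanging the coordinates in \<open>J\<close> is an involution of \<open>\<Omega> \<times> \<Omega>\<close>.\<close>

lemma card_mix: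
  "card {(y, z) \<in> \<Omega> \<times> \<Omega>. mix J y z \<in> X} = card (\<Omega> \<inter> X) * card \<Omega>"
proof -
  let ?f = "\<lambda>(y, z). (mix J y z, mix J z y)"
  have inv: "?f (?f p) = p" for p :: "(nat \<Rightarrow> 'a) \<times> (nat \<Rightarrow> 'a)" by (cases p) (auto simp: mix_def)
  have "bij_betw ?f {(y, z) \<in> \<Omega> \<times> \<Omega>. mix J y z \<in> X} ((\<Omega> \<inter> X) \<times> \<Omega>)"
  proof (rule bij_betw_byWitness[where f' = ?f])
    show "?f ` {(y, z) \<in> \<Omega> \<times> \<Omega>. mix J y z \<in> X} \<subseteq> (\<Omega> \<inter> X) \<times> \<Omega>" using mix_in by auto
    have mm: "mix J (mix J y z) (mix J z y) = y" for y z :: "nat \<Rightarrow> 'a" by (auto simp: mix_def)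
    show "?f ` ((\<Omega> \<inter> X) \<times> \<Omega>) \<subseteq> {(y, z) \<in> \<Omega> \<times> \<Omega>. mix J y z \<in> X}"
    proof (rule image_subsetI)
      fix p assume "p \<in> (\<Omega> \<inter> X) \<times> \<Omega>"
      then obtain y z where "p = (y, z)" "y \<in> \<Omega>" "y \<in> X" "z \<in> \<Omega>" by blast
      then show "?f p \<in> {(y, z) \<in> \<Omega> \<times> \<Omega>. mix J y z \<in> X}"
        using mix_in[of y z J] mix_in[of z y J] by (simp add: mm)
    qed
  qed (use inv in blast)+
  then show ?thesis by (simp add: bij_betw_same_card card_cartesian_product)
qed

text \<open>Averaging over \<open>y\<close>: by \<open>card_mix\<close>, each of the
  \<open>2 ^ card B\<close> sets \<open>J\<close> contributes \<open>card X * card \<Omega>\<close>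
  pairs. All \<open>J\<close> are controlled at once because the empty set, singletons, pairs and
  \<open>B\<close> itself are needed for one and the same \<open>y\<close>.\<close>

lemma ex_reference:
  assumes "X \<subseteq> \<Omega>"
  shows "\<exists>y\<in>\<Omega>. card {z \<in> \<Omega>. \<exists>J\<subseteq>B. mix J y z \<in> X} \<le> 2 ^ card B * card X"
proof (rule ccontr)
  assume "\<not> ?thesis"
  then have less: "2 ^ card B * card X < card {z \<in> \<Omega>. \<exists>J\<subseteq>B. mix J y z \<in> X}" if "y \<in> \<Omega>" for y
    using that not_le by blast
  have "card \<Omega> * (2 ^ card B * card X) = (\<Sum>y\<in>\<Omega>. 2 ^ card B * card X)" by simp
  also have "\<dots> < (\<Sum>y\<in>\<Omega>. card {z \<in> \<Omega>. \<exists>J\<subseteq>B. mix J y z \<in> X})"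
    using fin\<Omega> \<Omega>_ne less by (intro sum_strict_mono) auto
  also have "\<dots> = card (Sigma \<Omega> (\<lambda>y. {z \<in> \<Omega>. \<exists>J\<subseteq>B. mix J y z \<in> X}))"
    using fin\<Omega> by (subst card_SigmaI) auto
  also have "Sigma \<Omega> (\<lambda>y. {z \<in> \<Omega>. \<exists>J\<subseteq>B. mix J y z \<in> X}) = (\<Union>J\<in>Pow B. {(y, z) \<in> \<Omega> \<times> \<Omega>. mix J y z \<in> X})"
    by auto
  also have "card \<dots> \<le> (\<Sum>J\<in>Pow B. card {(y, z) \<in> \<Omega> \<times> \<Omega>. mix J y z \<in> X})"
    using finB by (intro card_UN_le) auto
  also have "\<dots> = 2 ^ card B * (card X * card \<Omega>)"
    unfolding card_mix using assms finB by (simp add: Int_absorb1 card_Pow)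
  finally show False by (simp add: algebra_simps)
qed

definition miss :: "(nat \<Rightarrow> 'a) \<Rightarrow> real" where
  "miss x = (\<Sum>i\<in>B. \<Sum>j\<in>B. of_bool (i \<noteq> j \<and> \<not> adj (x i) (x j)) * (w i * w j))"

definition nonadj :: "nat \<Rightarrow> nat \<Rightarrow> real" where
  "nonadj i j = real (card {(u, v) \<in> V i \<times> V j. \<not> adj u v})"

definition missing :: real where
  "missing = (\<Sum>i\<in>B. \<Sum>j\<in>B. of_bool (i \<noteq> j) * nonadj i j)"

lemma card_nonadj_transversals:
  assumes ij: "i \<in> B" "j \<in> B" "i \<noteq> j"
  shows "real (card {x \<in> \<Omega>. \<not> adj (x i) (x j)}) * (w i * w j) = nonadj i j * real (card \<Omega>)"
proof -
  have "{x \<in> \<Omega>. \<not> adj (x i) (x j)} = {x \<in> \<Omega>. (x i, x j) \<in> {(u, v) \<in> V i \<times> V j. \<not> adj u v}}"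
    using ij by (auto simp: PiE_iff)
  then show ?thesis unfolding nonadj_def using card_pair_transversals[OF ij, of "{(u, v) \<in> V i \<times> V j. \<not> adj u v}"] by auto
qed

text \<open>A given non-edge between classes \<open>i\<close> and \<open>j\<close> is hit with
  probability \<open>1 / (w i * w j)\<close>, which the weight in \<open>miss\<close>
  cancels.\<close>

lemma sum_miss: "(\<Sum>x\<in>\<Omega>. miss x) = real (card \<Omega>) * missing"
proof -
  have "(\<Sum>x\<in>\<Omega>. miss x) = (\<Sum>i\<in>B. \<Sum>j\<in>B. \<Sum>x\<in>\<Omega>. of_bool (i \<noteq> j \<and> \<not> adj (x i) (x j)) * (w i * w j))"
    unfolding miss_def by (subst sum.swap, rule sum.cong[OF refl], rule sum.swap)
  also have "\<dots> = (\<Sum>i\<in>B. \<Sum>j\<in>B. of_bool (i \<noteq> j) * nonadj i j * real (card \<Omega>))"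
  proof (intro sum.cong refl)
    fix i j assume ij: "i \<in> B" "j \<in> B"
    show "(\<Sum>x\<in>\<Omega>. of_bool (i \<noteq> j \<and> \<not> adj (x i) (x j)) * (w i * w j)) = of_bool (i \<noteq> j) * nonadj i j * real (card \<Omega>)"
    proof (cases "i = j")
      case False
      have "(\<Sum>x\<in>\<Omega>. of_bool (i \<noteq> j \<and> \<not> adj (x i) (x j)) * (w i * w j)) = 
        (\<Sum>x\<in>\<Omega>. if x \<in> {x \<in> \<Omega>. \<not> adj (x i) (x j)} then w i * w j else 0)"
        using False by (intro sum.cong) auto
      also have "\<dots> = real (card {x \<in> \<Omega>. \<not> adj (x i) (x j)}) * (w i * w j)"
        using fin\<Omega> by (intro sum_if_mem_const) auto
      finally show ?thesis using card_nonadj_transversals[OF ij False] False by simp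
    qed simp
  qed
  finally show ?thesis unfolding missing_def by (simp add: sum_distrib_left mult.commute mult.left_commute)
qed

lemma miss_nonneg: "0 \<le> miss x"
  unfolding miss_def using w_pos by (intro sum_nonneg) (auto simp: less_imp_le)

lemma miss_ge_pair:
  assumes "i \<in> B" "j \<in> B" "i \<noteq> j" "\<not> adj (x i) (x j)"
  shows "w i * w j \<le> miss x"
proof -
  have "w i * w j = of_bool (i \<noteq> j \<and> \<not> adj (x i) (x j)) * (w i * w j)" using assms by simp
  also have "\<dots> \<le> (\<Sum>j\<in>B. of_bool (i \<noteq> j \<and> \<not> adj (x i) (x j)) * (w i * w j))"
    using assms finB w_pos by (intro member_le_sum) (auto simp: less_imp_le)
  also have "\<dots> \<le> miss x"
    unfolding miss_def using assms finB w_pos by (intro member_le_sum) (auto intro!: sum_nonneg simp: less_imp_le)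
  finally show ?thesis .
qed

definition cliques :: "nat \<Rightarrow> (nat \<Rightarrow> 'a) set" where
  "cliques t = {x \<in> \<Omega>. \<exists>J\<subseteq>B. card J = t \<and> (\<forall>i\<in>J. \<forall>j\<in>J. i \<noteq> j \<longrightarrow> adj (x i) (x j))}"

lemma cliques_subset: "cliques t \<subseteq> \<Omega>"
  by (auto simp: cliques_def)

text \<open>\<open>weighted_partite_bound\<close>, complemented in the total weight \<open>W\<close>
  of ordered pairs. The additional sum, over edges inside colour classes, is what gives stability
  and not just the extremal bound.\<close>

lemma clique_free_colouring:
  assumes x: "x \<in> \<Omega>" "x \<notin> cliques (Suc k)"
  shows "\<exists>\<sigma>. \<sigma> \<in> B \<rightarrow> {1..k} \<and> inside B w \<sigma> +
     (\<Sum>i\<in>B. \<Sum>j\<in>B. of_bool (i \<noteq> j \<and> adj (x i) (x j) \<and> \<sigma> i = \<sigma> j) * (w i * w j)) \<le> miss x"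
proof -
  define H where "H i j \<longleftrightarrow> i \<noteq> j \<and> adj (x i) (x j)" for i j
  have "\<exists>\<sigma>. \<sigma> \<in> B \<rightarrow> {1..k} \<and>
    (\<Sum>i\<in>B. \<Sum>j\<in>B. of_bool (H i j) * (w i * w j)) +
    (\<Sum>i\<in>B. \<Sum>j\<in>B. of_bool (H i j \<and> \<sigma> i = \<sigma> j) * (w i * w j))
    \<le> (\<Sum>i\<in>B. \<Sum>j\<in>B. of_bool (\<sigma> i \<noteq> \<sigma> j) * (w i * w j))"
  proof (rule weighted_partite_bound)
    show "\<exists>i\<in>J. \<exists>j\<in>J. i \<noteq> j \<and> \<not> H i j" if "J \<subseteq> B" "card J = Suc k" for J
      using x that unfolding cliques_def H_def by blast
  qed (use finB w_pos adj_sym in \<open>auto simp: H_def less_imp_le\<close>)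
  then obtain \<sigma> where \<sigma>: "\<sigma> \<in> B \<rightarrow> {1..k}"
    "(\<Sum>i\<in>B. \<Sum>j\<in>B. of_bool (H i j) * (w i * w j)) +
    (\<Sum>i\<in>B. \<Sum>j\<in>B. of_bool (H i j \<and> \<sigma> i = \<sigma> j) * (w i * w j))
    \<le> (\<Sum>i\<in>B. \<Sum>j\<in>B. of_bool (\<sigma> i \<noteq> \<sigma> j) * (w i * w j))" by blast
  define W where "W = (\<Sum>i\<in>B. \<Sum>j\<in>B. of_bool (i \<noteq> j) * (w i * w j))"
  have 1: "miss x = W - (\<Sum>i\<in>B. \<Sum>j\<in>B. of_bool (H i j) * (w i * w j))"
    unfolding miss_def W_def sum_subtractf[symmetric] by (intro sum.cong refl) (auto simp: H_def)
  have 2: "inside B w \<sigma> = W - (\<Sum>i\<in>B. \<Sum>j\<in>B. of_bool (\<sigma> i \<noteq> \<sigma> j) * (w i * w j))"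
    unfolding inside_def W_def sum_subtractf[symmetric] by (intro sum.cong refl) auto
  show ?thesis
    using \<sigma> 1 2 by (intro exI[of _ \<sigma>]) (auto simp: H_def conj_assoc)
qed

end

text \<open>
  \<open>g\<close> bounds from below the weight inside the classes of a \<open>k\<close>-colouring of the index set, \<open>\<Lambda> * c\<close> is the
  tolerance for near-optimality.
\<close>

locale dense_transversals = transversals +
  fixes k :: nat and c \<Lambda> g U :: real
  assumes kB: "{1..k} \<subseteq> B" and wc: "\<And>i. i \<in> B \<Longrightarrow> c \<le> w i" and c: "0 < c" "2 * \<Lambda> < c" "0 < \<Lambda>"
    and g: "\<And>\<tau>. \<tau> \<in> B \<rightarrow> {1..k} \<Longrightarrow> g \<le> inside B w \<tau>" and gU: "0 \<le> g" "g \<le> U"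
begin

definition good :: "(nat \<Rightarrow> 'a) \<Rightarrow> (nat \<Rightarrow> nat) \<Rightarrow> bool" where
  "good x \<sigma> \<longleftrightarrow> \<sigma> \<in> B \<rightarrow> {1..k} \<and> (\<forall>i\<in>B. \<forall>j\<in>B. i \<noteq> j \<longrightarrow> (\<not> adj (x i) (x j) \<longleftrightarrow> \<sigma> i = \<sigma> j)) \<and>
     inside B w \<sigma> \<le> g + \<Lambda> * c"

definition bad :: "(nat \<Rightarrow> 'a) set" where
  "bad = {x \<in> \<Omega>. \<nexists>\<sigma>. good x \<sigma>}"

lemma good_surj:
  assumes "good x \<sigma>"
  shows "\<sigma> ` B = {1..k}"
proof (rule near_optimal_imp_surj[OF finB kB wc c(1,2)])
  show "inside B w \<sigma> \<le> inside B w \<tau> + \<Lambda> * c" if "\<tau> \<in> B \<rightarrow> {1..k}" for \<tau>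
    using g[OF that] assms by (simp add: good_def)
qed (use assms c in \<open>auto simp: good_def\<close>)

text \<open>An edge inside a colour class and a missing edge across classes each weigh at least
  \<open>c * c\<close>, more than \<open>\<Lambda> * c\<close>. The slack between \<open>g\<close>
  and \<open>miss x\<close> therefore leaves room for neither, and the colouring describes adjacency
  exactly.\<close>

lemma good_if_miss_le:
  assumes x: "x \<in> \<Omega>" "x \<notin> cliques (Suc k)" "miss x \<le> g + \<Lambda> * c"
  shows "\<exists>\<sigma>. good x \<sigma>"
proof -
  obtain \<sigma> where \<sigma>: "\<sigma> \<in> B \<rightarrow> {1..k}" "inside B w \<sigma> +
     (\<Sum>i\<in>B. \<Sum>j\<in>B. of_bool (i \<noteq> j \<and> adj (x i) (x j) \<and> \<sigma> i = \<sigma> j) * (w i * w j)) \<le> miss x"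
    using clique_free_colouring[OF x(1,2)] by blast
  define e where "e i j = of_bool (i \<noteq> j \<and> adj (x i) (x j) \<and> \<sigma> i = \<sigma> j) * (w i * w j)" for i j
  define f where "f i j = of_bool (i \<noteq> j \<and> \<not> adj (x i) (x j) \<and> \<sigma> i \<noteq> \<sigma> j) * (w i * w j)" for i j
  have e0: "0 \<le> e i j" and f0: "0 \<le> f i j" if "i \<in> B" "j \<in> B" for i j
    using that w_pos by (auto simp: e_def f_def less_imp_le)
  have single: "h i j \<le> (\<Sum>i\<in>B. \<Sum>j\<in>B. h i j)" if "i \<in> B" "j \<in> B" "\<And>i j. i \<in> B \<Longrightarrow> j \<in> B \<Longrightarrow> 0 \<le> h i j"
    for h :: "nat \<Rightarrow> nat \<Rightarrow> real" and i j
  proof -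
    have "h i j \<le> (\<Sum>j\<in>B. h i j)" using that finB by (intro member_le_sum) auto
    also have "\<dots> \<le> (\<Sum>i\<in>B. \<Sum>j\<in>B. h i j)" using that finB by (intro member_le_sum) (auto intro!: sum_nonneg)
    finally show ?thesis .
  qed
  have small: "\<Lambda> * c < w i * w j" if "i \<in> B" "j \<in> B" for i j
  proof -
    have "\<Lambda> * c < c * c" using c by (intro mult_strict_right_mono) auto
    also have "\<dots> \<le> w i * w j" using c wc that less_imp_le[OF w_pos] by (intro mult_mono) auto
    finally show ?thesis .
  qed
  have es: "(\<Sum>i\<in>B. \<Sum>j\<in>B. e i j) \<le> \<Lambda> * c" using \<sigma> g[OF \<sigma>(1)] x(3) unfolding e_def by linarith
  have e: "\<not> (adj (x i) (x j) \<and> \<sigma> i = \<sigma> j)" if "i \<in> B" "j \<in> B" "i \<noteq> j" for i j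
  proof
    assume "adj (x i) (x j) \<and> \<sigma> i = \<sigma> j"
    then have "e i j = w i * w j" using that by (simp add: e_def)
    then show False using single[OF that(1,2), of e] e0 small[OF that(1,2)] es by fastforce
  qed
  have "miss x - inside B w \<sigma> = (\<Sum>i\<in>B. \<Sum>j\<in>B. f i j)"
    unfolding miss_def inside_def sum_subtractf[symmetric] using e by (intro sum.cong refl) (auto simp: f_def)
  then have fs: "(\<Sum>i\<in>B. \<Sum>j\<in>B. f i j) \<le> \<Lambda> * c" using g[OF \<sigma>(1)] x(3) by linarith
  have f: "\<not> (\<not> adj (x i) (x j) \<and> \<sigma> i \<noteq> \<sigma> j)" if "i \<in> B" "j \<in> B" "i \<noteq> j" for i j
  proof
    assume "\<not> adj (x i) (x j) \<and> \<sigma> i \<noteq> \<sigma> j"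
    then have "f i j = w i * w j" using that by (simp add: f_def)
    then show False using single[OF that(1,2), of f] f0 small[OF that(1,2)] fs by fastforce
  qed
  have "0 \<le> (\<Sum>i\<in>B. \<Sum>j\<in>B. e i j)" using e0 by (intro sum_nonneg) auto
  then have "inside B w \<sigma> \<le> g + \<Lambda> * c" using \<sigma>(2) x(3) unfolding e_def by linarith
  then have "good x \<sigma>" unfolding good_def using \<sigma>(1) e f by blast
  then show ?thesis by blast
qed

lemma miss_ge_if_clique_free:
  assumes x: "x \<in> \<Omega>" "x \<notin> cliques (Suc k)"
  shows "g \<le> miss x"
proof -
  obtain \<sigma> where \<sigma>: "\<sigma> \<in> B \<rightarrow> {1..k}" "inside B w \<sigma> +
     (\<Sum>i\<in>B. \<Sum>j\<in>B. of_bool (i \<noteq> j \<and> adj (x i) (x j) \<and> \<sigma> i = \<sigma> j) * (w i * w j)) \<le> miss x"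
    using clique_free_colouring[OF x(1,2)] by blast
  have "0 \<le> (\<Sum>i\<in>B. \<Sum>j\<in>B. of_bool (i \<noteq> j \<and> adj (x i) (x j) \<and> \<sigma> i = \<sigma> j) * (w i * w j))"
    using w_pos by (intro sum_nonneg) (auto simp: less_imp_le)
  then show ?thesis using \<sigma> g[OF \<sigma>(1)] by linarith
qed

context
  fixes \<delta> \<eta> :: real
  assumes missing: "missing \<le> g + \<delta>" and \<eta>: "0 \<le> \<eta>" "real (card (cliques (Suc k))) \<le> \<eta> * real (card \<Omega>)"
begin

text \<open>\<open>miss x\<close> can drop below \<open>g\<close> only on clique transversals, and
  then by at most \<open>U\<close>. Compensating for these turns the bound on the average into a
  bound on the positive part, to which Markov's inequality applies.\<close>

lemma sum_excess: "(\<Sum>x\<in>\<Omega>. max 0 (miss x - g)) \<le> real (card \<Omega>) * (\<delta> + \<eta> * U)"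
proof -
  have "(\<Sum>x\<in>\<Omega>. max 0 (miss x - g)) \<le> (\<Sum>x\<in>\<Omega>. miss x - g + (if x \<in> cliques (Suc k) then U else 0))"
  proof (rule sum_mono)
    fix x assume "x \<in> \<Omega>"
    then show "max 0 (miss x - g) \<le> miss x - g + (if x \<in> cliques (Suc k) then U else 0)"
      using miss_ge_if_clique_free[of x] miss_nonneg[of x] gU by auto
  qed
  also have "\<dots> = real (card \<Omega>) * missing - real (card \<Omega>) * g + real (card (cliques (Suc k))) * U"
    using sum_if_mem_const[OF fin\<Omega>, of "cliques (Suc k)" U] by (simp add: sum.distrib sum_subtractf sum_miss cliques_subset)
  also have "\<dots> \<le> real (card \<Omega>) * (g + \<delta>) - real (card \<Omega>) * g + (\<eta> * real (card \<Omega>)) * U"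
    using missing \<eta> gU by (intro add_mono diff_mono mult_left_mono mult_right_mono) auto
  finally show ?thesis by (simp add: algebra_simps)
qed

lemma card_bad: "\<Lambda> * c * real (card bad) \<le> real (card \<Omega>) * (\<Lambda> * c * \<eta> + \<delta> + \<eta> * U)"
proof -
  define Y where "Y = {x \<in> \<Omega>. miss x - g > \<Lambda> * c}"
  have "bad \<subseteq> cliques (Suc k) \<union> Y"
    using good_if_miss_le by (force simp: bad_def Y_def)
  then have "card bad \<le> card (cliques (Suc k) \<union> Y)"
    using fin\<Omega> by (intro card_mono) (auto simp: cliques_def Y_def)
  also have "\<dots> \<le> card (cliques (Suc k)) + card Y" by (rule card_Un_le)
  finally have 1: "real (card bad) \<le> real (card (cliques (Suc k))) + real (card Y)" by linarith
  have "real (card Y) * (\<Lambda> * c) = (\<Sum>x\<in>\<Omega>. if x \<in> Y then \<Lambda> * c else 0)"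
    using fin\<Omega> by (subst sum_if_mem_const) (auto simp: Y_def)
  also have "\<dots> \<le> (\<Sum>x\<in>\<Omega>. max 0 (miss x - g))"
    by (intro sum_mono) (auto simp: Y_def)
  also have "\<dots> \<le> real (card \<Omega>) * (\<delta> + \<eta> * U)" by (rule sum_excess)
  finally have 2: "real (card Y) * (\<Lambda> * c) \<le> real (card \<Omega>) * (\<delta> + \<eta> * U)" .
  have "\<Lambda> * c * real (card bad) \<le> \<Lambda> * c * (\<eta> * real (card \<Omega>) + real (card Y))"
    using 1 \<eta> c by (intro mult_left_mono) auto
  then show ?thesis using 2 by (simp add: algebra_simps)
qed

text \<open>A missing pair costs a transversal \<open>w i * w j\<close>, at least half of which is
  excess. Such transversals have frequency \<open>nonadj i j / (w i * w j)\<close>, so the weights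
  cancel and the bound is absolute, however large the two classes are.\<close>

lemma nonadj_heavy_pair:
  assumes ij: "i \<in> B" "j \<in> B" "i \<noteq> j" and heavy: "2 * U \<le> w i * w j"
  shows "nonadj i j \<le> 2 * (\<delta> + \<eta> * U)"
proof -
  define Y where "Y = {x \<in> \<Omega>. \<not> adj (x i) (x j)}"
  have "real (card Y) * (w i * w j / 2) = (\<Sum>x\<in>\<Omega>. if x \<in> Y then w i * w j / 2 else 0)"
    using fin\<Omega> by (subst sum_if_mem_const) (auto simp: Y_def)
  also have "\<dots> \<le> (\<Sum>x\<in>\<Omega>. max 0 (miss x - g))"
  proof (rule sum_mono)
    fix x assume "x \<in> \<Omega>"
    show "(if x \<in> Y then w i * w j / 2 else 0) \<le> max 0 (miss x - g)"
    proof (cases "x \<in> Y")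
      case True
      then have "w i * w j \<le> miss x" using miss_ge_pair[OF ij] by (simp add: Y_def)
      then show ?thesis using True heavy gU by (simp add: max_def)
    qed simp
  qed
  also have "\<dots> \<le> real (card \<Omega>) * (\<delta> + \<eta> * U)" by (rule sum_excess)
  finally have "real (card Y) * (w i * w j) \<le> 2 * (real (card \<Omega>) * (\<delta> + \<eta> * U))" by (simp add: field_simps)
  then have "nonadj i j * real (card \<Omega>) \<le> (2 * (\<delta> + \<eta> * U)) * real (card \<Omega>)"
    using card_nonadj_transversals[OF ij] by (simp add: Y_def algebra_simps)
  moreover have "0 < real (card \<Omega>)" using fin\<Omega> \<Omega>_ne by (simp add: card_gt_0_iff)
  ultimately show ?thesis by (rule mult_right_le_imp_le)
qed

end

end

subsection \<open>The colouring induced by a reference transversal\<close>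

context dense_transversals
begin

definition index :: "'a \<Rightarrow> nat" where
  "index v = (THE j. j \<in> B \<and> v \<in> V j)"

lemma index_eq: "j \<in> B \<Longrightarrow> v \<in> V j \<Longrightarrow> index v = j"
  unfolding index_def using disj by (intro the_equality) (auto simp: disjoint_family_on_def)

lemma goodD:
  assumes "good x \<sigma>" "i \<in> B" "j \<in> B" "i \<noteq> j"
  shows "\<not> adj (x i) (x j) \<longleftrightarrow> \<sigma> i = \<sigma> j"
  using assms unfolding good_def by blast

context
  fixes y :: "nat \<Rightarrow> 'a" and \<sigma> :: "nat \<Rightarrow> nat"
  assumes y: "y \<in> \<Omega>" "good y \<sigma>"
begin

text \<open>
  The second condition matters when \<open>v\<close> is adjacent to all other vertices of \<open>y\<close>: there may then be several
  colours satisfying the first one.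
\<close>

definition matches :: "nat \<Rightarrow> 'a \<Rightarrow> nat \<Rightarrow> bool" where
  "matches j v a \<longleftrightarrow> (\<forall>l\<in>B - {j}. \<not> adj v (y l) \<longleftrightarrow> \<sigma> l = a) \<and> (a \<notin> \<sigma> ` (B - {j}) \<longrightarrow> a = \<sigma> j)"

text \<open>The default is the colour that \<open>y\<close> gives to the class of \<open>v\<close>:
  a heavy class has to be monochromatic on all its vertices, including those for which the
  substitution into \<open>y\<close> is not good.\<close>

definition colour :: "'a \<Rightarrow> nat" where
  "colour v = (if \<exists>\<tau>. good (y(index v := v)) \<tau> then SOME a. matches (index v) v a else \<sigma> (index v))"

lemma \<sigma>_in: "i \<in> B \<Longrightarrow> \<sigma> i \<in> {1..k}"
  using y by (auto simp: good_def)

text \<open>If \<open>\<tau> j\<close> occurs at another index \<open>l0\<close>, the colour is read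
  off as \<open>\<sigma> l0\<close>. Otherwise \<open>v\<close> is adjacent to all other vertices of
  \<open>y\<close>; since \<open>\<tau>\<close> and \<open>\<sigma>\<close> both use all
  \<open>k\<close> colours and induce the same partition of \<open>B - {j}\<close>, the index
  \<open>j\<close> is alone in its \<open>\<sigma>\<close>-class too, and \<open>\<sigma> j\<close>
  works.\<close>

lemma colour_matches:
  assumes j: "j \<in> B" "v \<in> V j" and good: "good (y(j := v)) \<tau>"
  shows "matches j v (colour v)"
proof -
  have \<tau>: "\<not> adj v (y l) \<longleftrightarrow> \<tau> j = \<tau> l" if "l \<in> B - {j}" for l
    using goodD[OF good, of j l] j that by auto
  have ker: "\<tau> l = \<tau> l' \<longleftrightarrow> \<sigma> l = \<sigma> l'" if "l \<in> B - {j}" "l' \<in> B - {j}" for l l'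
    using goodD[OF good, of l l'] goodD[OF y(2), of l l'] that by (cases "l = l'") auto
  have "\<exists>a. matches j v a"
  proof (cases "\<tau> j \<in> \<tau> ` (B - {j})")
    case True
    then obtain l0 where l0: "\<tau> j = \<tau> l0" "l0 \<in> B - {j}" by (rule imageE) blast
    have "matches j v (\<sigma> l0)" unfolding matches_def using \<tau> ker l0 by (metis image_eqI)
    then show ?thesis by blast
  next
    case False
    have "card (\<tau> ` B) = k" "card (\<sigma> ` B) = k" using good_surj[OF good] good_surj[OF y(2)] by auto
    moreover have "insert j (B - {j}) = B" using j by auto
    then have "\<tau> ` B = insert (\<tau> j) (\<tau> ` (B - {j}))" "\<sigma> ` B = insert (\<sigma> j) (\<sigma> ` (B - {j}))"
      by (metis image_insert)+
    moreover have "card (\<tau> ` (B - {j})) = card (\<sigma> ` (B - {j}))"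
      using ker finB by (intro card_image_eq_if_same_kernel) auto
    ultimately have "\<sigma> j \<notin> \<sigma> ` (B - {j})" using False finB
      by (metis card_insert_if finite_Diff finite_imageI n_not_Suc_n)
    moreover have "adj v (y l)" if "l \<in> B - {j}" for l using \<tau>[OF that] False that by auto
    ultimately have "matches j v (\<sigma> j)" unfolding matches_def by (metis image_eqI)
    then show ?thesis by blast
  qed
  then have "matches j v (SOME a. matches j v a)" by (rule someI_ex)
  then show ?thesis using good index_eq[OF j] unfolding colour_def by auto
qed

lemma colour_default:
  assumes "j \<in> B" "v \<in> V j" "\<nexists>\<tau>. good (y(j := v)) \<tau>"
  shows "colour v = \<sigma> j"
  using assms index_eq[OF assms(1,2)] unfolding colour_def by auto

lemma colour_in:
  assumes "j \<in> B" "v \<in> V j"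
  shows "colour v \<in> {1..k}"
proof (cases "\<exists>\<tau>. good (y(j := v)) \<tau>")
  case True
  then have "matches j v (colour v)" using colour_matches assms by blast
  then have "colour v \<in> \<sigma> ` B" using assms(1) unfolding matches_def by blast
  then show ?thesis using \<sigma>_in by auto
next
  case False
  then show ?thesis using colour_default[OF assms] \<sigma>_in[OF assms(1)] by simp
qed

text \<open>If one of the two colours occurs on the remaining indices \<open>R\<close>, the
  comparison is made with a vertex of \<open>y\<close> there. Otherwise colours are counted:
  \<open>\<sigma>\<close> and \<open>\<tau>\<close> use equally many on \<open>R\<close>. When
  \<open>\<tau> i = \<tau> j\<close> just one colour is left for both vertices; when they differ two
  are left, and each vertex must take that of its own index.\<close>

lemma colour_pair:
  assumes ij: "i \<in> B" "j \<in> B" "i \<noteq> j" and u: "u \<in> V i" and v: "v \<in> V j"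
    and good: "good (y(i := u)) \<tau>1" "good (y(j := v)) \<tau>2" "good (y(i := u, j := v)) \<tau>"
  shows "\<not> adj u v \<longleftrightarrow> colour u = colour v"
proof -
  define R where "R = B - {i, j}"
  have R: "finite R" "B = insert i (insert j R)" using finB ij by (auto simp: R_def)
  have mu: "matches i u (colour u)" and mv: "matches j v (colour v)"
    using colour_matches ij u v good by blast+
  have uR: "\<not> adj u (y l) \<longleftrightarrow> \<sigma> l = colour u" "\<not> adj u (y l) \<longleftrightarrow> \<tau> i = \<tau> l"
    and vR: "\<not> adj v (y l) \<longleftrightarrow> \<sigma> l = colour v" "\<not> adj v (y l) \<longleftrightarrow> \<tau> j = \<tau> l" if "l \<in> R" for l
  proof -
    have l: "l \<in> B" "l \<noteq> i" "l \<noteq> j" using that by (auto simp: R_def)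
    show "\<not> adj u (y l) \<longleftrightarrow> \<sigma> l = colour u" "\<not> adj v (y l) \<longleftrightarrow> \<sigma> l = colour v"
      using mu mv l unfolding matches_def by blast+
    show "\<not> adj u (y l) \<longleftrightarrow> \<tau> i = \<tau> l" "\<not> adj v (y l) \<longleftrightarrow> \<tau> j = \<tau> l"
      using goodD[OF good(3), of i l] goodD[OF good(3), of j l] ij l by auto
  qed
  have uv: "\<not> adj u v \<longleftrightarrow> \<tau> i = \<tau> j" using goodD[OF good(3) ij] ij by auto
  have ker: "\<tau> l = \<tau> l' \<longleftrightarrow> \<sigma> l = \<sigma> l'" if "l \<in> R" "l' \<in> R" for l l'
    using goodD[OF good(3), of l l'] goodD[OF y(2), of l l'] that by (cases "l = l'") (auto simp: R_def)
  have cR: "card (\<tau> ` R) = card (\<sigma> ` R)"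
    using ker R(1) by (intro card_image_eq_if_same_kernel) auto
  have cs: "card (insert (\<tau> i) (insert (\<tau> j) (\<tau> ` R))) = k"
    using good_surj[OF good(3)] R(2) by (metis image_insert card_atLeastAtMost diff_Suc_1)
  show ?thesis
  proof (cases "colour u \<in> \<sigma> ` R \<or> colour v \<in> \<sigma> ` R")
    case True
    then show ?thesis using uR vR uv by (auto simp: image_iff; metis)
  next
    case False
    have "\<tau> i \<noteq> \<tau> l \<and> \<tau> j \<noteq> \<tau> l" if "l \<in> R" for l
      using uR[OF that] vR[OF that] False imageI[OF that, of \<sigma>] by auto
    then have nR: "\<tau> i \<notin> \<tau> ` R" "\<tau> j \<notin> \<tau> ` R" by blast+
    have \<sigma>B: "insert (\<sigma> i) (insert (\<sigma> j) (\<sigma> ` R)) = {1..k}"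
      using good_surj[OF y(2)] R(2) by (metis image_insert)
    have uk: "colour u \<in> {1..k}" "colour v \<in> {1..k}" using colour_in ij u v by auto
    show ?thesis
    proof (cases "\<tau> i = \<tau> j")
      case True
      then have "Suc (card (\<sigma> ` R)) = k" using cs nR R(1) cR by simp
      then have "card ({1..k} - \<sigma> ` R) = 1"
        using \<sigma>B R(1) by (subst card_Diff_subset) auto
      then obtain x where "{1..k} - \<sigma> ` R = {x}" by (auto simp: card_1_singleton_iff)
      then have "colour u = x" "colour v = x" using False uk by blast+
      then show ?thesis using uv True by simp
    next
      case ne: False
      then have card2: "Suc (Suc (card (\<sigma> ` R))) = k" using cs nR R(1) cR by simp
      have "\<sigma> i \<noteq> \<sigma> j"
      proof
        assume "\<sigma> i = \<sigma> j"
        then have "card {1..k} \<le> Suc (card (\<sigma> ` R))"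
          unfolding \<sigma>B[symmetric] using R(1) by (simp add: card_insert_if)
        then show False using card2 by simp
      qed
      \<comment> \<open>Formulated for both orders of \<open>i\<close> and \<open>j\<close>. With
        colour \<open>\<sigma> b\<close>, \<open>x\<close> would be nonadjacent to
        \<open>y b\<close>, so \<open>a\<close> and \<open>b\<close> would share a class of
        \<open>\<tau>'\<close>, leaving that colouring with at most \<open>k - 1\<close>
        colours.\<close>
      have one: "colour x \<noteq> \<sigma> b"
        if "a \<in> B" "b \<in> B" "a \<noteq> b" "{a, b} = {i, j}" "x \<in> V a" "good (y(a := x)) \<tau>'" "colour x \<notin> \<sigma> ` R" for a b x \<tau>'
      proof
        assume c: "colour x = \<sigma> b"
        have m: "matches a x (colour x)" using colour_matches that by blast
        have "R = B - {a, b}" unfolding R_def that(4) ..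
        then have Rb: "b \<notin> R" "a \<notin> R" "B = insert a (insert b R)" using that(1,2) by auto
        have "\<not> adj x (y b)" using m c that(2,3) unfolding matches_def by auto
        then have "\<tau>' a = \<tau>' b" using goodD[OF that(6,1,2,3)] that(3) by auto
        moreover have "\<tau>' ` B = {1..k}" using good_surj that by blast
        ultimately have "{1..k} = insert (\<tau>' b) (\<tau>' ` R)" using Rb by auto
        then have "card {1..k} \<le> Suc (card (\<tau>' ` R))" using R(1) by (simp add: card_insert_if)
        moreover have "card (\<tau>' ` R) = card (\<sigma> ` R)"
        proof (rule card_image_eq_if_same_kernel[OF R(1)])
          fix l l' assume l: "l \<in> R" "l' \<in> R"
          then have "l \<noteq> a" "l' \<noteq> a" using Rb by auto
          with l show "\<tau>' l = \<tau>' l' \<longleftrightarrow> \<sigma> l = \<sigma> l'"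
            using goodD[OF that(6), of l l'] goodD[OF y(2), of l l'] Rb by (cases "l = l'") auto
        qed
        ultimately show False using card2 by simp
      qed
      have "colour u \<noteq> \<sigma> j" "colour v \<noteq> \<sigma> i"
        using one[of i j u] one[of j i v] ij u v good False by (auto simp: insert_commute)
      then have "colour u = \<sigma> i" "colour v = \<sigma> j" using uk False \<sigma>B by blast+
      then show ?thesis using uv ne \<open>\<sigma> i \<noteq> \<sigma> j\<close> by simp
    qed
  qed
qed

lemma heavy_alone:
  assumes "good x \<tau>" "i \<in> B" "j \<in> B" "i \<noteq> j" "g + \<Lambda> * c < w i * w j"
  shows "\<tau> i \<noteq> \<tau> j"
  using inside_ge_pair[of B w i j \<tau>] assms w_pos finB by (force simp: good_def less_imp_le)

text \<open>The weight hypothesis isolates \<open>i\<close> in every good colouring, by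
  \<open>heavy_alone\<close>. This forces all adjacencies that the definition of
  \<open>colour\<close> looks at, and the default value agrees where there is no good
  colouring.\<close>

lemma colour_heavy:
  assumes i: "i \<in> B" and heavy: "\<And>j. j \<in> B \<Longrightarrow> j \<noteq> i \<Longrightarrow> g + \<Lambda> * c < w i * w j"
  shows "v \<in> V i \<Longrightarrow> colour v = \<sigma> i" "j \<in> B \<Longrightarrow> j \<noteq> i \<Longrightarrow> v \<in> V j \<Longrightarrow> colour v \<noteq> \<sigma> i"
proof -
  show "colour v = \<sigma> i" if v: "v \<in> V i"
  proof (cases "\<exists>\<tau>. good (y(i := v)) \<tau>")
    case True
    then obtain \<tau> where \<tau>: "good (y(i := v)) \<tau>" by blast
    have m: "matches i v (colour v)" using colour_matches[OF i v \<tau>] .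
    have "colour v \<notin> \<sigma> ` (B - {i})"
    proof
      assume "colour v \<in> \<sigma> ` (B - {i})"
      then obtain l where l: "colour v = \<sigma> l" "l \<in> B - {i}" by (rule imageE) blast
      then have "\<not> adj v (y l)" using m unfolding matches_def by simp
      then have "\<tau> i = \<tau> l" using goodD[OF \<tau> i, of l] l by auto
      then show False using heavy_alone[OF \<tau> i, of l] l heavy[of l] by auto
    qed
    then show ?thesis using m by (auto simp: matches_def)
  qed (use colour_default[OF i v] in simp)
  show "colour v \<noteq> \<sigma> i" if j: "j \<in> B" "j \<noteq> i" "v \<in> V j"
  proof (cases "\<exists>\<tau>. good (y(j := v)) \<tau>")
    case True
    then obtain \<tau> where \<tau>: "good (y(j := v)) \<tau>" by blast
    have m: "matches j v (colour v)" using colour_matches[OF j(1,3) \<tau>] .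
    have "\<tau> i \<noteq> \<tau> j" using heavy_alone[OF \<tau> i j(1)] j heavy by auto
    then have "adj v (y i)" using goodD[OF \<tau> j(1) i] j(2) by auto
    moreover have "\<not> adj v (y i) \<longleftrightarrow> \<sigma> i = colour v" using m i j(2) unfolding matches_def by blast
    ultimately show ?thesis by auto
  next
    case False
    then show ?thesis using colour_default[OF j(1,3)] heavy_alone[OF y(2) i j(1)] j heavy by auto
  qed
qed

lemma colour_transversal:
  assumes z: "z \<in> \<Omega>" and good: "\<And>J. J \<subseteq> B \<Longrightarrow> \<exists>\<tau>. good (mix J y z) \<tau>"
  shows "\<And>i j. i \<in> B \<Longrightarrow> j \<in> B \<Longrightarrow> i \<noteq> j \<Longrightarrow> \<not> adj (z i) (z j) \<longleftrightarrow> colour (z i) = colour (z j)"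
    and "inside B w (\<lambda>i. colour (z i)) \<le> g + \<Lambda> * c"
proof -
  show pair: "\<not> adj (z i) (z j) \<longleftrightarrow> colour (z i) = colour (z j)" if ij: "i \<in> B" "j \<in> B" "i \<noteq> j" for i j
  proof -
    have eq: "mix {i} y z = y(i := z i)" "mix {j} y z = y(j := z j)" "mix {i, j} y z = y(i := z i, j := z j)"
      using ij by (auto simp: mix_def)
    obtain \<tau>1 \<tau>2 \<tau> where "good (y(i := z i)) \<tau>1" "good (y(j := z j)) \<tau>2" "good (y(i := z i, j := z j)) \<tau>"
      using good[of "{i}"] good[of "{j}"] good[of "{i, j}"] ij unfolding eq by auto
    then show ?thesis using ij z by (intro colour_pair) (auto simp: PiE_iff)
  qed
  have eq: "mix B y z = z" using z y(1) by (auto simp: mix_def PiE_iff extensional_def)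
  obtain \<tau> where \<tau>: "good z \<tau>" using good[of B] unfolding eq by auto
  have "inside B w (\<lambda>i. colour (z i)) = inside B w \<tau>"
    using pair \<tau> by (intro inside_cong_kernel) (auto simp: good_def)
  then show "inside B w (\<lambda>i. colour (z i)) \<le> g + \<Lambda> * c" using \<tau> by (simp add: good_def)
qed

end

lemma ex_colouring:
  assumes few: "2 ^ card B * card bad < card \<Omega>"
  obtains Z f where "Z \<subseteq> \<Omega>" "card \<Omega> \<le> card Z + 2 ^ card B * card bad"
    "\<forall>i\<in>B. \<forall>v\<in>V i. f v \<in> {1..k}"
    "\<forall>z\<in>Z. \<forall>i\<in>B. \<forall>j\<in>B. i \<noteq> j \<longrightarrow> (\<not> adj (z i) (z j) \<longleftrightarrow> f (z i) = f (z j))"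
    "\<forall>z\<in>Z. inside B w (\<lambda>i. f (z i)) \<le> g + \<Lambda> * c"
    "\<forall>i\<in>B. (\<forall>j\<in>B. j \<noteq> i \<longrightarrow> g + \<Lambda> * c < w i * w j) \<longrightarrow>
       (\<exists>a. (\<forall>v\<in>V i. f v = a) \<and> (\<forall>j\<in>B. j \<noteq> i \<longrightarrow> (\<forall>v\<in>V j. f v \<noteq> a)))"
proof -
  obtain y where y: "y \<in> \<Omega>" "card {z \<in> \<Omega>. \<exists>J\<subseteq>B. mix J y z \<in> bad} \<le> 2 ^ card B * card bad"
    using ex_reference[of bad] by (auto simp: bad_def)
  define Z where "Z = {z \<in> \<Omega>. \<not> (\<exists>J\<subseteq>B. mix J y z \<in> bad)}"
  define Y where "Y = {z \<in> \<Omega>. \<exists>J\<subseteq>B. mix J y z \<in> bad}"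
  have "Z \<union> Y = \<Omega>" by (auto simp: Z_def Y_def)
  then have cZ: "card \<Omega> \<le> card Z + 2 ^ card B * card bad"
    using y(2) card_Un_le[of Z Y] unfolding Y_def[symmetric] by simp
  have gm: "\<exists>\<tau>. good (mix J y z) \<tau>" if "z \<in> Z" "J \<subseteq> B" for z J
    using that mix_in[OF y(1), of z J] unfolding Z_def bad_def by blast
  have "Z \<noteq> {}" using cZ few by auto
  then obtain z where "z \<in> Z" by auto
  \<comment> \<open>With \<open>J\<close> empty, any single member of \<open>Z\<close> certifies
    that \<open>y\<close> itself is good.\<close>
  have "mix {} y z = y" by (simp add: mix_def)
  then obtain \<sigma> where \<sigma>: "good y \<sigma>" using gm[OF \<open>z \<in> Z\<close>, of "{}"] by auto
  show thesis
  proof (rule that[of Z "colour y \<sigma>"]; (intro ballI impI)?)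
    show "Z \<subseteq> \<Omega>" by (auto simp: Z_def)
    show "card \<Omega> \<le> card Z + 2 ^ card B * card bad" by (rule cZ)
    show "colour y \<sigma> v \<in> {1..k}" if "i \<in> B" "v \<in> V i" for i v using colour_in[OF y(1) \<sigma> that] .
    show "(\<not> adj (z i) (z j)) = (colour y \<sigma> (z i) = colour y \<sigma> (z j))"
      if "z \<in> Z" "i \<in> B" "j \<in> B" "i \<noteq> j" for z i j
      using that gm by (intro colour_transversal(1)[OF y(1) \<sigma>]) (auto simp: Z_def)
    show "inside B w (\<lambda>i. colour y \<sigma> (z i)) \<le> g + \<Lambda> * c" if "z \<in> Z" for z
      using that gm by (intro colour_transversal(2)[OF y(1) \<sigma>]) (auto simp: Z_def)
    show "\<exists>a. (\<forall>v\<in>V i. colour y \<sigma> v = a) \<and> (\<forall>j\<in>B. j \<noteq> i \<longrightarrow> (\<forall>v\<in>V j. colour y \<sigma> v \<noteq> a))"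
      if "i \<in> B" "\<forall>j\<in>B. j \<noteq> i \<longrightarrow> g + \<Lambda> * c < w i * w j" for i
      using colour_heavy[OF y(1) \<sigma> that(1)] that(2) by (intro exI[of _ "\<sigma> i"]) blast
  qed
qed

end

subsection \<open>The exceptional vertices\<close>

definition has_blow_up :: "nat set \<Rightarrow> (nat \<Rightarrow> 'a set) \<Rightarrow> ('a \<Rightarrow> 'a \<Rightarrow> bool) \<Rightarrow> nat \<Rightarrow> nat \<Rightarrow> bool" where
  "has_blow_up B V adj t s \<longleftrightarrow> (\<exists>J\<subseteq>B. \<exists>S. card J = t \<and> (\<forall>j\<in>J. S j \<subseteq> V j \<and> card (S j) = s) \<and>
     (\<forall>i\<in>J. \<forall>j\<in>J. i \<noteq> j \<longrightarrow> (\<forall>u\<in>S i. \<forall>v\<in>S j. adj u v)))"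

text \<open>Supersaturation: if cliques were frequent, one of at most \<open>2 ^ r\<close> index
  sets \<open>J\<close> would carry a positive fraction of the transversals, and a box inside these
  is a blow-up of a clique.\<close>

lemma few_cliques:
  fixes \<eta> :: real
  assumes "\<eta> > 0"
  shows "\<exists>N0. \<forall>B (V :: nat \<Rightarrow> 'a set) adj. transversals B V adj \<longrightarrow> card B \<le> r \<longrightarrow> (\<forall>i\<in>B. N0 \<le> card (V i)) \<longrightarrow>
    \<not> has_blow_up B V adj t s \<longrightarrow> real (card (transversals.cliques B V adj t)) \<le> \<eta> * real (card (PiE B V))"
proof -
  define \<eta>' where "\<eta>' = \<eta> / 2 ^ r"
  have \<eta>': "\<eta>' > 0" using assms by (simp add: \<eta>'_def)
  define P where "P q N \<longleftrightarrow> (\<forall>(J :: nat set) (A :: nat \<Rightarrow> 'a set) T.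
     finite J \<and> card J = q \<and> (\<forall>j\<in>J. finite (A j) \<and> N \<le> card (A j)) \<and> T \<subseteq> PiE J A \<and>
     real (card T) \<ge> \<eta>' * (\<Prod>j\<in>J. real (card (A j)))
     \<longrightarrow> (\<exists>S. (\<forall>j\<in>J. S j \<subseteq> A j \<and> card (S j) = s) \<and> PiE J S \<subseteq> T))" for q N
  have "\<exists>N. P q N" for q
    using dense_product_contains_box[where 'a = 'a and s = s and q = q, rule_format, OF \<eta>'] unfolding P_def .
  then obtain N where N: "\<And>q. P q (N q)" by metis
  define N0 where "N0 = (\<Sum>q\<le>r. N q)"
  show ?thesis
  proof (intro exI[of _ N0] allI impI)
    fix B and V :: "nat \<Rightarrow> 'a set" and adj
    assume tr: "transversals B V adj" and r: "card B \<le> r" and V: "\<forall>i\<in>B. N0 \<le> card (V i)"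
      and no: "\<not> has_blow_up B V adj t s"
    interpret transversals B V adj by (rule tr)
    show "real (card (cliques t)) \<le> \<eta> * real (card \<Omega>)"
    proof (rule ccontr)
      assume "\<not> ?thesis"
      then have more: "\<eta> * real (card \<Omega>) < real (card (cliques t))" by simp
      define T where "T J = {x \<in> \<Omega>. \<forall>i\<in>J. \<forall>j\<in>J. i \<noteq> j \<longrightarrow> adj (x i) (x j)}" for J
      define F where "F = {J \<in> Pow B. card J = t}"
      have finF: "finite F" using finB by (simp add: F_def)
      have "cliques t = (\<Union>J\<in>F. T J)" by (auto simp: cliques_def T_def F_def)
      then have "card (cliques t) \<le> (\<Sum>J\<in>F. card (T J))" using finF by (simp add: card_UN_le)
      then have le: "real (card (cliques t)) \<le> (\<Sum>J\<in>F. real (card (T J)))"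
        unfolding of_nat_sum[symmetric] by (simp only: of_nat_le_iff)
      have "\<exists>J\<in>F. \<eta>' * real (card \<Omega>) \<le> real (card (T J))"
      proof (rule ccontr)
        assume "\<not> ?thesis"
        then have "(\<Sum>J\<in>F. real (card (T J))) \<le> (\<Sum>J\<in>F. \<eta>' * real (card \<Omega>))"
          by (intro sum_mono) (meson less_imp_le not_le)
        also have "\<dots> = real (card F) * (\<eta>' * real (card \<Omega>))" by simp
        also have "\<dots> \<le> 2 ^ r * (\<eta>' * real (card \<Omega>))"
        proof (rule mult_right_mono)
          have "card F \<le> card (Pow B)" using finB by (intro card_mono) (auto simp: F_def)
          also have "\<dots> \<le> 2 ^ r" using finB r by (simp add: card_Pow)
          finally have "real (card F) \<le> real (2 ^ r)" by (simp only: of_nat_le_iff)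
          then show "real (card F) \<le> 2 ^ r" by simp
        qed (use \<eta>' in simp)
        also have "\<dots> = \<eta> * real (card \<Omega>)" by (simp add: \<eta>'_def)
        finally show False using le more by linarith
      qed
      then obtain J where J: "J \<in> F" "\<eta>' * real (card \<Omega>) \<le> real (card (T J))" by blast
      \<comment> \<open>The box is found in the product over all of \<open>B\<close> and restricted
        to \<open>J\<close> only afterwards, so \<open>T J\<close> need not be projected. As only
        \<open>card B \<le> r\<close> is known, \<open>N0\<close> dominates the thresholds of all
        dimensions.\<close>
      have "N (card B) \<le> N0" unfolding N0_def using r by (intro member_le_sum) auto
      then have NV: "\<forall>i\<in>B. finite (V i) \<and> N (card B) \<le> card (V i)" using V finV by fastforce
      have "real (card \<Omega>) = (\<Prod>j\<in>B. real (card (V j)))" using finB by (simp add: card_PiE)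
      then have "\<exists>S. (\<forall>j\<in>B. S j \<subseteq> V j \<and> card (S j) = s) \<and> PiE B S \<subseteq> T J"
        using N[of "card B", unfolded P_def, rule_format, of B V "T J"] finB NV J(2) by (auto simp: T_def)
      then obtain S where S: "\<And>j. j \<in> B \<Longrightarrow> S j \<subseteq> V j \<and> card (S j) = s" "PiE B S \<subseteq> T J" by blast
      have "has_blow_up B V adj t s"
        unfolding has_blow_up_def
      proof (intro exI[of _ J] exI[of _ S] conjI ballI impI)
        show JB: "J \<subseteq> B" "card J = t" using J by (auto simp: F_def)
        show "S j \<subseteq> V j" "card (S j) = s" if "j \<in> J" for j using S JB that by auto
        fix i j u v assume ij: "i \<in> J" "j \<in> J" "i \<noteq> j" and uv: "u \<in> S i" "v \<in> S j"
        have "i \<in> B" using ij JB by auto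
        then have "finite (S i)" "card (S i) = s" using S(1)[of i] finV[of i] finite_subset by blast+
        then have "s \<noteq> 0" using uv(1) card_gt_0_iff[of "S i"] by auto
        then have "\<forall>l\<in>B. \<exists>x. x \<in> S l" using S(1) by (metis card.empty ex_in_conv)
        then obtain e where e: "\<And>l. l \<in> B \<Longrightarrow> e l \<in> S l" by metis
        \<comment> \<open>Any \<open>u\<close> and \<open>v\<close> from the box have to be
          completed to a full transversal in it; \<open>s \<noteq> 0\<close> provides the other
          coordinates.\<close>
        define x where "x = (\<lambda>l. if l = i then u else if l = j then v else if l \<in> B then e l else undefined)"
        have "x \<in> PiE B S" using e uv ij JB by (auto simp: x_def PiE_iff extensional_def)
        then have "x \<in> T J" using S(2) by blast
        then have "adj (x i) (x j)" using ij unfolding T_def by blast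
        then show "adj u v" using ij by (simp add: x_def)
      qed
      then show False using no by blast
    qed
  qed
qed

context dense_transversals
begin

text \<open>Two kinds of vertices are discarded: those in many wrong pairs and those whose colour is
  rare in their class. The rarity threshold \<open>\<xi>\<close> is a compromise: small, since rare
  cells are deleted, but with \<open>\<xi> ^ card B\<close> above the fraction
  \<open>\<beta>\<close> of exceptional transversals, and large against \<open>\<zeta>\<close>, so
  that no supported cell disappears.\<close>

lemma ex_exceptional_set:
  fixes m L \<xi> \<omega> \<epsilon> \<zeta> \<beta> \<delta> \<eta> :: real
  assumes miss: "missing \<le> g + \<delta>" "0 \<le> \<eta>" "real (card (cliques (Suc k))) \<le> \<eta> * real (card \<Omega>)"
    and few: "2 ^ card B * real (card bad) \<le> \<beta> * real (card \<Omega>)" "\<beta> < \<xi> ^ card B"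
    and \<xi>: "0 < \<xi>" "\<xi> * real k \<le> 1" "\<xi> \<le> 1"
    and m: "0 < m" "0 < L"
    and heavy: "\<And>i j. i \<in> B \<Longrightarrow> j \<in> B \<Longrightarrow> j \<noteq> i \<Longrightarrow> L * m < w i \<Longrightarrow> 2 * U \<le> w i * w j \<and> g + \<Lambda> * c < w i * w j"
    and \<omega>: "2 * (\<delta> + \<eta> * U) \<le> \<omega> * m\<^sup>2" "\<beta> * L\<^sup>2 \<le> \<omega>"
    and \<epsilon>: "0 < \<epsilon>" "(real (card B))\<^sup>2 * \<omega> \<le> \<zeta> * \<epsilon>" and \<zeta>: "\<zeta> * m < \<xi> * c"
  shows "\<exists>f X1 supp. near_optimal_supports B k w supp \<Lambda> c \<and> (\<forall>i\<in>B. \<forall>v\<in>V i. f v \<in> {1..k}) \<and>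
     X1 \<subseteq> (\<Union>i\<in>B. V i) \<and> real (card X1) \<le> (\<zeta> + real (card B) * (real k * \<xi> * L)) * m \<and>
     (\<forall>i\<in>B. \<forall>a\<in>{1..k}. (\<exists>v\<in>V i - X1. f v = a) \<longleftrightarrow> a \<in> supp i) \<and>
     (\<forall>i\<in>B. \<forall>v\<in>V i - X1. real (card {u \<in> (\<Union>j\<in>B - {i}. V j). \<not> (adj v u \<longleftrightarrow> f v \<noteq> f u)}) \<le> \<epsilon> * m)"
proof -
  have cO: "0 < real (card \<Omega>)" using fin\<Omega> \<Omega>_ne by (simp add: card_gt_0_iff)
  have \<beta>1: "\<beta> < 1" using few(2) power_le_one[of \<xi> "card B"] \<xi> by linarith
  have "real (2 ^ card B * card bad) < real (card \<Omega>)"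
  proof -
    have "\<beta> * real (card \<Omega>) < 1 * real (card \<Omega>)" using \<beta>1 cO by (intro mult_strict_right_mono) auto
    then show ?thesis using few(1) by simp
  qed
  then have "2 ^ card B * card bad < card \<Omega>" by (simp only: of_nat_less_iff)
  then obtain Z f where Z: "Z \<subseteq> \<Omega>" "card \<Omega> \<le> card Z + 2 ^ card B * card bad"
    and f0: "\<forall>i\<in>B. \<forall>v\<in>V i. f v \<in> {1..k}"
    and pair0: "\<forall>z\<in>Z. \<forall>i\<in>B. \<forall>j\<in>B. i \<noteq> j \<longrightarrow> (\<not> adj (z i) (z j) \<longleftrightarrow> f (z i) = f (z j))"
    and ins0: "\<forall>z\<in>Z. inside B w (\<lambda>i. f (z i)) \<le> g + \<Lambda> * c"
    and mono0: "\<forall>i\<in>B. (\<forall>j\<in>B. j \<noteq> i \<longrightarrow> g + \<Lambda> * c < w i * w j) \<longrightarrow>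
       (\<exists>a. (\<forall>v\<in>V i. f v = a) \<and> (\<forall>j\<in>B. j \<noteq> i \<longrightarrow> (\<forall>v\<in>V j. f v \<noteq> a)))"
    by (rule ex_colouring)
  have f: "f v \<in> {1..k}" if "i \<in> B" "v \<in> V i" for i v using f0 that by blast
  have pair: "\<not> adj (z i) (z j) \<longleftrightarrow> f (z i) = f (z j)" if "z \<in> Z" "i \<in> B" "j \<in> B" "i \<noteq> j" for z i j
    using pair0 that by blast
  have ins: "inside B w (\<lambda>i. f (z i)) \<le> g + \<Lambda> * c" if "z \<in> Z" for z using ins0 that by blast
  have finZ: "finite Z" using Z(1) fin\<Omega> finite_subset by blast
  have "card (\<Omega> - Z) = card \<Omega> - card Z" using Z(1) finZ by (intro card_Diff_subset)
  then have "card (\<Omega> - Z) \<le> 2 ^ card B * card bad" using Z(2) by linarith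
  then have "real (card (\<Omega> - Z)) \<le> real (2 ^ card B * card bad)" by (simp only: of_nat_le_iff)
  then have cZ: "real (card (\<Omega> - Z)) \<le> \<beta> * real (card \<Omega>)" using few(1) by simp

  \<comment> \<open>Well-represented colours and near-optimality\<close>
  define cell where "cell i a = {v \<in> V i. f v = a}" for i a
  define supp where "supp i = {a \<in> {1..k}. \<xi> * w i \<le> real (card (cell i a))}" for i
  have fincell: "finite (cell i a)" if "i \<in> B" for i a using finV[OF that] by (simp add: cell_def)
  have heavy_mono: "\<exists>a. (\<forall>v\<in>V i. f v = a) \<and> (\<forall>j\<in>B. j \<noteq> i \<longrightarrow> (\<forall>v\<in>V j. f v \<noteq> a))"
    if "i \<in> B" "L * m < w i" for i
  proof -
    have "\<forall>j\<in>B. j \<noteq> i \<longrightarrow> g + \<Lambda> * c < w i * w j" using heavy[OF that(1)] that(2) by blast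
    then show ?thesis using mono0 that(1) by blast
  qed
  have near: "near_optimal_supports B k w supp \<Lambda> c"
  proof
    fix i assume i: "i \<in> B"
    have "supp i \<noteq> {}"
    proof
      assume "supp i = {}"
      then have lt: "real (card (cell i a)) < \<xi> * w i" if "a \<in> {1..k}" for a using that by (auto simp: supp_def)
      have "V i = (\<Union>a\<in>{1..k}. cell i a)" using f i by (auto simp: cell_def)
      then have "card (V i) \<le> (\<Sum>a\<in>{1..k}. card (cell i a))" by (metis card_UN_le finite_atLeastAtMost)
      then have "w i \<le> (\<Sum>a\<in>{1..k}. real (card (cell i a)))"
        unfolding w_def of_nat_sum[symmetric] by (simp only: of_nat_le_iff)
      also have "\<dots> < (\<Sum>a\<in>{1..k}. \<xi> * w i)"
      proof (rule sum_strict_mono)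
        obtain v where "v \<in> V i" using V_ne[OF i] by blast
        then show "{1..k} \<noteq> {}" using f[OF i, of v] by auto
      qed (use lt in auto)
      also have "\<dots> = (\<xi> * real k) * w i" by simp
      also have "\<dots> \<le> 1 * w i" using \<xi> w_pos[OF i] by (intro mult_right_mono) auto
      finally show False by simp
    qed
    then show "supp i \<noteq> {} \<and> supp i \<subseteq> {1..k}" by (auto simp: supp_def)
  next
    fix \<sigma> \<tau> assume \<sigma>: "\<sigma> \<in> Pi B supp" and \<tau>: "\<tau> \<in> B \<rightarrow> {1..k}"
    \<comment> \<open>A product of supported cells has density at least
      \<open>\<xi> ^ card B\<close>, so it cannot avoid \<open>Z\<close>; a member of
      \<open>Z\<close> in it realises \<open>\<sigma>\<close> and is nearly optimal.\<close>
    define A where "A = PiE B (\<lambda>i. cell i (\<sigma> i))"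
    have AO: "A \<subseteq> \<Omega>" unfolding A_def cell_def by (auto simp: PiE_iff)
    have "\<xi> ^ card B * real (card \<Omega>) = (\<Prod>i\<in>B. \<xi> * w i)"
      using finB by (simp add: card_PiE prod.distrib w_def)
    also have "\<dots> \<le> (\<Prod>i\<in>B. real (card (cell i (\<sigma> i))))"
      using \<sigma> \<xi> w_pos by (intro prod_mono) (auto simp: Pi_iff supp_def less_imp_le)
    also have "\<dots> = real (card A)" using finB by (simp add: A_def card_PiE)
    finally have cA: "\<xi> ^ card B * real (card \<Omega>) \<le> real (card A)" .
    have "\<not> A \<subseteq> \<Omega> - Z"
    proof
      assume "A \<subseteq> \<Omega> - Z"
      then have "card A \<le> card (\<Omega> - Z)" using fin\<Omega> by (intro card_mono) auto
      then have "\<xi> ^ card B * real (card \<Omega>) \<le> \<beta> * real (card \<Omega>)" using cA cZ by linarith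
      then show False using few(2) cO by simp
    qed
    then obtain z where z: "z \<in> A" "z \<in> Z" using AO by blast
    have "inside B w \<sigma> = inside B w (\<lambda>i. f (z i))"
      using z(1) by (intro inside_cong_kernel) (auto simp: A_def cell_def PiE_iff)
    then show "inside B w \<sigma> \<le> inside B w \<tau> + \<Lambda> * c" using ins[OF z(2)] g[OF \<tau>] by linarith
  qed (use finB kB wc c in auto)

  \<comment> \<open>Wrong pairs between two classes\<close>
  define M where "M i j = {(u, v) \<in> V i \<times> V j. \<not> (adj u v \<longleftrightarrow> f u \<noteq> f v)}" for i j
  have M_le: "real (card (M i j)) \<le> \<omega> * m\<^sup>2" if ij: "i \<in> B" "j \<in> B" "i \<noteq> j" for i j
  proof (cases "L * m < w i \<or> L * m < w j")
    case True
    \<comment> \<open>A heavy class does not share its colour, so all wrong pairs at it are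
      non-edges and the absolute bound applies. Without a heavy class, \<open>w i * w j\<close> is
      at most \<open>(L * m)^2\<close> and the frequency bound suffices.\<close>
    have "f u \<noteq> f v" if uv: "u \<in> V i" "v \<in> V j" for u v
      using True
    proof
      assume "L * m < w i"
      from heavy_mono[OF ij(1) this] obtain a where "f u = a" "f v \<noteq> a" using uv ij by metis
      then show ?thesis by simp
    next
      assume "L * m < w j"
      from heavy_mono[OF ij(2) this] obtain a where "f v = a" "f u \<noteq> a" using uv ij by metis
      then show ?thesis by simp
    qed
    then have "M i j \<subseteq> {(u, v) \<in> V i \<times> V j. \<not> adj u v}" unfolding M_def by auto
    moreover have "finite {(u, v) \<in> V i \<times> V j. \<not> adj u v}"
      by (rule finite_subset[of _ "V i \<times> V j"]) (use finV ij in auto)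
    ultimately have "real (card (M i j)) \<le> nonadj i j"
      unfolding nonadj_def of_nat_le_iff by (intro card_mono)
    also have "\<dots> \<le> 2 * (\<delta> + \<eta> * U)"
    proof (rule nonadj_heavy_pair[OF miss ij])
      show "2 * U \<le> w i * w j" using True heavy[of i j] heavy[of j i] ij by (auto simp: mult.commute)
    qed
    finally show ?thesis using \<omega>(1) by linarith
  next
    case False
    have "{x \<in> \<Omega>. (x i, x j) \<in> M i j} \<subseteq> \<Omega> - Z" using pair ij by (auto simp: M_def)
    then have "card {x \<in> \<Omega>. (x i, x j) \<in> M i j} \<le> card (\<Omega> - Z)" using fin\<Omega> by (intro card_mono) auto
    then have "real (card {x \<in> \<Omega>. (x i, x j) \<in> M i j}) \<le> \<beta> * real (card \<Omega>)" using cZ by linarith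
    then have "real (card {x \<in> \<Omega>. (x i, x j) \<in> M i j}) * (w i * w j) \<le> \<beta> * real (card \<Omega>) * (w i * w j)"
      using w_pos ij by (intro mult_right_mono) (auto simp: less_imp_le)
    moreover have "real (card {x \<in> \<Omega>. (x i, x j) \<in> M i j}) * (w i * w j) = real (card (M i j)) * real (card \<Omega>)"
      by (rule card_pair_transversals[OF ij]) (auto simp: M_def)
    ultimately have "real (card (M i j)) * real (card \<Omega>) \<le> (\<beta> * (w i * w j)) * real (card \<Omega>)"
      by (simp add: algebra_simps)
    then have "real (card (M i j)) \<le> \<beta> * (w i * w j)" using cO by (rule mult_right_le_imp_le)
    also have "\<dots> \<le> \<beta> * ((L * m) * (L * m))"
    proof (rule mult_left_mono)
      show "w i * w j \<le> (L * m) * (L * m)"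
        using False w_pos ij m by (intro mult_mono) (auto simp: less_imp_le)
      have "0 \<le> \<beta> * real (card \<Omega>)" using cZ by (rule order_trans[rotated]) simp
      then show "0 \<le> \<beta>" using cO by (simp add: zero_le_mult_iff)
    qed
    also have "\<dots> = (\<beta> * L\<^sup>2) * m\<^sup>2" by (simp add: power2_eq_square)
    also have "\<dots> \<le> \<omega> * m\<^sup>2" using \<omega>(2) by (intro mult_right_mono) auto
    finally show ?thesis .
  qed

  \<comment> \<open>Vertices in many wrong pairs\<close>
  define mis where "mis i v = {u \<in> (\<Union>j\<in>B - {i}. V j). \<not> (adj v u \<longleftrightarrow> f v \<noteq> f u)}" for i v
  define Y where "Y i = {v \<in> V i. \<epsilon> * m < real (card (mis i v))}" for i
  have Y: "real (card (Y i)) * (\<epsilon> * m) \<le> real (card B) * (\<omega> * m\<^sup>2)" if i: "i \<in> B" for i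
  proof -
    have finYi: "finite (Y i)" using finV[OF i] by (simp add: Y_def)
    have cm: "card (mis i v) \<le> (\<Sum>j\<in>B - {i}. card {u \<in> V j. (v, u) \<in> M i j})" if "v \<in> V i" for v
    proof -
      have "mis i v = (\<Union>j\<in>B - {i}. {u \<in> V j. (v, u) \<in> M i j})" using that by (auto simp: mis_def M_def)
      then show ?thesis using finB by (simp add: card_UN_le)
    qed
    have "real (card (Y i)) * (\<epsilon> * m) = (\<Sum>v\<in>Y i. \<epsilon> * m)" by simp
    also have "\<dots> \<le> (\<Sum>v\<in>Y i. \<Sum>j\<in>B - {i}. real (card {u \<in> V j. (v, u) \<in> M i j}))"
    proof (rule sum_mono)
      fix v assume v: "v \<in> Y i"
      then have "real (card (mis i v)) \<le> real (\<Sum>j\<in>B - {i}. card {u \<in> V j. (v, u) \<in> M i j})"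
        using cm[of v] unfolding of_nat_le_iff by (simp add: Y_def)
      then show "\<epsilon> * m \<le> (\<Sum>j\<in>B - {i}. real (card {u \<in> V j. (v, u) \<in> M i j}))"
        using v by (simp add: Y_def)
    qed
    also have "\<dots> \<le> (\<Sum>v\<in>V i. \<Sum>j\<in>B - {i}. real (card {u \<in> V j. (v, u) \<in> M i j}))"
      using finV[OF i] by (intro sum_mono2) (auto simp: Y_def intro!: sum_nonneg)
    also have "\<dots> = (\<Sum>j\<in>B - {i}. \<Sum>v\<in>V i. real (card {u \<in> V j. (v, u) \<in> M i j}))" by (rule sum.swap)
    also have "\<dots> = (\<Sum>j\<in>B - {i}. real (card (M i j)))"
    proof (intro sum.cong refl)
      fix j assume j: "j \<in> B - {i}"
      have "M i j = Sigma (V i) (\<lambda>v. {u \<in> V j. (v, u) \<in> M i j})" by (auto simp: M_def)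
      then have "card (M i j) = card (Sigma (V i) (\<lambda>v. {u \<in> V j. (v, u) \<in> M i j}))" by (rule arg_cong)
      also have "\<dots> = (\<Sum>v\<in>V i. card {u \<in> V j. (v, u) \<in> M i j})" using finV i j by (intro card_SigmaI) auto
      finally show "(\<Sum>v\<in>V i. real (card {u \<in> V j. (v, u) \<in> M i j})) = real (card (M i j))" by simp
    qed
    also have "\<dots> \<le> (\<Sum>j\<in>B - {i}. \<omega> * m\<^sup>2)" using M_le i by (intro sum_mono) auto
    also have "\<dots> = real (card (B - {i})) * (\<omega> * m\<^sup>2)" by simp
    also have "\<dots> \<le> real (card B) * (\<omega> * m\<^sup>2)"
    proof (rule mult_right_mono)
      show "real (card (B - {i})) \<le> real (card B)" using finB by (simp add: card_mono)
      \<comment> \<open>The sign comes from the nonnegative excess, which is bounded by this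
        quantity.\<close>
      have "0 \<le> 2 * (\<delta> + \<eta> * U)"
      proof -
        have "0 \<le> (\<Sum>x\<in>\<Omega>. max 0 (miss x - g))" by (intro sum_nonneg) auto
        then have "0 \<le> real (card \<Omega>) * (\<delta> + \<eta> * U)" using sum_excess[OF miss] by linarith
        then show ?thesis using cO by (simp add: zero_le_mult_iff)
      qed
      then show "0 \<le> \<omega> * m\<^sup>2" using \<omega>(1) by linarith
    qed
    finally show ?thesis .
  qed

  \<comment> \<open>Vertices of rare colours\<close>
  define R where "R i = {v \<in> V i. f v \<notin> supp i}" for i
  have R: "real (card (R i)) \<le> real k * \<xi> * L * m" if i: "i \<in> B" for i
  proof (cases "L * m < w i")
    case True
    then obtain a where a: "\<forall>v\<in>V i. f v = a" using heavy_mono[OF i] by blast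
    obtain v where "v \<in> V i" using V_ne[OF i] by blast
    then have "a \<in> {1..k}" using a f[OF i, of v] by auto
    moreover have "cell i a = V i" using a by (auto simp: cell_def)
    then have "\<xi> * w i \<le> real (card (cell i a))" using \<xi> w_pos[OF i] by (simp add: w_def)
    ultimately have "a \<in> supp i" by (simp add: supp_def)
    then have "R i = {}" using a by (auto simp: R_def)
    then show ?thesis using \<xi> m by simp
  next
    case False
    have "R i = (\<Union>a\<in>{1..k} - supp i. cell i a)" using f[OF i] by (auto simp: R_def cell_def)
    then have "card (R i) \<le> (\<Sum>a\<in>{1..k} - supp i. card (cell i a))" by (simp add: card_UN_le)
    then have "real (card (R i)) \<le> (\<Sum>a\<in>{1..k} - supp i. real (card (cell i a)))"
      unfolding of_nat_sum[symmetric] by (simp only: of_nat_le_iff)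
    also have "\<dots> \<le> (\<Sum>a\<in>{1..k} - supp i. \<xi> * (L * m))"
    proof (rule sum_mono)
      fix a assume "a \<in> {1..k} - supp i"
      then have "real (card (cell i a)) \<le> \<xi> * w i" by (auto simp: supp_def)
      also have "\<dots> \<le> \<xi> * (L * m)" using False \<xi> by (intro mult_left_mono) auto
      finally show "real (card (cell i a)) \<le> \<xi> * (L * m)" .
    qed
    also have "\<dots> \<le> (\<Sum>a\<in>{1..k}. \<xi> * (L * m))" using \<xi> m by (intro sum_mono2) auto
    finally show ?thesis by (simp add: mult.assoc)
  qed
  define XY where "XY = (\<Union>i\<in>B. Y i)"
  define XR where "XR = (\<Union>i\<in>B. R i)"
  have finXY: "finite XY" "finite XR" using finB finV by (auto simp: XY_def XR_def Y_def R_def)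
  have cXY: "real (card XY) \<le> \<zeta> * m"
  proof -
    have "real (card XY) \<le> real (\<Sum>i\<in>B. card (Y i))"
      unfolding XY_def of_nat_le_iff using finB by (rule card_UN_le)
    then have "real (card XY) * (\<epsilon> * m) \<le> (\<Sum>i\<in>B. real (card (Y i))) * (\<epsilon> * m)"
      using \<epsilon> m by (intro mult_right_mono) auto
    also have "\<dots> = (\<Sum>i\<in>B. real (card (Y i)) * (\<epsilon> * m))" by (rule sum_distrib_right)
    also have "\<dots> \<le> (\<Sum>i\<in>B. real (card B) * (\<omega> * m\<^sup>2))" by (intro sum_mono Y)
    also have "\<dots> = ((real (card B))\<^sup>2 * \<omega>) * m\<^sup>2" by (simp add: power2_eq_square)
    also have "\<dots> \<le> (\<zeta> * \<epsilon>) * m\<^sup>2" using \<epsilon> by (intro mult_right_mono) auto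
    also have "\<dots> = (\<zeta> * m) * (\<epsilon> * m)" by (simp add: power2_eq_square)
    finally show ?thesis using \<epsilon> m by (simp add: mult_le_cancel_right)
  qed
  have cXR: "real (card XR) \<le> real (card B) * (real k * \<xi> * L) * m"
  proof -
    have "real (card XR) \<le> real (\<Sum>i\<in>B. card (R i))"
      unfolding XR_def of_nat_le_iff using finB by (rule card_UN_le)
    also have "\<dots> \<le> (\<Sum>i\<in>B. real k * \<xi> * L * m)" unfolding of_nat_sum by (intro sum_mono R)
    also have "\<dots> = real (card B) * (real k * \<xi> * L) * m" by simp
    finally show ?thesis .
  qed
  show ?thesis
  proof (intro exI[of _ f] exI[of _ "XY \<union> XR"] exI[of _ supp] conjI ballI near)
    show "f v \<in> {1..k}" if "i \<in> B" "v \<in> V i" for i v using f that by blast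
    show "XY \<union> XR \<subseteq> (\<Union>i\<in>B. V i)" unfolding XY_def XR_def Y_def R_def by blast
    have "card (XY \<union> XR) \<le> card XY + card XR" by (rule card_Un_le)
    then show "real (card (XY \<union> XR)) \<le> (\<zeta> + real (card B) * (real k * \<xi> * L)) * m"
      using cXY cXR by (simp add: distrib_right)
  next
    fix i a assume ia: "i \<in> B" "a \<in> {1..k}"
    show "(\<exists>v\<in>V i - (XY \<union> XR). f v = a) \<longleftrightarrow> a \<in> supp i"
    proof
      assume "\<exists>v\<in>V i - (XY \<union> XR). f v = a"
      then show "a \<in> supp i" using ia by (auto simp: XR_def R_def)
    next
      assume a: "a \<in> supp i"
      \<comment> \<open>A supported cell has at least \<open>\<xi> * c\<close> vertices, more than
        all of \<open>XY\<close>, and contains no vertex of a rare colour.\<close>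
      have "\<not> cell i a \<subseteq> XY"
      proof
        assume "cell i a \<subseteq> XY"
        then have "real (card (cell i a)) \<le> real (card XY)" using finXY by (simp add: card_mono)
        moreover have "\<xi> * c \<le> \<xi> * w i" using wc[OF ia(1)] \<xi> by (intro mult_left_mono) auto
        ultimately show False using a cXY \<zeta> by (auto simp: supp_def)
      qed
      then obtain v where v: "v \<in> V i" "f v = a" "v \<notin> XY" by (auto simp: cell_def)
      have "v \<notin> R j" if "j \<in> B" for j
      proof (cases "j = i")
        case False
        then have "V j \<inter> V i = {}" using disj ia that unfolding disjoint_family_on_def by simp
        then show ?thesis using v by (auto simp: R_def)
      qed (use v a in \<open>simp add: R_def\<close>)
      then have "v \<notin> XR" by (simp add: XR_def)
      then show "\<exists>v\<in>V i - (XY \<union> XR). f v = a" using v by blast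
    qed
  next
    fix i v assume "i \<in> B" "v \<in> V i - (XY \<union> XR)"
    then have "v \<notin> Y i" "v \<in> V i" by (auto simp: XY_def)
    then show "real (card {u \<in> (\<Union>j\<in>B - {i}. V j). \<not> (adj v u \<longleftrightarrow> f v \<noteq> f u)}) \<le> \<epsilon> * m"
      unfolding Y_def mis_def by simp
  qed
qed

end

subsection \<open>Choice of the constants\<close>

text \<open>Listed in the order of choice, each depending only on the earlier ones:
  \<open>\<phi>\<close> scales all trimming tolerances relative to \<open>m\<close>,
  \<open>L\<close> is the threshold for heavy classes, \<open>\<xi>\<close> for rare colours,
  \<open>\<zeta>\<close> bounds the vertices in many wrong pairs, \<open>\<omega>\<close> the wrong
  pairs between two classes, \<open>\<beta>\<close> the exceptional transversals,
  \<open>\<tau>\<close> the average excess and \<open>\<eta>\<close> the frequency of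
  cliques.\<close>

lemma ex_constants:
  fixes r k :: nat and \<epsilon> \<gamma> :: real
  assumes "1 \<le> k" "k \<le> r" "0 < \<epsilon>" "0 < \<gamma>"
  obtains \<phi> L \<xi> \<zeta> \<omega> \<beta> \<tau> \<eta> :: real where
    "0 < \<phi>" "8 * (real r + 2 * real k + 1) * \<phi> \<le> \<gamma>" "8 * (real r + 2 * real k + 1) * \<phi> \<le> \<epsilon>"
    "0 < L" "L * \<gamma> = 2 * (real r)\<^sup>2 + 2"
    "0 < \<xi>" "\<xi> * real k \<le> 1" "\<xi> \<le> 1" "real r * (real k * \<xi> * L) \<le> \<phi> / 16"
    "0 < \<zeta>" "\<zeta> \<le> \<phi> / 16" "\<zeta> < \<xi> * \<gamma>"
    "0 < \<omega>" "(real r)\<^sup>2 * \<omega> \<le> \<zeta> * \<epsilon>"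
    "0 < \<beta>" "\<beta> < \<xi> ^ r" "\<beta> * L\<^sup>2 \<le> \<omega>"
    "0 < \<tau>" "2 * \<tau> \<le> \<omega>" "2 ^ r * \<tau> \<le> \<beta> / 2 * (\<phi> / 8 * \<gamma>)"
    "0 < \<eta>" "\<eta> * (real r)\<^sup>2 \<le> \<tau> / 2" "2 ^ r * \<eta> \<le> \<beta> / 2"
proof -
  have r: "1 \<le> real r" "1 \<le> real k" using assms by auto
  define \<phi> where "\<phi> = min \<gamma> \<epsilon> / (8 * (real r + 2 * real k + 1))"
  have 1: "0 < \<phi>" "8 * (real r + 2 * real k + 1) * \<phi> \<le> \<gamma>" "8 * (real r + 2 * real k + 1) * \<phi> \<le> \<epsilon>"
    using assms r by (auto simp: \<phi>_def)
  define L where "L = (2 * (real r)\<^sup>2 + 2) / \<gamma>"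
  have 2: "0 < L" "L * \<gamma> = 2 * (real r)\<^sup>2 + 2"
    using assms by (auto simp: L_def intro!: divide_pos_pos add_nonneg_pos)
  define \<xi> where "\<xi> = min (1 / real k) (\<phi> / (16 * (real r * real k * L)))"
  have rkL: "0 < real r * real k * L" using r 2 by simp
  have 3: "0 < \<xi>" using r rkL 1 by (simp add: \<xi>_def)
  have 4: "\<xi> * real k \<le> 1"
  proof -
    have "\<xi> * real k \<le> 1 / real k * real k" using r by (intro mult_right_mono) (auto simp: \<xi>_def)
    then show ?thesis using r by simp
  qed
  have "\<xi> * 1 \<le> \<xi> * real k" using r 3 by (intro mult_left_mono) auto
  then have 5: "\<xi> \<le> 1" using 4 by linarith
  have 6: "real r * (real k * \<xi> * L) \<le> \<phi> / 16"
  proof -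
    have "real r * real k * L * \<xi> \<le> real r * real k * L * (\<phi> / (16 * (real r * real k * L)))"
      using rkL by (intro mult_left_mono) (auto simp: \<xi>_def)
    also have "\<dots> = \<phi> / 16"
    proof -
      have "x * (\<phi> / (16 * x)) = \<phi> / 16" if "0 < x" for x :: real using that by simp
      from this[OF rkL] show ?thesis .
    qed
    finally show ?thesis by (simp add: algebra_simps)
  qed
  define \<zeta> where "\<zeta> = min (\<phi> / 16) (\<xi> * \<gamma> / 2)"
  have 7: "0 < \<zeta>" "\<zeta> \<le> \<phi> / 16" using 1 3 assms by (auto simp: \<zeta>_def)
  have 8: "\<zeta> < \<xi> * \<gamma>"
  proof -
    have "\<zeta> \<le> \<xi> * \<gamma> / 2" by (simp add: \<zeta>_def)
    moreover have "0 < \<xi> * \<gamma>" using 3 assms by simp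
    ultimately show ?thesis by linarith
  qed
  define \<omega> where "\<omega> = \<zeta> * \<epsilon> / (real r)\<^sup>2"
  have 9: "0 < \<omega>" "(real r)\<^sup>2 * \<omega> \<le> \<zeta> * \<epsilon>" using r 7 assms by (auto simp: \<omega>_def)
  define \<beta> where "\<beta> = min (\<xi> ^ r / 2) (\<omega> / L\<^sup>2)"
  have 10: "0 < \<beta>" using 3 9 2 by (simp add: \<beta>_def)
  have 11: "\<beta> < \<xi> ^ r"
  proof -
    have "\<beta> \<le> \<xi> ^ r / 2" unfolding \<beta>_def by (rule min.cobounded1)
    moreover have "0 < \<xi> ^ r" using 3 by simp
    ultimately show ?thesis by linarith
  qed
  have 12: "\<beta> * L\<^sup>2 \<le> \<omega>"
  proof -
    have "\<beta> * L\<^sup>2 \<le> \<omega> / L\<^sup>2 * L\<^sup>2" by (intro mult_right_mono) (auto simp: \<beta>_def)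
    then show ?thesis using 2 by simp
  qed
  define \<tau> where "\<tau> = min (\<omega> / 2) (\<beta> / 2 * (\<phi> / 8 * \<gamma>) / 2 ^ r)"
  have 13: "0 < \<tau>" "2 * \<tau> \<le> \<omega>" using 9 10 1 assms by (auto simp: \<tau>_def)
  have 14: "2 ^ r * \<tau> \<le> \<beta> / 2 * (\<phi> / 8 * \<gamma>)"
  proof -
    have "2 ^ r * \<tau> \<le> 2 ^ r * (\<beta> / 2 * (\<phi> / 8 * \<gamma>) / 2 ^ r)" by (intro mult_left_mono) (auto simp: \<tau>_def)
    then show ?thesis by simp
  qed
  define \<eta> where "\<eta> = min (\<tau> / 2 / (real r)\<^sup>2) (\<beta> / 2 / 2 ^ r)"
  have 15: "0 < \<eta>" using 13 10 r by (simp add: \<eta>_def)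
  have 16: "\<eta> * (real r)\<^sup>2 \<le> \<tau> / 2"
  proof -
    have "\<eta> * (real r)\<^sup>2 \<le> \<tau> / 2 / (real r)\<^sup>2 * (real r)\<^sup>2" by (intro mult_right_mono) (auto simp: \<eta>_def)
    then show ?thesis using r by simp
  qed
  have 17: "2 ^ r * \<eta> \<le> \<beta> / 2"
  proof -
    have "2 ^ r * \<eta> \<le> 2 ^ r * (\<beta> / 2 / 2 ^ r)" by (intro mult_left_mono) (auto simp: \<eta>_def)
    then show ?thesis by simp
  qed
  show thesis by (rule that[OF 1 2 3 4 5 6 7 8 9 10 11 12 13 14 15 16 17])
qed

text \<open>The stability conditions in terms of supports after the deletion of \<open>X\<close>,
  with \<open>\<mu>\<close> the common size of the integral parts of partial classes. They are
  exact; \<open>rest_le\<close> is the fourth condition with every integral part replaced by its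
  lower bound \<open>\<mu>\<close>.\<close>

locale approx_stable =
  fixes B :: "nat set" and k :: nat and V :: "nat \<Rightarrow> 'a set" and f :: "'a \<Rightarrow> nat" and X :: "'a set"
    and supp :: "nat \<Rightarrow> nat set" and \<mu> :: nat
  assumes colour_range: "\<And>i v. i \<in> B \<Longrightarrow> v \<in> V i \<Longrightarrow> f v \<in> {1..k}"
    and X_subset: "X \<subseteq> (\<Union>i\<in>B. V i)"
    and supp_range: "\<And>i. i \<in> B \<Longrightarrow> supp i \<noteq> {} \<and> supp i \<subseteq> {1..k}"
    and cells: "\<And>i a. i \<in> B \<Longrightarrow> a \<in> {1..k} \<Longrightarrow> (\<exists>v\<in>V i - X. f v = a) \<longleftrightarrow> a \<in> supp i"
    and partial_unique: "\<And>i a j. i \<in> B \<Longrightarrow> a \<in> supp i \<Longrightarrow> supp i \<noteq> {a} \<Longrightarrow>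
      j \<in> B \<Longrightarrow> a \<in> supp j \<Longrightarrow> supp j \<noteq> {a} \<Longrightarrow> i = j"
    and level_le: "\<And>b. b \<in> {1..k} \<Longrightarrow> \<mu> \<le> (\<Sum>i | i \<in> B \<and> supp i = {b}. card (V i - X))"
    and partial_eq: "\<And>i a. i \<in> B \<Longrightarrow> a \<in> supp i \<Longrightarrow> supp i \<noteq> {a} \<Longrightarrow>
      (\<Sum>i | i \<in> B \<and> supp i = {a}. card (V i - X)) = \<mu>"
    and partial_le: "\<And>i a. i \<in> B \<Longrightarrow> a \<in> supp i \<Longrightarrow> supp i \<noteq> {a} \<Longrightarrow> card (V i - X) \<le> \<mu>"
    and rest_le: "\<And>i a. i \<in> B \<Longrightarrow> supp i = {a} \<Longrightarrow> (\<Sum>j\<in>B - {i}. card {v \<in> V j - X. f v = a}) \<le> \<mu>"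

text \<open>The stability result when no class is smaller than \<open>\<gamma> * m\<close>. Since
  \<open>\<delta>\<close> depends on \<open>\<gamma>\<close>, the light classes have to be split off
  before it is applied. The edge hypothesis is stated against every \<open>k\<close>-colouring of
  \<open>B\<close>, which avoids \<open>turan_f\<close> for the reduced family.\<close>

lemma dense_imp_approx_stable:
  fixes r k s :: nat and \<epsilon> \<gamma> :: real
  assumes k: "1 \<le> k" "k \<le> r" and \<epsilon>: "0 < \<epsilon>" and \<gamma>: "0 < \<gamma>"
  shows "\<exists>\<delta>>0. \<forall>B (V :: nat \<Rightarrow> 'a set) adj.
    transversals B V adj \<longrightarrow> card B \<le> r \<longrightarrow> {1..k} \<subseteq> B \<longrightarrow> (\<forall>i\<in>{1..k}. card (V k) \<le> card (V i)) \<longrightarrow>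
    (\<forall>i\<in>B - {1..k}. card (V i) \<le> card (V k)) \<longrightarrow> (\<forall>i\<in>B. \<gamma> * real (card (V k)) \<le> real (card (V i))) \<longrightarrow>
    1 / \<delta> \<le> real (card (V k)) \<longrightarrow> \<not> has_blow_up B V adj (Suc k) s \<longrightarrow>
    (\<forall>\<tau>. \<tau> \<in> B \<rightarrow> {1..k} \<longrightarrow>
       transversals.missing B V adj \<le> inside B (\<lambda>i. real (card (V i))) \<tau> + \<delta> * (real (card (V k)))\<^sup>2) \<longrightarrow>
    (\<exists>f X supp \<mu>. approx_stable B k V f X supp \<mu> \<and> real (card X) \<le> \<epsilon> * real (card (V k)) \<and>
       (\<forall>i\<in>B. \<forall>v\<in>V i - X. real (card {u \<in> (\<Union>j\<in>B - {i}. V j). \<not> (adj v u \<longleftrightarrow> f v \<noteq> f u)}) \<le> \<epsilon> * real (card (V k))) \<and>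
       (\<forall>b\<in>{1..k}. (1 - \<epsilon>) * real (card (V k)) < real (\<Sum>i | i \<in> B \<and> supp i = {b}. card (V i - X))))"
proof -
  obtain \<phi> L \<xi> \<zeta> \<omega> \<beta> \<tau> \<eta> :: real where
    \<phi>: "0 < \<phi>" "8 * (real r + 2 * real k + 1) * \<phi> \<le> \<gamma>" "8 * (real r + 2 * real k + 1) * \<phi> \<le> \<epsilon>"
    and L: "0 < L" "L * \<gamma> = 2 * (real r)\<^sup>2 + 2"
    and \<xi>: "0 < \<xi>" "\<xi> * real k \<le> 1" "\<xi> \<le> 1" "real r * (real k * \<xi> * L) \<le> \<phi> / 16"
    and \<zeta>: "0 < \<zeta>" "\<zeta> \<le> \<phi> / 16" "\<zeta> < \<xi> * \<gamma>"
    and \<omega>: "0 < \<omega>" "(real r)\<^sup>2 * \<omega> \<le> \<zeta> * \<epsilon>"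
    and \<beta>: "0 < \<beta>" "\<beta> < \<xi> ^ r" "\<beta> * L\<^sup>2 \<le> \<omega>"
    and \<tau>: "0 < \<tau>" "2 * \<tau> \<le> \<omega>" "2 ^ r * \<tau> \<le> \<beta> / 2 * (\<phi> / 8 * \<gamma>)"
    and \<eta>: "0 < \<eta>" "\<eta> * (real r)\<^sup>2 \<le> \<tau> / 2" "2 ^ r * \<eta> \<le> \<beta> / 2"
    by (rule ex_constants[OF k \<epsilon> \<gamma>])
  obtain N0 where N0: "\<And>B (V :: nat \<Rightarrow> 'a set) adj. transversals B V adj \<Longrightarrow> card B \<le> r \<Longrightarrow>
    \<forall>i\<in>B. N0 \<le> card (V i) \<Longrightarrow> \<not> has_blow_up B V adj (Suc k) s \<Longrightarrow>
    real (card (transversals.cliques B V adj (Suc k))) \<le> \<eta> * real (card (PiE B V))"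
    using few_cliques[OF \<eta>(1), where 'a = 'a and r = r and t = "Suc k" and s = s] by metis
  \<comment> \<open>From \<open>1 \<le> \<delta> * m\<close>, the first bound makes rounding to an
    integer negligible and the third makes every class as large as \<open>N0\<close>; the second
    keeps the excess within \<open>\<tau>\<close>.\<close>
  define \<delta> where "\<delta> = min (min (\<phi> / 2) (\<tau> / 2)) (\<gamma> / (real N0 + 1))"
  have \<delta>0: "0 < \<delta>" using \<phi>(1) \<tau>(1) \<gamma> by (simp add: \<delta>_def)
  have \<delta>: "0 < \<delta>" "\<delta> \<le> \<phi> / 2" "\<delta> \<le> \<tau> / 2"
  proof -
    show "0 < \<delta>" by (rule \<delta>0)
    show "\<delta> \<le> \<phi> / 2" unfolding \<delta>_def by (rule min.coboundedI1, rule min.cobounded1)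
    show "\<delta> \<le> \<tau> / 2" unfolding \<delta>_def by (rule min.coboundedI1, rule min.cobounded2)
  qed
  have \<delta>N: "\<delta> * (real N0 + 1) \<le> \<gamma>"
  proof -
    have "\<delta> * (real N0 + 1) \<le> \<gamma> / (real N0 + 1) * (real N0 + 1)" by (intro mult_right_mono) (auto simp: \<delta>_def)
    then show ?thesis by simp
  qed
  show ?thesis
  proof (intro exI[of _ \<delta>] conjI \<delta>(1) allI impI)
    fix B and V :: "nat \<Rightarrow> 'a set" and adj
    assume tr: "transversals B V adj" and Br: "card B \<le> r" and kB: "{1..k} \<subseteq> B"
      and Vk: "\<forall>i\<in>{1..k}. card (V k) \<le> card (V i)" and Vk': "\<forall>i\<in>B - {1..k}. card (V i) \<le> card (V k)"
      and V\<gamma>: "\<forall>i\<in>B. \<gamma> * real (card (V k)) \<le> real (card (V i))" and m\<delta>: "1 / \<delta> \<le> real (card (V k))"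
      and no: "\<not> has_blow_up B V adj (Suc k) s"
      and mi: "\<forall>\<tau>. \<tau> \<in> B \<rightarrow> {1..k} \<longrightarrow>
       transversals.missing B V adj \<le> inside B (\<lambda>i. real (card (V i))) \<tau> + \<delta> * (real (card (V k)))\<^sup>2"
    interpret transversals B V adj by (rule tr)
    have w: "w = (\<lambda>i. real (card (V i)))" by (auto simp: w_def)
    define m where "m = real (card (V k))"
    have m1: "1 \<le> \<delta> * m" using m\<delta> \<delta> by (simp add: m_def pos_divide_le_eq mult.commute)
    have m: "0 < m" using m1 \<delta>(1) by (smt (verit) mult_nonneg_nonpos)
    \<comment> \<open>Extensional colourings, so that the minimum is over a finite set.\<close>
    define g where "g = Min (inside B w ` (B \<rightarrow>\<^sub>E {1..k}))"
    have finP: "finite (B \<rightarrow>\<^sub>E {1..k})" using finB by (intro finite_PiE) auto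
    have g_le: "g \<le> inside B w \<sigma>" if "\<sigma> \<in> B \<rightarrow> {1..k}" for \<sigma>
    proof -
      have "inside B w \<sigma> = inside B w (restrict \<sigma> B)" by (intro inside_cong_kernel) auto
      moreover have "restrict \<sigma> B \<in> B \<rightarrow>\<^sub>E {1..k}" using that by auto
      ultimately show ?thesis unfolding g_def using finP by (simp add: Min_le)
    qed
    have "B \<rightarrow>\<^sub>E {1..k} \<noteq> {}" using k by (auto simp: PiE_eq_empty_iff)
    then have "g \<in> inside B w ` (B \<rightarrow>\<^sub>E {1..k})" unfolding g_def using finP by (intro Min_in) auto
    then obtain \<sigma>0 where \<sigma>0: "\<sigma>0 \<in> B \<rightarrow>\<^sub>E {1..k}" "g = inside B w \<sigma>0" by auto
    have miss: "missing \<le> g + \<delta> * m\<^sup>2" using mi \<sigma>0 by (auto simp: w m_def PiE_def)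
    have g0: "0 \<le> g" unfolding \<sigma>0(2) inside_def by (intro sum_nonneg) (auto simp: w)
    define U where "U = (real r)\<^sup>2 * m\<^sup>2"
    have gU: "g \<le> U"
    proof -
      \<comment> \<open>The first \<open>k - 1\<close> classes, possibly huge, stay alone; only
        classes of size at most \<open>m\<close> are merged. Hence the optimum is of order
        \<open>m^2\<close>.\<close>
      have "g \<le> inside B w (\<lambda>i. if i \<in> {1..k} then i else k)" using k by (intro g_le) auto
      also have "\<dots> \<le> (\<Sum>i\<in>B. \<Sum>j\<in>B. m * m)"
        unfolding inside_def
      proof (intro sum_mono)
        fix i j assume ij: "i \<in> B" "j \<in> B"
        have light: "0 \<le> w i \<and> w i \<le> m" if "i \<in> B" "i = k \<or> i \<notin> {1..k}" for i
          using Vk' that by (auto simp: w m_def)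
        let ?h = "\<lambda>i. if i \<in> {1..k} then i else k"
        show "of_bool (i \<noteq> j \<and> ?h i = ?h j) * (w i * w j) \<le> m * m"
        proof (cases "i \<noteq> j \<and> ?h i = ?h j")
          case True
          then have "i = k \<or> i \<notin> {1..k}" "j = k \<or> j \<notin> {1..k}" by (auto split: if_splits)
          then have "w i * w j \<le> m * m" using light ij m by (intro mult_mono) auto
          moreover have "of_bool P = (1::real)" if P for P using that by simp
          from this[OF True] have "of_bool (i \<noteq> j \<and> ?h i = ?h j) = (1::real)" .
          ultimately show ?thesis by (simp only: mult_1_left)
        next
          case False
          then show ?thesis using m by (simp only: of_bool_def if_False) simp
        qed
      qed
      also have "\<dots> = (real (card B))\<^sup>2 * m\<^sup>2" by (simp add: power2_eq_square)
      also have "\<dots> \<le> U" unfolding U_def using Br by (intro mult_right_mono power_mono) auto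
      finally show ?thesis .
    qed
    define c where "c = \<gamma> * m"
    define \<Lambda> where "\<Lambda> = \<phi> / 8 * m"
    have rk8: "8 * \<phi> \<le> 8 * (real r + 2 * real k + 1) * \<phi>" using \<phi>(1) by (intro mult_right_mono) auto
    have c0: "0 < c" using \<gamma> m by (simp add: c_def)
    have \<Lambda>0: "0 < \<Lambda>" using \<phi> m by (simp add: \<Lambda>_def)
    have \<Lambda>c: "2 * \<Lambda> < c"
    proof -
      have "2 * (\<phi> / 8) < \<gamma>" using \<phi> rk8 by linarith
      then have "2 * (\<phi> / 8) * m < \<gamma> * m" using m by (intro mult_strict_right_mono)
      then show ?thesis by (simp add: \<Lambda>_def c_def)
    qed
    interpret dense_transversals B V adj k c \<Lambda> g U
      by unfold_locales (use kB V\<gamma> c0 \<Lambda>0 \<Lambda>c g_le g0 gU in \<open>auto simp: w c_def m_def\<close>)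
    have "N0 \<le> card (V i)" if "i \<in> B" for i
    proof -
      have "real N0 * 1 \<le> real N0 * (\<delta> * m)" using m1 by (intro mult_left_mono) auto
      also have "\<dots> \<le> (\<delta> * (real N0 + 1)) * m" using \<delta> m by (simp add: algebra_simps)
      also have "\<dots> \<le> \<gamma> * m" using \<delta>N m by (intro mult_right_mono) auto
      also have "\<dots> \<le> real (card (V i))" using V\<gamma> that by (simp add: m_def)
      finally show ?thesis by simp
    qed
    then have cl: "real (card (cliques (Suc k))) \<le> \<eta> * real (card \<Omega>)" using N0[OF tr Br _ no] by blast
    have tot: "\<delta> * m\<^sup>2 + \<eta> * U \<le> \<tau> * m\<^sup>2"
    proof -
      have "(\<delta> + \<eta> * (real r)\<^sup>2) * m\<^sup>2 \<le> \<tau> * m\<^sup>2" using \<delta> \<eta> by (intro mult_right_mono) auto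
      then show ?thesis by (simp add: U_def algebra_simps)
    qed
    \<comment> \<open>\<open>\<Lambda> * c\<close> and the excess are both proportional to
      \<open>m^2\<close>, which cancels. The factor \<open>2 ^ card B\<close> pays for all mixtures
      with the reference transversal.\<close>
    have few: "2 ^ card B * real (card bad) \<le> \<beta> * real (card \<Omega>)"
    proof -
      define C where "C = \<phi> / 8 * \<gamma>"
      have C0: "0 < C" using \<phi> \<gamma> by (simp add: C_def)
      have Cm: "\<Lambda> * c = C * m\<^sup>2" by (simp add: C_def \<Lambda>_def c_def power2_eq_square)
      have "C * m\<^sup>2 * real (card bad) \<le> real (card \<Omega>) * (C * m\<^sup>2 * \<eta> + \<delta> * m\<^sup>2 + \<eta> * U)"
        using card_bad[OF miss less_imp_le[OF \<eta>(1)] cl] unfolding Cm .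
      also have "\<dots> \<le> real (card \<Omega>) * (C * m\<^sup>2 * \<eta> + \<tau> * m\<^sup>2)"
        using tot by (intro mult_left_mono) auto
      also have "\<dots> = (real (card \<Omega>) * (C * \<eta> + \<tau>)) * m\<^sup>2" by (simp add: algebra_simps)
      finally have "(C * real (card bad)) * m\<^sup>2 \<le> (real (card \<Omega>) * (C * \<eta> + \<tau>)) * m\<^sup>2" by (simp add: algebra_simps)
      then have 1: "C * real (card bad) \<le> real (card \<Omega>) * (C * \<eta> + \<tau>)" using m by (simp add: mult_le_cancel_right)
      have "2 ^ r * (C * real (card bad)) \<le> 2 ^ r * (real (card \<Omega>) * (C * \<eta> + \<tau>))"
        using 1 by (intro mult_left_mono) auto
      also have "\<dots> = real (card \<Omega>) * (C * (2 ^ r * \<eta>) + 2 ^ r * \<tau>)" by (simp add: algebra_simps)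
      also have "\<dots> \<le> real (card \<Omega>) * (C * (\<beta> / 2) + \<beta> / 2 * C)"
        using \<eta> \<tau> C0 by (intro mult_left_mono add_mono) (auto simp: C_def)
      also have "\<dots> = C * (\<beta> * real (card \<Omega>))" by (simp add: algebra_simps)
      finally have "C * (2 ^ r * real (card bad)) \<le> C * (\<beta> * real (card \<Omega>))" by (simp add: algebra_simps)
      then have "2 ^ r * real (card bad) \<le> \<beta> * real (card \<Omega>)" using C0 by (rule mult_left_le_imp_le)
      moreover have "2 ^ card B * real (card bad) \<le> 2 ^ r * real (card bad)"
        using Br by (intro mult_right_mono power_increasing) auto
      ultimately show ?thesis by linarith
    qed
    have \<beta>': "\<beta> < \<xi> ^ card B" using \<beta>(2) power_decreasing[OF Br, of \<xi>] \<xi> by linarith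
    have heavy: "2 * U \<le> w i * w j \<and> g + \<Lambda> * c < w i * w j" if "i \<in> B" "j \<in> B" "L * m < w i" for i j
    proof -
      \<comment> \<open>The value of \<open>L\<close> is made for this: a heavy class times any
        class gives \<open>2 * U + 2 * m^2\<close>, which also exceeds
        \<open>g + \<Lambda> * c\<close>.\<close>
      have "(2 * (real r)\<^sup>2 + 2) * m\<^sup>2 = (L * \<gamma>) * m\<^sup>2" unfolding L(2) ..
      also have "\<dots> = (L * m) * (\<gamma> * m)" by (simp add: power2_eq_square)
      also have "\<dots> \<le> w i * w j" using that V\<gamma> m \<gamma> L by (intro mult_mono) (auto simp: w m_def)
      finally have 1: "2 * U + 2 * m\<^sup>2 \<le> w i * w j" by (simp add: U_def algebra_simps)
      have "\<gamma> * m \<le> 1 * m" using V\<gamma> kB k by (auto simp: m_def)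
      then have "\<gamma> \<le> 1" using m by (rule mult_right_le_imp_le)
      then have "\<phi> / 8 \<le> 1" using rk8 \<phi>(1,2) by linarith
      then have "\<phi> / 8 * \<gamma> \<le> 1 * 1" using \<open>\<gamma> \<le> 1\<close> \<gamma> by (intro mult_mono) auto
      then have "(\<phi> / 8 * \<gamma>) * m\<^sup>2 \<le> 1 * m\<^sup>2" by (intro mult_right_mono) auto
      moreover have "\<Lambda> * c = (\<phi> / 8 * \<gamma>) * m\<^sup>2" by (simp add: \<Lambda>_def c_def power2_eq_square)
      moreover have "0 < m\<^sup>2" using m by simp
      ultimately show ?thesis using 1 gU g0 by linarith
    qed
    obtain f X1 supp where near: "near_optimal_supports B k w supp \<Lambda> c" and f: "\<forall>i\<in>B. \<forall>v\<in>V i. f v \<in> {1..k}"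
      and X1: "X1 \<subseteq> (\<Union>i\<in>B. V i)" "real (card X1) \<le> (\<zeta> + real (card B) * (real k * \<xi> * L)) * m"
      and cells: "\<forall>i\<in>B. \<forall>a\<in>{1..k}. (\<exists>v\<in>V i - X1. f v = a) \<longleftrightarrow> a \<in> supp i"
      and close: "\<forall>i\<in>B. \<forall>v\<in>V i - X1. real (card {u \<in> (\<Union>j\<in>B - {i}. V j). \<not> (adj v u \<longleftrightarrow> f v \<noteq> f u)}) \<le> \<epsilon> * m"
    proof -
      have "2 * (\<delta> * m\<^sup>2 + \<eta> * U) \<le> \<omega> * m\<^sup>2"
        using tot mult_right_mono[OF \<tau>(2), of "m\<^sup>2"] by (simp add: algebra_simps)
      moreover have "(real (card B))\<^sup>2 * \<omega> \<le> \<zeta> * \<epsilon>"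
      proof -
        have "(real (card B))\<^sup>2 * \<omega> \<le> (real r)\<^sup>2 * \<omega>" using Br \<omega>(1) by (intro mult_right_mono power_mono) auto
        then show ?thesis using \<omega>(2) by linarith
      qed
      moreover have "\<zeta> * m < \<xi> * c" using mult_strict_right_mono[OF \<zeta>(3) m] by (simp add: c_def algebra_simps)
      ultimately show thesis
        using ex_exceptional_set[OF miss less_imp_le[OF \<eta>(1)] cl few \<beta>' \<xi>(1-3) m L(1) heavy _ \<beta>(3) \<epsilon>] that
        by blast
    qed
    define \<theta> where "\<theta> = \<phi> / 8 * m"
    have \<theta>: "real (card X1) \<le> \<theta>"
    proof -
      have "real (card B) * (real k * \<xi> * L) \<le> real r * (real k * \<xi> * L)"
        using Br \<xi> L by (intro mult_right_mono) auto
      then have "\<zeta> + real (card B) * (real k * \<xi> * L) \<le> \<phi> / 8" using \<xi>(4) \<zeta>(2) by linarith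
      then have "(\<zeta> + real (card B) * (real k * \<xi> * L)) * m \<le> \<theta>"
        unfolding \<theta>_def using m by (intro mult_right_mono) auto
      then show ?thesis using X1(2) by linarith
    qed
    \<comment> \<open>Trimming removes whole vertices; rounding up adds at most 1, which is at most
      \<open>\<delta> * m\<close>.\<close>
    define \<Delta> where "\<Delta> = nat \<lceil>2 * \<Lambda> + 2 * \<theta>\<rceil>"
    have \<theta>0: "0 \<le> \<theta>" using \<phi> m by (simp add: \<theta>_def)
    have \<Delta>1: "2 * \<Lambda> + 2 * \<theta> \<le> real \<Delta>" unfolding \<Delta>_def by linarith
    have \<Delta>2: "real \<Delta> \<le> \<phi> * m"
    proof -
      have "real \<Delta> \<le> 2 * \<Lambda> + 2 * \<theta> + 1" using \<Lambda>0 \<theta>0 unfolding \<Delta>_def by linarith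
      also have "\<dots> \<le> \<phi> / 2 * m + \<delta> * m" using m1 by (simp add: \<Lambda>_def \<theta>_def)
      also have "\<dots> \<le> \<phi> / 2 * m + \<phi> / 2 * m" using \<delta>(2) m by (intro add_left_mono mult_right_mono) auto
      finally show ?thesis by simp
    qed
    have card\<Delta>: "real (card B * \<Delta>) \<le> real r * (\<phi> * m)"
      unfolding of_nat_mult using Br \<Delta>2 by (intro mult_mono) auto
    have big: "real ((card B + 2 * k) * \<Delta>) + \<theta> < c"
    proof -
      have "real ((card B + 2 * k) * \<Delta>) \<le> (real r + 2 * real k) * (\<phi> * m)"
        unfolding of_nat_mult of_nat_add using Br \<Delta>2 by (intro mult_mono) auto
      then have "real ((card B + 2 * k) * \<Delta>) + \<theta> \<le> ((real r + 2 * real k + 1) * \<phi>) * m"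
      proof -
        have "\<theta> \<le> \<phi> * m" using \<phi>(1) m unfolding \<theta>_def by (intro mult_right_mono) auto
        moreover have "((real r + 2 * real k + 1) * \<phi>) * m = (real r + 2 * real k) * (\<phi> * m) + \<phi> * m"
          by (simp add: algebra_simps)
        ultimately show ?thesis using \<open>real ((card B + 2 * k) * \<Delta>) \<le> _\<close> by linarith
      qed
      also have "\<dots> < \<gamma> * m"
      proof (rule mult_strict_right_mono[OF _ m])
        have "0 < (real r + 2 * real k + 1) * \<phi>" using \<phi>(1) by (intro mult_pos_pos) auto
        then show "(real r + 2 * real k + 1) * \<phi> < \<gamma>" using \<phi>(2) by linarith
      qed
      finally show ?thesis by (simp add: c_def)
    qed
    have err: "4 * \<Lambda> + \<theta> + 2 * real (card B * \<Delta>) < \<epsilon> * m"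
    proof -
      have "4 * \<Lambda> + \<theta> + 2 * real (card B * \<Delta>) \<le> (5 / 8 + 2 * real r) * \<phi> * m"
        using card\<Delta> by (simp add: \<Lambda>_def \<theta>_def algebra_simps)
      also have "\<dots> < (8 * (real r + 2 * real k + 1) * \<phi>) * m"
        using \<phi>(1) m by (intro mult_strict_right_mono) auto
      also have "\<dots> \<le> \<epsilon> * m" using \<phi>(3) m by (intro mult_right_mono) auto
      finally show ?thesis .
    qed
    interpret near: near_optimal_supports B k w supp \<Lambda> c by (rule near)
    obtain X \<mu> where X: "X1 \<subseteq> X" "X \<subseteq> (\<Union>i\<in>B. V i)" "real (card X) \<le> \<theta> + 2 * real (card B * \<Delta>)"
      and cells': "\<forall>i\<in>B. \<forall>a\<in>{1..k}. (\<exists>v\<in>V i - X. f v = a) \<longleftrightarrow> a \<in> supp i"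
      and \<mu>: "\<forall>b\<in>{1..k}. \<mu> \<le> (\<Sum>i | i \<in> B \<and> supp i = {b}. card (V i - X))"
      and low: "\<forall>b\<in>{1..k}. m - 3 * \<Lambda> - \<theta> - 2 * real (card B * \<Delta>) \<le> real (\<Sum>i | i \<in> B \<and> supp i = {b}. card (V i - X))"
      and part: "\<forall>i\<in>B. \<forall>a\<in>supp i. supp i \<noteq> {a} \<longrightarrow>
         (\<Sum>i | i \<in> B \<and> supp i = {a}. card (V i - X)) = \<mu> \<and> card (V i - X) \<le> \<mu>"
      and int: "\<forall>i\<in>B. \<forall>a. supp i = {a} \<longrightarrow> (\<Sum>j\<in>B - {i}. card {v \<in> V j - X. f v = a}) \<le> \<mu>"
    proof -
      have "m \<le> real (card (V i))" if "i \<in> {1..k}" for i using Vk that by (simp add: m_def)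
      note m_le = this
      show thesis
      proof (rule stable_deletion[where f = f and m = m, OF near[unfolded w] k(1) finV disj _ X1(1) \<theta> _ \<Delta>1 big])
        show "f v \<in> {1..k}" if "i \<in> B" "v \<in> V i" for i v using f that by blast
        show "(\<exists>v\<in>V i - X1. f v = a) \<longleftrightarrow> a \<in> supp i" if "i \<in> B" "a \<in> {1..k}" for i a using cells that by blast
      qed (assumption | rule m_le | rule that)+
    qed
    show "\<exists>f X supp \<mu>. approx_stable B k V f X supp \<mu> \<and> real (card X) \<le> \<epsilon> * real (card (V k)) \<and>
       (\<forall>i\<in>B. \<forall>v\<in>V i - X. real (card {u \<in> (\<Union>j\<in>B - {i}. V j). \<not> (adj v u \<longleftrightarrow> f v \<noteq> f u)}) \<le> \<epsilon> * real (card (V k))) \<and>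
       (\<forall>b\<in>{1..k}. (1 - \<epsilon>) * real (card (V k)) < real (\<Sum>i | i \<in> B \<and> supp i = {b}. card (V i - X)))"
    proof (intro exI[of _ f] exI[of _ X] exI[of _ supp] exI[of _ \<mu>] conjI ballI)
      show "approx_stable B k V f X supp \<mu>"
      proof
        show "f v \<in> {1..k}" if "i \<in> B" "v \<in> V i" for i v using f that by blast
        show "(\<exists>v\<in>V i - X. f v = a) \<longleftrightarrow> a \<in> supp i" if "i \<in> B" "a \<in> {1..k}" for i a using cells' that by blast
        show "\<mu> \<le> (\<Sum>i | i \<in> B \<and> supp i = {b}. card (V i - X))" if "b \<in> {1..k}" for b using \<mu> that by blast
        show "(\<Sum>i | i \<in> B \<and> supp i = {a}. card (V i - X)) = \<mu>" "card (V i - X) \<le> \<mu>"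
          if "i \<in> B" "a \<in> supp i" "supp i \<noteq> {a}" for i a using part that by blast+
        show "(\<Sum>j\<in>B - {i}. card {v \<in> V j - X. f v = a}) \<le> \<mu>" if "i \<in> B" "supp i = {a}" for i a
          using int that by blast
      qed (fact X(2) near.supp near.partial_unique)+
      show "real (card X) \<le> \<epsilon> * real (card (V k))" using X(3) err \<Lambda>0 by (simp add: m_def)
      show "real (card {u \<in> (\<Union>j\<in>B - {i}. V j). \<not> (adj v u \<longleftrightarrow> f v \<noteq> f u)}) \<le> \<epsilon> * real (card (V k))"
        if "i \<in> B" "v \<in> V i - X" for i v
        using close that X(1) by (auto simp: m_def)
      show "(1 - \<epsilon>) * real (card (V k)) < real (\<Sum>i | i \<in> B \<and> supp i = {b}. card (V i - X))" if "b \<in> {1..k}" for b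
      proof -
        have "(1 - \<epsilon>) * m < m - 3 * \<Lambda> - \<theta> - 2 * real (card B * \<Delta>)" using err \<Lambda>0 by (simp add: algebra_simps)
        then show ?thesis using low that unfolding m_def by fastforce
      qed
    qed
  qed
qed

subsection \<open>Edges and the extremal function\<close>

lemma sum_ordered_pairs:
  fixes h :: "'a set \<Rightarrow> real"
  assumes "finite E" "\<And>e. e \<in> E \<Longrightarrow> card e = 2"
  shows "(\<Sum>p\<in>{p. {fst p, snd p} \<in> E}. h {fst p, snd p}) = 2 * (\<Sum>e\<in>E. h e)"
proof -
  have fib: "\<exists>a b. e = {a, b} \<and> a \<noteq> b \<and> {p. {fst p, snd p} = e} = {(a, b), (b, a)}" if "e \<in> E" for e
  proof -
    obtain a b where "e = {a, b}" "a \<noteq> b" using assms(2)[OF \<open>e \<in> E\<close>] by (meson card_2_iff)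
    then show ?thesis by (intro exI[of _ a] exI[of _ b]) (auto simp: doubleton_eq_iff)
  qed
  have "{p. {fst p, snd p} \<in> E} = (\<Union>e\<in>E. {p. {fst p, snd p} = e})" by auto
  then have "(\<Sum>p\<in>{p. {fst p, snd p} \<in> E}. h {fst p, snd p}) =
      (\<Sum>e\<in>E. \<Sum>p\<in>{p. {fst p, snd p} = e}. h {fst p, snd p})"
  proof (simp only:, intro sum.UNION_disjoint ballI impI)
    show "finite {p. {fst p, snd p} = e}" if "e \<in> E" for e using fib[OF that] by auto
  qed (use assms in auto)
  also have "\<dots> = (\<Sum>e\<in>E. 2 * h e)"
  proof (intro sum.cong refl)
    fix e assume "e \<in> E"
    then obtain a b where ab: "e = {a, b}" "a \<noteq> b" "{p. {fst p, snd p} = e} = {(a, b), (b, a)}"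
      using fib[OF \<open>e \<in> E\<close>] by blast
    have "{b, a} = {a, b}" by auto
    then show "(\<Sum>p\<in>{p. {fst p, snd p} = e}. h {fst p, snd p}) = 2 * h e"
      unfolding ab(3) using ab(1,2) by simp
  qed
  finally show ?thesis by (simp add: sum_distrib_left)
qed

lemma finite_2_subsets: "finite A \<Longrightarrow> finite {p. p \<subseteq> A \<and> card p = 2}"
  by (rule finite_subset[of _ "Pow A"]) auto

text \<open>The fibres of \<open>\<sigma>\<close> are an admissible partition. Surjectivity is
  essential, as \<open>turan_f\<close> only admits partitions into exactly \<open>k\<close> nonempty
  parts.\<close>

lemma turan_f_ge:
  assumes \<sigma>: "\<sigma> ` {1..r} = {1..k}"
  shows "(\<Sum>i\<in>{1..r}. \<Sum>j\<in>{1..r}. of_bool (\<sigma> i \<noteq> \<sigma> j) * (real (n i) * real (n j))) \<le> 2 * real (turan_f n r (Suc k))"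
proof -
  define fib where "fib a = {i \<in> {1..r}. \<sigma> i = a}" for a
  define Q where "Q = fib ` {1..k}"
  have fib_ne: "fib a \<noteq> {}" if "a \<in> {1..k}" for a
  proof -
    have "a \<in> \<sigma> ` {1..r}" using that \<sigma> by simp
    then obtain i where "a = \<sigma> i" "i \<in> {1..r}" by (rule imageE) blast
    then have "i \<in> fib a" by (simp add: fib_def)
    then show ?thesis by blast
  qed
  have inj: "inj_on fib {1..k}"
  proof (rule inj_onI)
    fix a b assume ab: "a \<in> {1..k}" "b \<in> {1..k}" "fib a = fib b"
    then obtain i where i: "i \<in> fib a" using fib_ne by blast
    then have "i \<in> fib b" using ab by simp
    with i show "a = b" by (simp add: fib_def)
  qed
  have cQ: "card Q = k" unfolding Q_def using inj by (simp add: card_image)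
  have part: "partition_on {1..r} Q"
  proof (rule partition_onI)
    show "\<Union> Q = {1..r}" using \<sigma> unfolding Q_def fib_def by auto
    show "disjnt p q" if "p \<in> Q" "q \<in> Q" "p \<noteq> q" for p q
      using that unfolding Q_def fib_def disjnt_def by auto
    show "{} \<notin> Q"
    proof
      assume "{} \<in> Q"
      then obtain a where "{} = fib a" "a \<in> {1..k}" unfolding Q_def by (rule imageE) blast
      then show False using fib_ne by blast
    qed
  qed
  define W where "W I = (\<Sum>i\<in>I. n i)" for I
  define val where "val Q = (\<Sum>p | p \<subseteq> Q \<and> card p = 2. \<Prod>I\<in>p. W I)" for Q
  have tf: "turan_f n r (Suc k) = Max {val Q | Q. partition_on {1..r} Q \<and> card Q = k}"
    unfolding turan_f_def val_def W_def by simp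
  have "{val Q | Q. partition_on {1..r} Q \<and> card Q = k} \<subseteq> val ` {Q. partition_on {1..r} Q}" by blast
  then have "finite {val Q | Q. partition_on {1..r} Q \<and> card Q = k}"
    by (rule finite_subset) (intro finite_imageI finitely_many_partition_on, simp)
  then have "val Q \<le> turan_f n r (Suc k)" unfolding tf using part cQ by (intro Max_ge) auto
  then have 1: "real (val Q) \<le> real (turan_f n r (Suc k))" by simp
  have finQ: "finite Q" by (simp add: Q_def)
  have pr: "{p. {fst p, snd p} \<subseteq> Q \<and> card {fst p, snd p} = 2} = {p \<in> Q \<times> Q. fst p \<noteq> snd p}"
    by (auto simp: card_2_iff doubleton_eq_iff card_insert_if split: if_splits)
  have "2 * real (val Q) = 2 * (\<Sum>p | p \<subseteq> Q \<and> card p = 2. real (\<Prod>I\<in>p. W I))" by (simp add: val_def)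
  also have "\<dots> = (\<Sum>p\<in>{p. {fst p, snd p} \<in> {p. p \<subseteq> Q \<and> card p = 2}}. real (\<Prod>I\<in>{fst p, snd p}. W I))"
    by (rule sum_ordered_pairs[symmetric]) (use finQ in \<open>auto intro: finite_2_subsets\<close>)
  also have "\<dots> = (\<Sum>p\<in>{p \<in> Q \<times> Q. fst p \<noteq> snd p}. real (W (fst p)) * real (W (snd p)))"
    using pr by (intro sum.cong) auto
  also have "\<dots> = (\<Sum>p\<in>Q \<times> Q. of_bool (fst p \<noteq> snd p) * (real (W (fst p)) * real (W (snd p))))"
    using finQ by (intro sum.mono_neutral_cong_left) auto
  also have "\<dots> = (\<Sum>I\<in>Q. \<Sum>J\<in>Q. of_bool (I \<noteq> J) * (real (W I) * real (W J)))"
    unfolding sum.cartesian_product by (intro sum.cong refl) auto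
  also have "\<dots> = (\<Sum>a\<in>{1..k}. \<Sum>b\<in>{1..k}. of_bool (fib a \<noteq> fib b) * (real (W (fib a)) * real (W (fib b))))"
    unfolding Q_def by (simp only: sum.reindex[OF inj] comp_def)
  also have "\<dots> = (\<Sum>a\<in>{1..k}. \<Sum>b\<in>{1..k}. \<Sum>i\<in>fib a. \<Sum>j\<in>fib b. of_bool (\<sigma> i \<noteq> \<sigma> j) * (real (n i) * real (n j)))"
  proof (intro sum.cong refl)
    fix a b assume ab: "a \<in> {1..k}" "b \<in> {1..k}"
    have "fib a \<noteq> fib b \<longleftrightarrow> a \<noteq> b" using inj_on_eq_iff[OF inj ab] by simp
    then have "of_bool (fib a \<noteq> fib b) * (real (W (fib a)) * real (W (fib b))) =
       of_bool (a \<noteq> b) * ((\<Sum>i\<in>fib a. real (n i)) * (\<Sum>j\<in>fib b. real (n j)))"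
      by (simp only: W_def of_nat_sum)
    also have "\<dots> = (\<Sum>i\<in>fib a. \<Sum>j\<in>fib b. of_bool (a \<noteq> b) * (real (n i) * real (n j)))"
      by (subst sum_product) (simp only: sum_distrib_left)
    also have "\<dots> = (\<Sum>i\<in>fib a. \<Sum>j\<in>fib b. of_bool (\<sigma> i \<noteq> \<sigma> j) * (real (n i) * real (n j)))"
      by (intro sum.cong refl) (auto simp: fib_def)
    finally show "of_bool (fib a \<noteq> fib b) * (real (W (fib a)) * real (W (fib b))) =
       (\<Sum>i\<in>fib a. \<Sum>j\<in>fib b. of_bool (\<sigma> i \<noteq> \<sigma> j) * (real (n i) * real (n j)))" .
  qed
  also have "\<dots> = (\<Sum>a\<in>{1..k}. \<Sum>i\<in>fib a. \<Sum>j\<in>{1..r}. of_bool (\<sigma> i \<noteq> \<sigma> j) * (real (n i) * real (n j)))"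
  proof (rule sum.cong[OF refl])
    fix a
    have "(\<Sum>b\<in>{1..k}. \<Sum>j\<in>fib b. h j) = (\<Sum>j\<in>{1..r}. h j)" for h :: "nat \<Rightarrow> real"
      unfolding fib_def using \<sigma> by (intro sum.group) auto
    then show "(\<Sum>b\<in>{1..k}. \<Sum>i\<in>fib a. \<Sum>j\<in>fib b. of_bool (\<sigma> i \<noteq> \<sigma> j) * (real (n i) * real (n j))) =
      (\<Sum>i\<in>fib a. \<Sum>j\<in>{1..r}. of_bool (\<sigma> i \<noteq> \<sigma> j) * (real (n i) * real (n j)))"
      by (subst sum.swap) (simp only:)
  qed
  also have "\<dots> = (\<Sum>i\<in>{1..r}. \<Sum>j\<in>{1..r}. of_bool (\<sigma> i \<noteq> \<sigma> j) * (real (n i) * real (n j)))"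
    unfolding fib_def using \<sigma> by (intro sum.group) auto
  finally show ?thesis using 1 by linarith
qed

lemma two_card_edges:
  assumes fin: "\<And>i. i \<in> {1..r} \<Longrightarrow> finite (V i)" and disj: "disjoint_family_on V {1..r}"
    and G: "spanning_subgraph G (complete_multipartite r V)"
  shows "2 * real (card (edges G)) = (\<Sum>i\<in>{1..r}. \<Sum>j\<in>{1..r}. of_bool (i \<noteq> j) *
    (real (card (V i)) * real (card (V j)) - real (card {(u, v) \<in> V i \<times> V j. {u, v} \<notin> edges G})))"
proof -
  define D where "D i j = {(u, v) \<in> V i \<times> V j. {u, v} \<in> edges G}" for i j
  have eK: "\<exists>u v i j. e = {u, v} \<and> i \<in> {1..r} \<and> j \<in> {1..r} \<and> i \<noteq> j \<and> u \<in> V i \<and> v \<in> V j" if "e \<in> edges G" for e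
    using that G by (auto simp: spanning_subgraph_def complete_multipartite_def)
  have ne: "u \<noteq> v" if "u \<in> V i" "v \<in> V j" "i \<in> {1..r}" "j \<in> {1..r}" "i \<noteq> j" for u v i j
  proof -
    have "V i \<inter> V j = {}" using disj that unfolding disjoint_family_on_def by blast
    then show ?thesis using that(1,2) by blast
  qed
  have card2: "card e = 2" if e: "e \<in> edges G" for e
  proof -
    obtain u v i j where "e = {u, v}" "i \<in> {1..r}" "j \<in> {1..r}" "i \<noteq> j" "u \<in> V i" "v \<in> V j"
      using eK[OF e] by blast
    then show ?thesis using ne[of u i v j] by simp
  qed
  have "edges G \<subseteq> Pow (\<Union>i\<in>{1..r}. V i)" using eK by blast
  then have finE: "finite (edges G)" using fin by (meson finite_Pow_iff finite_UN_I finite_atLeastAtMost finite_subset)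
  have finD: "finite (D i j)" if "i \<in> {1..r}" "j \<in> {1..r}" for i j
    by (rule finite_subset[of _ "V i \<times> V j"]) (use fin that in \<open>auto simp: D_def\<close>)
  define P where "P = {p \<in> {1..r} \<times> {1..r}. fst p \<noteq> snd p}"
  have finP: "finite P" by (simp add: P_def)
  have "{p. {fst p, snd p} \<in> edges G} = (\<Union>q\<in>P. D (fst q) (snd q))"
  proof (intro set_eqI iffI)
    fix p assume p: "p \<in> {p. {fst p, snd p} \<in> edges G}"
    then obtain u v i j where uv: "{fst p, snd p} = {u, v}" "i \<in> {1..r}" "j \<in> {1..r}" "i \<noteq> j" "u \<in> V i" "v \<in> V j"
      using eK[of "{fst p, snd p}"] by auto
    then have "(p = (u, v)) \<or> (p = (v, u))" by (cases p) (auto simp: doubleton_eq_iff)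
    then have "p \<in> D i j \<or> p \<in> D j i" using p uv by (auto simp: D_def)
    moreover have "(i, j) \<in> P" "(j, i) \<in> P" using uv by (auto simp: P_def)
    ultimately show "p \<in> (\<Union>q\<in>P. D (fst q) (snd q))" by force
  next
    fix p assume "p \<in> (\<Union>q\<in>P. D (fst q) (snd q))"
    then show "p \<in> {p. {fst p, snd p} \<in> edges G}" by (auto simp: D_def)
  qed
  then have "2 * real (card (edges G)) = real (card (\<Union>q\<in>P. D (fst q) (snd q)))"
    using sum_ordered_pairs[OF finE card2, of "\<lambda>_. 1"] by simp
  also have "card (\<Union>q\<in>P. D (fst q) (snd q)) = (\<Sum>q\<in>P. card (D (fst q) (snd q)))"
  proof (rule card_UN_disjoint[OF finP])
    show "\<forall>q\<in>P. finite (D (fst q) (snd q))" using finD by (auto simp: P_def)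
    show "\<forall>q\<in>P. \<forall>q'\<in>P. q \<noteq> q' \<longrightarrow> D (fst q) (snd q) \<inter> D (fst q') (snd q') = {}"
    proof (intro ballI impI)
      fix q q' assume q: "q \<in> P" "q' \<in> P" "q \<noteq> q'"
      then have "fst q \<noteq> fst q' \<or> snd q \<noteq> snd q'" by (auto simp: prod_eq_iff)
      moreover have "fst q \<in> {1..r}" "fst q' \<in> {1..r}" "snd q \<in> {1..r}" "snd q' \<in> {1..r}"
        using q unfolding P_def by auto
      ultimately have "V (fst q) \<inter> V (fst q') = {} \<or> V (snd q) \<inter> V (snd q') = {}"
        using disj unfolding disjoint_family_on_def by blast
      then show "D (fst q) (snd q) \<inter> D (fst q') (snd q') = {}" unfolding D_def by blast
    qed
  qed
  also have "real \<dots> = (\<Sum>q\<in>P. real (card (D (fst q) (snd q))))" by simp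
  also have "\<dots> = (\<Sum>q\<in>{1..r} \<times> {1..r}. of_bool (fst q \<noteq> snd q) * real (card (D (fst q) (snd q))))"
    unfolding P_def by (intro sum.mono_neutral_cong_left) auto
  also have "\<dots> = (\<Sum>i\<in>{1..r}. \<Sum>j\<in>{1..r}. of_bool (i \<noteq> j) * real (card (D i j)))"
    unfolding sum.cartesian_product by (intro sum.cong refl) auto
  also have "\<dots> = (\<Sum>i\<in>{1..r}. \<Sum>j\<in>{1..r}. of_bool (i \<noteq> j) *
    (real (card (V i)) * real (card (V j)) - real (card {(u, v) \<in> V i \<times> V j. {u, v} \<notin> edges G})))"
  proof (intro sum.cong refl)
    fix i j assume ij: "i \<in> {1..r}" "j \<in> {1..r}"
    define N where "N = {(u, v) \<in> V i \<times> V j. {u, v} \<notin> edges G}"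
    have "V i \<times> V j = D i j \<union> N" by (auto simp: D_def N_def)
    then have "card (V i \<times> V j) = card (D i j \<union> N)" by (rule arg_cong)
    also have "\<dots> = card (D i j) + card N"
    proof (rule card_Un_disjoint[OF finD[OF ij]])
      show "finite N" by (rule finite_subset[of _ "V i \<times> V j"]) (use fin ij in \<open>auto simp: N_def\<close>)
      show "D i j \<inter> N = {}" by (auto simp: D_def N_def)
    qed
    finally have "card (V i \<times> V j) = card (D i j) + card {(u, v) \<in> V i \<times> V j. {u, v} \<notin> edges G}"
      unfolding N_def .
    then have "real (card (V i) * card (V j)) = real (card (D i j) + card {(u, v) \<in> V i \<times> V j. {u, v} \<notin> edges G})"
      by (simp only: card_cartesian_product)
    then show "of_bool (i \<noteq> j) * real (card (D i j)) = of_bool (i \<noteq> j) *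
      (real (card (V i)) * real (card (V j)) - real (card {(u, v) \<in> V i \<times> V j. {u, v} \<notin> edges G}))" by simp
  qed
  finally show ?thesis .
qed

lemma inside_extend:
  assumes finA: "finite A" and BA: "B \<subseteq> A" and r: "card A \<le> r" and w0: "\<And>i. i \<in> A \<Longrightarrow> 0 \<le> w i"
    and light: "\<And>i. i \<in> A - B \<Longrightarrow> w i \<le> \<gamma> * m" and \<gamma>: "0 \<le> \<gamma>" "\<gamma> \<le> 1" and m: "0 \<le> m"
    and a: "\<And>i. i \<in> B \<Longrightarrow> \<sigma> i = a \<Longrightarrow> w i \<le> m"
  shows "inside A w (\<lambda>i. if i \<in> B then \<sigma> i else a) \<le> inside B w \<sigma> + (real r)\<^sup>2 * (\<gamma> * m\<^sup>2)"
proof -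
  let ?\<tau> = "\<lambda>i. if i \<in> B then \<sigma> i else a"
  have lm: "w i \<le> m" if "i \<in> A - B" for i
    using light[OF that] mult_right_mono[OF \<gamma>(2) m] by simp
  have "inside A w ?\<tau> \<le> (\<Sum>i\<in>A. \<Sum>j\<in>A. of_bool (i \<in> B \<and> j \<in> B) * (of_bool (i \<noteq> j \<and> \<sigma> i = \<sigma> j) * (w i * w j)) + \<gamma> * m\<^sup>2)"
    unfolding inside_def
  proof (intro sum_mono)
    fix i j assume ij: "i \<in> A" "j \<in> A"
    have g0: "0 \<le> \<gamma> * m\<^sup>2" using \<gamma> by simp
    show "of_bool (i \<noteq> j \<and> ?\<tau> i = ?\<tau> j) * (w i * w j)
      \<le> of_bool (i \<in> B \<and> j \<in> B) * (of_bool (i \<noteq> j \<and> \<sigma> i = \<sigma> j) * (w i * w j)) + \<gamma> * m\<^sup>2"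
    proof (cases "i \<in> B \<and> j \<in> B")
      case True
      then show ?thesis using g0 by simp
    next
      case False
      show ?thesis
      proof (cases "?\<tau> i = ?\<tau> j")
        case True
        have "w i * w j \<le> \<gamma> * m\<^sup>2"
        proof (cases "i \<in> B")
          case iB: True
          then have "w i \<le> m" "w j \<le> \<gamma> * m" using False True a light ij by auto
          then have "w i * w j \<le> m * (\<gamma> * m)" using w0 ij m by (intro mult_mono) auto
          then show ?thesis by (simp add: power2_eq_square algebra_simps)
        next
          case iB: False
          then have "w i \<le> \<gamma> * m" using light ij by auto
          moreover have "w j \<le> m" using iB True a lm ij by (cases "j \<in> B") auto
          ultimately have "w i * w j \<le> (\<gamma> * m) * m" using w0 ij m \<gamma> by (intro mult_mono) auto
          then show ?thesis by (simp add: power2_eq_square algebra_simps)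
        qed
        then show ?thesis using False g0 by (auto simp: of_bool_def)
      qed (use g0 False in \<open>auto simp: of_bool_def\<close>)
    qed
  qed
  also have "\<dots> = (\<Sum>i\<in>A. \<Sum>j\<in>A. of_bool (i \<in> B \<and> j \<in> B) * (of_bool (i \<noteq> j \<and> \<sigma> i = \<sigma> j) * (w i * w j)))
      + (real (card A))\<^sup>2 * (\<gamma> * m\<^sup>2)"
    by (simp add: sum.distrib power2_eq_square)
  also have "(\<Sum>i\<in>A. \<Sum>j\<in>A. of_bool (i \<in> B \<and> j \<in> B) * (of_bool (i \<noteq> j \<and> \<sigma> i = \<sigma> j) * (w i * w j))) = inside B w \<sigma>"
  proof -
    have "inside B w \<sigma> = (\<Sum>i\<in>B. \<Sum>j\<in>A. of_bool (i \<in> B \<and> j \<in> B) * (of_bool (i \<noteq> j \<and> \<sigma> i = \<sigma> j) * (w i * w j)))"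
      unfolding inside_def by (intro sum.cong refl sum.mono_neutral_cong_left) (use finA BA in auto)
    also have "\<dots> = (\<Sum>i\<in>A. \<Sum>j\<in>A. of_bool (i \<in> B \<and> j \<in> B) * (of_bool (i \<noteq> j \<and> \<sigma> i = \<sigma> j) * (w i * w j)))"
      by (intro sum.mono_neutral_left) (use finA BA in \<open>auto intro!: sum.neutral\<close>)
    finally show ?thesis by simp
  qed
  also have "(real (card A))\<^sup>2 * (\<gamma> * m\<^sup>2) \<le> (real r)\<^sup>2 * (\<gamma> * m\<^sup>2)"
    using r \<gamma> by (intro mult_right_mono power_mono) auto
  finally show ?thesis by simp
qed

text \<open>
  Classes of size at least \<open>\<gamma> l * m\<close> are kept, the others are deleted; they are negligible even compared with
  the tolerances that \<open>\<gamma> l\<close> imposes.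
\<close>

lemma ex_gap:
  fixes x :: "nat \<Rightarrow> real" and \<gamma> :: "nat \<Rightarrow> real"
  assumes \<gamma>: "\<And>l. \<gamma> (Suc l) \<le> \<gamma> l" and m: "0 \<le> m"
  shows "\<exists>l\<le>r. \<forall>i\<in>{1..r}. x i < \<gamma> (Suc l) * m \<or> \<gamma> l * m \<le> x i"
proof (rule ccontr)
  assume "\<not> ?thesis"
  then have "\<forall>l\<in>{..r}. \<exists>i. i \<in> {1..r} \<and> \<gamma> (Suc l) * m \<le> x i \<and> x i < \<gamma> l * m" by (meson atMost_iff not_le)
  then obtain f where f: "\<And>l. l \<in> {..r} \<Longrightarrow> f l \<in> {1..r} \<and> \<gamma> (Suc l) * m \<le> x (f l) \<and> x (f l) < \<gamma> l * m" by metis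
  \<comment> \<open>The intervals from \<open>\<gamma> (Suc l) * m\<close> to
    \<open>\<gamma> l * m\<close> are disjoint, so \<open>r + 1\<close> levels without a gap would
    need \<open>r + 1\<close> different indices.\<close>
  have dec: "\<gamma> l' * m \<le> \<gamma> l * m" if "l \<le> l'" for l l'
    using lift_Suc_antimono_le[of \<gamma>, OF \<gamma> that] m by (intro mult_right_mono)
  have ne: "f l \<noteq> f l'" if "l < l'" "l' \<le> r" for l l'
  proof
    assume "f l = f l'"
    then have "\<gamma> (Suc l) * m < \<gamma> l' * m" using f[of l] f[of l'] that by auto
    then show False using dec[of "Suc l" l'] that by simp
  qed
  have "inj_on f {..r}"
  proof (rule inj_onI)
    fix l l' assume "l \<in> {..r}" "l' \<in> {..r}" "f l = f l'"
    then show "l = l'" using ne[of l l'] ne[of l' l] by (metis atMost_iff linorder_neqE_nat)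
  qed
  moreover have "f ` {..r} \<subseteq> {1..r}" using f by blast
  ultimately have "card {..r} \<le> card {1..r}" by (rule card_inj_on_le) (rule finite_atLeastAtMost)
  then show False by simp
qed

subsection \<open>The stability theorem\<close>

text \<open>Translation to the original family. Classes outside \<open>B\<close> become empty under
  \<open>X'\<close>, and empty classes are neither integral nor partial. Their vertices are put into
  class 1 of \<open>P\<close>, an arbitrary choice with no effect on \<open>P\<close> after the
  deletion of \<open>X'\<close>.\<close>

lemma stable_partition_if_approx_stable:
  fixes V :: "nat \<Rightarrow> 'a set" and G :: "'a sgraph"
  assumes k: "1 \<le> k" and Br: "B \<subseteq> {1..r}"
    and finV: "\<forall>i\<in>{1..r}. finite (V i)" and disj: "disjoint_family_on V {1..r}"
    and G: "spanning_subgraph G (complete_multipartite r V)"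
    and st: "approx_stable B k V f X supp \<mu>"
    and close: "\<forall>i\<in>B. \<forall>v\<in>V i - X. real (card {u \<in> (\<Union>j\<in>B - {i}. V j). \<not> ({v, u} \<in> edges G \<longleftrightarrow> f v \<noteq> f u)}) \<le> e"
    and e: "e \<le> \<epsilon> * real (card (V k))"
    and X': "X' = X \<union> (\<Union>i\<in>{1..r} - B. V i)" "real (card X') \<le> \<epsilon> * real (card (V k))"
  defines "P \<equiv> \<lambda>a. {v \<in> verts G. (if v \<in> (\<Union>i\<in>B. V i) then f v else 1) = a}"
  shows "stable_partition r (Suc k) V X' \<epsilon> G P"
    and "\<And>a. a \<in> {1..k} \<Longrightarrow> card (integral_part r (delete_family V X') (delete_family P X' a)) =
       (\<Sum>i | i \<in> B \<and> supp i = {a}. card (V i - X))"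
proof -
  have vG: "verts G = (\<Union>i\<in>{1..r}. V i)"
    using G by (simp add: spanning_subgraph_def complete_multipartite_def)
  have fin: "finite (V i)" if "i \<in> {1..r}" for i using finV that by blast
  have finG: "finite (verts G)" unfolding vG using fin by auto
  have disjD: "i = j" if "i \<in> {1..r}" "j \<in> {1..r}" "v \<in> V i" "v \<in> V j" for i j v
    using that disj unfolding disjoint_family_on_def by blast
  interpret approx_stable B k V f X supp \<mu> by (rule st)
  have finB: "finite B" using Br finite_subset by blast
  define V' where "V' = delete_family V X'"
  define P' where "P' = delete_family P X'"
  have V'B: "V' i = V i - X" if "i \<in> B" for i
  proof -
    have "v \<notin> V j" if "v \<in> V i" "j \<in> {1..r} - B" for v j
      using disjD[of i j v] that \<open>i \<in> B\<close> Br by blast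
    then show ?thesis unfolding V'_def delete_family_def X'(1) by blast
  qed
  have V'0: "V' i = {}" if "i \<in> {1..r} - B" for i
    using that unfolding V'_def delete_family_def X'(1) by blast
  have inX': "\<exists>i\<in>B. v \<in> V i - X" if "v \<in> verts G - X'" for v
    using that unfolding vG X'(1) by blast
  have notX': "v \<in> verts G - X'" if "i \<in> B" "v \<in> V i - X" for i v
    using V'B[OF that(1)] that Br unfolding V'_def delete_family_def vG by blast
  have mem: "v \<in> P' a \<longleftrightarrow> f v = a" if "i \<in> B" "v \<in> V i - X" for i v a
    using notX'[OF that] that unfolding P'_def delete_family_def P_def by auto
  have P'_sub: "\<exists>i\<in>B. v \<in> V i - X \<and> f v = a" if "v \<in> P' a" for v a
  proof -
    have "v \<in> verts G - X'" using that unfolding P'_def delete_family_def P_def by blast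
    then obtain i where "i \<in> B" "v \<in> V i - X" using inX' by blast
    then show ?thesis using mem that by blast
  qed
  have V'_sub: "V' i \<subseteq> P' a \<longleftrightarrow> supp i \<subseteq> {a}" if i: "i \<in> B" and a: "a \<in> {1..k}" for i a
  proof
    assume "V' i \<subseteq> P' a"
    then have "f v = a" if "v \<in> V i - X" for v using mem[OF i that] that V'B[OF i] by blast
    then show "supp i \<subseteq> {a}" using cells[OF i] supp_range[OF i] by blast
  next
    assume s: "supp i \<subseteq> {a}"
    show "V' i \<subseteq> P' a"
    proof
      fix v assume "v \<in> V' i"
      then have v: "v \<in> V i - X" using V'B[OF i] by simp
      then have "f v \<in> supp i" using cells[OF i, of "f v"] colour_range[OF i] by blast
      then show "v \<in> P' a" using s mem[OF i v] by auto
    qed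
  qed
  have V'_int: "V' i \<inter> P' a \<noteq> {} \<longleftrightarrow> a \<in> supp i" if i: "i \<in> B" and a: "a \<in> {1..k}" for i a
    using cells[OF i a] mem[OF i] V'B[OF i] by auto
  have integral: "integral_in (V' i) (P' a) \<longleftrightarrow> i \<in> B \<and> supp i = {a}" if "i \<in> {1..r}" "a \<in> {1..k}" for i a
  proof (cases "i \<in> B")
    case True
    have "V' i \<noteq> {}" using V'_int[OF True] supp_range[OF True] by blast
    then show ?thesis unfolding integral_in_def V'_sub[OF True that(2)] using supp_range[OF True] True by blast
  next
    case False
    then show ?thesis using V'0 that by (simp add: integral_in_def)
  qed
  have partial: "partial_in (V' i) (P' a) \<longleftrightarrow> i \<in> B \<and> a \<in> supp i \<and> supp i \<noteq> {a}" if "i \<in> {1..r}" "a \<in> {1..k}" for i a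
  proof (cases "i \<in> B")
    case True
    show ?thesis unfolding partial_in_def V'_sub[OF True that(2)] V'_int[OF True that(2)] using True by blast
  next
    case False
    then show ?thesis using V'0 that by (simp add: partial_in_def)
  qed
  have ip: "integral_part r V' (P' a) = (\<Union>i\<in>{i \<in> B. supp i = {a}}. V i - X)" if a: "a \<in> {1..k}" for a
  proof -
    have "{i \<in> {1..r}. integral_in (V' i) (P' a)} = {i \<in> B. supp i = {a}}" using integral a Br by blast
    then show ?thesis unfolding integral_part_def using V'B by simp
  qed
  show card_ip: "card (integral_part r V' (P' a)) = (\<Sum>i | i \<in> B \<and> supp i = {a}. card (V i - X))" if a: "a \<in> {1..k}" for a
    unfolding ip[OF a]
  proof (rule card_UN_disjoint)
    show "\<forall>i\<in>{i \<in> B. supp i = {a}}. \<forall>j\<in>{i \<in> B. supp i = {a}}. i \<noteq> j \<longrightarrow> (V i - X) \<inter> (V j - X) = {}"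
      using disjD Br by blast
  qed (use finB fin Br in auto)
  have isp: "\<exists>i\<in>B. a \<in> supp i \<and> supp i \<noteq> {a}" if a: "is_partial r V' (P' a)" "a \<in> {1..k}" for a
  proof -
    obtain i where "i \<in> {1..r}" "partial_in (V' i) (P' a)" using a(1) unfolding is_partial_def partial_part_def by blast
    then show ?thesis using partial a(2) by blast
  qed
  have finP': "finite (P' a)" for a
    by (rule finite_subset[OF _ finG]) (auto simp: P'_def delete_family_def P_def)
  have "stable k P' r V'"
    unfolding stable_def
  proof (intro conjI ballI impI)
    fix a assume a: "a \<in> {1..k}"
    have "i = j" if "i \<in> {i \<in> {1..r}. partial_in (V' i) (P' a)}" "j \<in> {i \<in> {1..r}. partial_in (V' i) (P' a)}" for i j
      using that partial[of i a] partial[of j a] a partial_unique[of i a j] by blast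
    then have "card {i \<in> {1..r}. partial_in (V' i) (P' a)} \<le> Suc 0"
      by (subst card_le_Suc0_iff_eq) auto
    then show "card {i \<in> {1..r}. partial_in (V' i) (P' a)} \<le> 1" by simp
  next
    fix a b assume ab: "a \<in> {1..k}" "b \<in> {1..k}" "is_partial r V' (P' a)"
    have a\<mu>: "card (integral_part r V' (P' a)) = \<mu>"
      using isp[OF ab(3,1)] partial_eq card_ip[OF ab(1)] by auto
    show "if is_partial r V' (P' b) then card (integral_part r V' (P' a)) = card (integral_part r V' (P' b))
      else card (integral_part r V' (P' a)) \<le> card (P' b)"
    proof (cases "is_partial r V' (P' b)")
      case True
      then have "card (integral_part r V' (P' b)) = \<mu>"
        using isp[OF True ab(2)] partial_eq card_ip[OF ab(2)] by auto
      then show ?thesis using True a\<mu> by simp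
    next
      case False
      have "integral_part r V' (P' b) \<subseteq> P' b" unfolding integral_part_def integral_in_def by blast
      then have "card (integral_part r V' (P' b)) \<le> card (P' b)" using finP' by (intro card_mono)
      then show ?thesis using False a\<mu> level_le[OF ab(2)] card_ip[OF ab(2)] by simp
    qed
  next
    fix a i assume a: "a \<in> {1..k}" and i: "i \<in> {1..r}" and pc: "is_partial_class k P' (V' i)"
    obtain b where b: "b \<in> {1..k}" "partial_in (V' i) (P' b)" using pc unfolding is_partial_class_def by blast
    then have ib: "i \<in> B" "b \<in> supp i" "supp i \<noteq> {b}" using partial[OF i b(1)] by auto
    then show "card (V' i) \<le> card (integral_part r V' (P' a))"
      using partial_le[OF ib] V'B[OF ib(1)] level_le[OF a] card_ip[OF a] by simp
  next
    fix a i b assume a: "a \<in> {1..k}" and i: "i \<in> {1..r}" and ii: "integral_in (V' i) (P' a)" and b: "b \<in> {1..k}" "b \<noteq> a"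
    have iB: "i \<in> B" "supp i = {a}" using integral[OF i a] ii by auto
    have "P' a - V' i \<subseteq> (\<Union>j\<in>B - {i}. {v \<in> V j - X. f v = a})"
      using P'_sub V'B[OF iB(1)] by blast
    then have "card (P' a - V' i) \<le> card (\<Union>j\<in>B - {i}. {v \<in> V j - X. f v = a})"
      using finB fin Br by (intro card_mono) auto
    also have "\<dots> \<le> (\<Sum>j\<in>B - {i}. card {v \<in> V j - X. f v = a})" using finB by (intro card_UN_le) auto
    also have "\<dots> \<le> \<mu>" by (rule rest_le[OF iB])
    also have "\<dots> \<le> card (integral_part r V' (P' b))" using level_le[OF b(1)] card_ip[OF b(1)] by simp
    finally show "card (P' a - V' i) \<le> card (integral_part r V' (P' b))" .
  qed
  moreover have "indexed_partition (verts G) k P"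
  proof -
    have "(if v \<in> (\<Union>i\<in>B. V i) then f v else 1) \<in> {1..k}" for v using colour_range k by auto
    then show ?thesis unfolding indexed_partition_def disjoint_family_on_def P_def by blast
  qed
  moreover have X'G: "X' \<subseteq> verts G" using X_subset Br unfolding X'(1) vG by blast
  moreover have "close_to (\<epsilon> * real (card (V k))) (delete_verts G X') (delete_verts (cross_subgraph (complete_multipartite r V) k P) X')"
    unfolding close_to_def
  proof (intro conjI ballI)
    let ?K = "complete_multipartite r V"
    show "verts (delete_verts G X') = verts (delete_verts (cross_subgraph ?K k P) X')"
      using G by (simp add: delete_verts_def cross_subgraph_def spanning_subgraph_def)
    fix v assume "v \<in> verts (delete_verts (cross_subgraph ?K k P) X')"
    then have "v \<in> verts G - X'" using G by (simp add: delete_verts_def cross_subgraph_def spanning_subgraph_def)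
    then obtain i where i: "i \<in> B" "v \<in> V i - X" using inX' by blast
    \<comment> \<open>Both graphs lie in the complete multipartite graph, so their neighbourhoods of
      \<open>v\<close> differ only at vertices of other kept classes, which is where
      \<open>close\<close> counts.\<close>
    have Ki: "\<exists>j\<in>B - {i}. u \<in> V j - X" if u: "{v, u} \<in> edges ?K" "{v, u} \<inter> X' = {}" for u
    proof -
      obtain x y p q where pq: "{v, u} = {x, y}" "p \<in> {1..r}" "q \<in> {1..r}" "p \<noteq> q" "x \<in> V p" "y \<in> V q"
        using u(1) unfolding complete_multipartite_def by auto
      have "u \<in> verts G - X'" using pq u(2) unfolding vG by (auto simp: doubleton_eq_iff)
      then obtain j where j: "j \<in> B" "u \<in> V j - X" using inX' by blast
      have "j \<noteq> i"
      proof
        assume "j = i"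
        then have "x \<in> V i" "y \<in> V i" using pq(1) i j by (auto simp: doubleton_eq_iff)
        then have "p = i" "q = i" using disjD pq i Br by blast+
        then show False using pq by simp
      qed
      then show ?thesis using j by blast
    qed
    have GK: "edges G \<subseteq> edges ?K" using G by (simp add: spanning_subgraph_def)
    have "sym_diff (neighbourhood (delete_verts (cross_subgraph ?K k P) X') v) (neighbourhood (delete_verts G X') v)
      \<subseteq> {u \<in> (\<Union>j\<in>B - {i}. V j). \<not> ({v, u} \<in> edges G \<longleftrightarrow> f v \<noteq> f u)}"
    proof
      fix u assume u: "u \<in> sym_diff (neighbourhood (delete_verts (cross_subgraph ?K k P) X') v) (neighbourhood (delete_verts G X') v)"
      have cross: "{v, u} \<in> edges (cross_subgraph ?K k P) \<longleftrightarrow> {v, u} \<in> edges ?K \<and>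
          (\<exists>a\<in>{1..k}. \<exists>b\<in>{1..k}. \<exists>x\<in>P a. \<exists>y\<in>P b. a \<noteq> b \<and> {v, u} = {x, y})"
        by (simp add: cross_subgraph_def)
      have uK: "{v, u} \<in> edges ?K" "{v, u} \<inter> X' = {}"
        using u GK cross by (auto simp: neighbourhood_def delete_verts_def)
      obtain j where j: "j \<in> B - {i}" "u \<in> V j - X" using Ki[OF uK] by blast
      have Pv: "v \<in> P a \<longleftrightarrow> f v = a" "u \<in> P a \<longleftrightarrow> f u = a" for a
        using i j Br unfolding P_def vG by auto
      have "{v, u} \<in> edges (cross_subgraph ?K k P) \<longleftrightarrow> f v \<noteq> f u"
      proof
        assume "{v, u} \<in> edges (cross_subgraph ?K k P)"
        then obtain a b x y where "a \<noteq> b" "x \<in> P a" "y \<in> P b" "{v, u} = {x, y}" unfolding cross by blast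
        then show "f v \<noteq> f u" using Pv by (auto simp: doubleton_eq_iff)
      next
        assume "f v \<noteq> f u"
        then show "{v, u} \<in> edges (cross_subgraph ?K k P)"
          unfolding cross using uK(1) colour_range i j Pv by blast
      qed
      moreover have "\<not> ({v, u} \<in> edges (cross_subgraph ?K k P) \<longleftrightarrow> {v, u} \<in> edges G)"
        using u uK by (auto simp: neighbourhood_def delete_verts_def)
      ultimately show "u \<in> {u \<in> (\<Union>j\<in>B - {i}. V j). \<not> ({v, u} \<in> edges G \<longleftrightarrow> f v \<noteq> f u)}" using j by blast
    qed
    moreover have "finite {u \<in> (\<Union>j\<in>B - {i}. V j). \<not> ({v, u} \<in> edges G \<longleftrightarrow> f v \<noteq> f u)}"
      by (rule finite_subset[OF _ finG]) (use Br vG in blast)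
    ultimately have "card (sym_diff (neighbourhood (delete_verts (cross_subgraph ?K k P) X') v) (neighbourhood (delete_verts G X') v))
      \<le> card {u \<in> (\<Union>j\<in>B - {i}. V j). \<not> ({v, u} \<in> edges G \<longleftrightarrow> f v \<noteq> f u)}" by (intro card_mono)
    then show "real (card (sym_diff (neighbourhood (delete_verts (cross_subgraph ?K k P) X') v) (neighbourhood (delete_verts G X') v)))
      \<le> \<epsilon> * real (card (V k))"
      using close i e by force
  qed
  ultimately show "stable_partition r (Suc k) V X' \<epsilon> G P"
    unfolding stable_partition_def V'_def P'_def using X'(2) by simp
qed

theorem theorem1p5:
  fixes r t :: nat and F :: "'b sgraph" and \<epsilon> :: real
  assumes "3 \<le> t" and "t \<le> r"
    and "simple_graph F" and "chromatic_number F = t"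
    and "0 < \<epsilon>" and "\<epsilon> < 1"
  shows "\<exists>\<delta>>0. \<forall>(n :: nat \<Rightarrow> nat) (V :: nat \<Rightarrow> 'a set) (G :: 'a sgraph).
    (\<forall>i j. 1 \<le> i \<and> i \<le> j \<and> j \<le> r \<longrightarrow> n j \<le> n i) \<and>
    real (n (t - 1)) \<ge> 1 / \<delta> \<and>
    disjoint_family_on V {1..r} \<and>
    (\<forall>i\<in>{1..r}. finite (V i) \<and> card (V i) = n i) \<and>
    spanning_subgraph G (complete_multipartite r V) \<and>
    free_of F G \<and>
    real (card (edges G)) \<ge> real (turan_f n r t) - \<delta> * (real (n (t - 1)))\<^sup>2
    \<longrightarrow>
    (\<exists>G' X P.
       spanning_subgraph G' G \<and>
       real (card (edges G')) \<ge> real (card (edges G)) - \<epsilon> * (real (n (t - 1)))\<^sup>2 \<and>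
       stable_partition r t V X \<epsilon> G' P \<and>
       (\<forall>j\<in>{1..t - 1}.
          real (card (integral_part r (delete_family V X) (delete_family P X j)))
            > (1 - \<epsilon>) * real (n (t - 1))))"
proof -
  define k where "k = t - 1"
  have t: "t = Suc k" and k: "1 \<le> k" "k \<le> r" using assms by (auto simp: k_def)
  define s where "s = card (verts F)"
  \<comment> \<open>Half of \<open>\<epsilon>\<close> is spent here, the other half on deleting the
    light classes.\<close>
  define core where "core \<gamma> \<delta> \<longleftrightarrow> (\<forall>B (V :: nat \<Rightarrow> 'a set) adj.
    transversals B V adj \<longrightarrow> card B \<le> r \<longrightarrow> {1..k} \<subseteq> B \<longrightarrow> (\<forall>i\<in>{1..k}. card (V k) \<le> card (V i)) \<longrightarrow>
    (\<forall>i\<in>B - {1..k}. card (V i) \<le> card (V k)) \<longrightarrow> (\<forall>i\<in>B. \<gamma> * real (card (V k)) \<le> real (card (V i))) \<longrightarrow>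
    1 / \<delta> \<le> real (card (V k)) \<longrightarrow> \<not> has_blow_up B V adj (Suc k) s \<longrightarrow>
    (\<forall>\<tau>. \<tau> \<in> B \<rightarrow> {1..k} \<longrightarrow>
       transversals.missing B V adj \<le> inside B (\<lambda>i. real (card (V i))) \<tau> + \<delta> * (real (card (V k)))\<^sup>2) \<longrightarrow>
    (\<exists>f X supp \<mu>. approx_stable B k V f X supp \<mu> \<and> real (card X) \<le> \<epsilon> / 2 * real (card (V k)) \<and>
       (\<forall>i\<in>B. \<forall>v\<in>V i - X. real (card {u \<in> (\<Union>j\<in>B - {i}. V j). \<not> (adj v u \<longleftrightarrow> f v \<noteq> f u)}) \<le> \<epsilon> / 2 * real (card (V k))) \<and>
       (\<forall>b\<in>{1..k}. (1 - \<epsilon> / 2) * real (card (V k)) < real (\<Sum>i | i \<in> B \<and> supp i = {b}. card (V i - X)))))"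
    for \<gamma> \<delta> :: real
  have "\<exists>\<delta>>0. core \<gamma> \<delta>" if "0 < \<gamma>" for \<gamma>
    unfolding core_def using dense_imp_approx_stable[OF k _ that, of "\<epsilon> / 2"] assms(5) by simp
  then obtain d where d: "\<And>\<gamma>. 0 < \<gamma> \<Longrightarrow> 0 < d \<gamma> \<and> core \<gamma> (d \<gamma>)" by metis
  \<comment> \<open>Classes below the next threshold change the optimum by at most a quarter of the
    slack \<open>d \<gamma>\<close>, in units of \<open>m^2\<close>, and have together at most
    \<open>\<epsilon> / 2 * m\<close> vertices.\<close>
  define step where "step \<gamma> = min \<gamma> (min (d \<gamma> / (4 * (real r)\<^sup>2)) (\<epsilon> / (2 * real r)))" for \<gamma>
  define \<gamma> where "\<gamma> l = (step ^^ l) 1" for l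
  have \<gamma>0: "\<gamma> 0 = 1" and \<gamma>S: "\<gamma> (Suc l) = step (\<gamma> l)" for l by (simp_all add: \<gamma>_def)
  have r: "0 < real r" using k by simp
  have \<gamma>_pos: "0 < \<gamma> l" for l
  proof (induction l)
    case (Suc l)
    then show ?case using d[OF Suc] r assms(5) by (simp add: \<gamma>S step_def)
  qed (simp add: \<gamma>0)
  have \<gamma>_dec: "\<gamma> (Suc l) \<le> \<gamma> l" for l unfolding \<gamma>S step_def by simp
  have \<gamma>_le1: "\<gamma> l \<le> 1" for l
    by (induction l) (use \<gamma>_dec order_trans in \<open>auto simp: \<gamma>0\<close>)
  \<comment> \<open>The level \<open>l\<close> of the gap depends on the class sizes, so
    \<open>\<delta>\<close> has to serve all levels.\<close>
  define \<delta> where "\<delta> = Min ((\<lambda>l. d (\<gamma> l) / 4) ` {..r})"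
  have \<delta>_le: "\<delta> \<le> d (\<gamma> l) / 4" if "l \<le> r" for l unfolding \<delta>_def using that by (intro Min_le) auto
  have \<delta>_pos: "0 < \<delta>" unfolding \<delta>_def using d \<gamma>_pos by (subst Min_gr_iff) auto
  show ?thesis
  proof (intro exI[of _ \<delta>] conjI \<delta>_pos allI impI; elim conjE)
    fix n :: "nat \<Rightarrow> nat" and V :: "nat \<Rightarrow> 'a set" and G :: "'a sgraph"
    assume mono: "\<forall>i j. 1 \<le> i \<and> i \<le> j \<and> j \<le> r \<longrightarrow> n j \<le> n i" and big: "real (n (t - 1)) \<ge> 1 / \<delta>"
      and disj: "disjoint_family_on V {1..r}" and V: "\<forall>i\<in>{1..r}. finite (V i) \<and> card (V i) = n i"
      and G: "spanning_subgraph G (complete_multipartite r V)" and free: "free_of F G"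
      and eG: "real (card (edges G)) \<ge> real (turan_f n r t) - \<delta> * (real (n (t - 1)))\<^sup>2"
    define m where "m = real (n k)"
    have m: "1 / \<delta> \<le> m" using big by (simp add: m_def t)
    have m0: "0 < m" using m \<delta>_pos by (meson divide_pos_pos less_le_trans zero_less_one)
    have Vk: "card (V k) = n k" using V k by auto
    define w where "w i = real (card (V i))" for i
    have wn: "w i = real (n i)" if "i \<in> {1..r}" for i using V that by (simp add: w_def)
    obtain l where l: "l \<le> r" "\<forall>i\<in>{1..r}. w i < \<gamma> (Suc l) * m \<or> \<gamma> l * m \<le> w i"
      using ex_gap[of \<gamma> m r w, OF \<gamma>_dec] m0 by auto
    define D where "D = d (\<gamma> l)"
    have D: "0 < D" "core (\<gamma> l) D" using d[OF \<gamma>_pos] by (auto simp: D_def)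
    define B where "B = {i \<in> {1..r}. \<gamma> l * m \<le> w i}"
    define adj where "adj u v \<longleftrightarrow> {u, v} \<in> edges G" for u v
    have Br: "B \<subseteq> {1..r}" and finB: "finite B" by (auto simp: B_def)
    have cB: "card B \<le> r" using card_mono[OF _ Br] by simp
    \<comment> \<open>By the gap, a class that misses the threshold \<open>\<gamma> l * m\<close>
      misses even the next one.\<close>
    have light: "w i \<le> \<gamma> (Suc l) * m" if "i \<in> {1..r} - B" for i using l(2) that unfolding B_def by force
    have w_k: "m \<le> w i" if "i \<in> {1..k}" for i using mono wn[of i] that k by (auto simp: m_def)
    have kB: "{1..k} \<subseteq> B"
    proof
      fix i assume i: "i \<in> {1..k}"
      have "\<gamma> l * m \<le> 1 * m" using \<gamma>_le1 m0 by (intro mult_right_mono) auto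
      then show "i \<in> B" using w_k[OF i] i k by (auto simp: B_def)
    qed
    have w_le: "w i \<le> m" if "i \<in> {1..r}" "i \<notin> {1..k} \<or> i = k" for i
      using mono wn[of i] that k by (auto simp: m_def)
    interpret tr: transversals B V adj
    proof
      show "V i \<noteq> {}" if "i \<in> B" for i
      proof
        assume "V i = {}"
        then show False using that mult_pos_pos[OF \<gamma>_pos[of l] m0] by (simp add: B_def w_def)
      qed
      show "disjoint_family_on V B" using disj Br by (rule disjoint_family_on_mono[rotated])
    qed (use finB V Br in \<open>auto simp: adj_def insert_commute\<close>)
    have blow: "\<not> has_blow_up B V adj (Suc k) s"
    proof
      assume "has_blow_up B V adj (Suc k) s"
      then obtain J S where JS: "J \<subseteq> B" "card J = Suc k" "\<forall>j\<in>J. S j \<subseteq> V j \<and> card (S j) = s"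
        "\<forall>i\<in>J. \<forall>j\<in>J. i \<noteq> j \<longrightarrow> (\<forall>u\<in>S i. \<forall>v\<in>S j. adj u v)" unfolding has_blow_up_def by blast
      have "contains_copy G F"
      proof (rule contains_copy_if_blow_up[OF assms(3,4)])
        show "finite J" using JS(1) finB finite_subset by blast
        show "card J = t" using JS(2) t by simp
        show "disjoint_family_on S J"
          using disj JS(1,3) Br unfolding disjoint_family_on_def by blast
        show "S j \<subseteq> verts G \<and> card (S j) = card (verts F) \<and> finite (S j)" if "j \<in> J" for j
        proof -
          have "j \<in> {1..r}" "S j \<subseteq> V j" "card (S j) = s" using that JS Br by auto
          moreover have "verts G = (\<Union>i\<in>{1..r}. V i)"
            using G by (simp add: spanning_subgraph_def complete_multipartite_def)
          ultimately show ?thesis using V finite_subset unfolding s_def by blast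
        qed
        show "{u, v} \<in> edges G" if "i \<in> J" "j \<in> J" "i \<noteq> j" "u \<in> S i" "v \<in> S j" for i j u v
          using JS(4) that unfolding adj_def by blast
      qed
      then show False using free by (simp add: free_of_def)
    qed

    \<comment> \<open>Missing edges between the kept classes\<close>
    have miss: "tr.missing \<le> inside B w \<tau> + D * m\<^sup>2" if \<tau>: "\<tau> \<in> B \<rightarrow> {1..k}" for \<tau>
    proof -
      have finP: "finite (B \<rightarrow>\<^sub>E {1..k})" using finB by (intro finite_PiE) auto
      have neP: "B \<rightarrow>\<^sub>E {1..k} \<noteq> {}" using k by (auto simp: PiE_eq_empty_iff)
      obtain \<sigma> where \<sigma>: "\<sigma> \<in> B \<rightarrow>\<^sub>E {1..k}" "\<And>\<rho>. \<rho> \<in> B \<rightarrow>\<^sub>E {1..k} \<Longrightarrow> inside B w \<sigma> \<le> inside B w \<rho>"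
      proof -
        have "Min (inside B w ` (B \<rightarrow>\<^sub>E {1..k})) \<in> inside B w ` (B \<rightarrow>\<^sub>E {1..k})"
          using finP neP by (intro Min_in) auto
        then obtain \<sigma> where "Min (inside B w ` (B \<rightarrow>\<^sub>E {1..k})) = inside B w \<sigma>" "\<sigma> \<in> B \<rightarrow>\<^sub>E {1..k}"
          by (rule imageE) blast
        then show thesis using finP by (intro that[of \<sigma>]) (auto intro: Min_le simp flip: \<open>Min _ = _\<close>)
      qed
      have \<sigma>_opt: "inside B w \<sigma> \<le> inside B w \<rho>" if "\<rho> \<in> B \<rightarrow> {1..k}" for \<rho>
      proof -
        have "inside B w \<rho> = inside B w (restrict \<rho> B)" by (intro inside_cong_kernel) auto
        moreover have "restrict \<rho> B \<in> B \<rightarrow>\<^sub>E {1..k}" using that by auto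
        ultimately show ?thesis using \<sigma>(2) by simp
      qed
      have \<sigma>Pi: "\<sigma> \<in> B \<rightarrow> {1..k}" using \<sigma>(1) by (simp add: PiE_def)
      \<comment> \<open>Tolerance 0: an optimal colouring uses every colour, so its extension is
        admissible for \<open>turan_f\<close>.\<close>
      have surj: "\<sigma> ` B = {1..k}"
        by (rule near_optimal_imp_surj[OF finB kB, of "\<gamma> l * m" w 0])
           (use \<sigma>Pi \<sigma>_opt \<gamma>_pos m0 in \<open>auto simp: B_def\<close>)
      \<comment> \<open>The first \<open>k - 1\<close> indices leave a colour \<open>a\<close> free.
        Only indices of weight at most \<open>m\<close> have it, so the light classes can join it
        cheaply.\<close>
      have "card (\<sigma> ` {1..<k}) < card {1..k}" using card_image_le[of "{1..<k}" \<sigma>] k by simp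
      then have "\<not> {1..k} \<subseteq> \<sigma> ` {1..<k}" by (meson card_mono finite_atLeastLessThan finite_imageI not_le)
      then obtain a where a: "a \<in> {1..k}" "a \<notin> \<sigma> ` {1..<k}" by blast
      define \<rho> where "\<rho> = (\<lambda>i. if i \<in> B then \<sigma> i else a)"
      have ins: "inside {1..r} w \<rho> \<le> inside B w \<sigma> + (real r)\<^sup>2 * (\<gamma> (Suc l) * m\<^sup>2)"
        unfolding \<rho>_def
      proof (rule inside_extend[OF _ Br])
        show "w i \<le> m" if "i \<in> B" "\<sigma> i = a" for i
        proof (rule w_le)
          show "i \<in> {1..r}" using that Br by blast
          have "i \<notin> {1..<k}" using a(2) that(2) by blast
          then show "i \<notin> {1..k} \<or> i = k" by auto
        qed
      qed (use light \<gamma>_pos[of "Suc l"] \<gamma>_le1[of "Suc l"] m0 in \<open>auto simp: w_def\<close>)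
      have "\<rho> ` {1..r} = {1..k}"
      proof
        show "\<rho> ` {1..r} \<subseteq> {1..k}" using \<sigma>Pi a(1) by (auto simp: \<rho>_def)
        have "\<rho> ` B = \<sigma> ` B" by (rule image_cong) (auto simp: \<rho>_def)
        then show "{1..k} \<subseteq> \<rho> ` {1..r}" using surj Br by (metis image_mono)
      qed
      from turan_f_ge[OF this, of n]
      have tu: "(\<Sum>i\<in>{1..r}. \<Sum>j\<in>{1..r}. of_bool (\<rho> i \<noteq> \<rho> j) * (w i * w j)) \<le> 2 * real (turan_f n r t)"
        unfolding t using wn by simp
      define N where "N i j = real (card {(u, v) \<in> V i \<times> V j. {u, v} \<notin> edges G})" for i j
      have N0: "0 \<le> N i j" for i j by (simp add: N_def)
      have "2 * real (card (edges G)) = (\<Sum>i\<in>{1..r}. \<Sum>j\<in>{1..r}. of_bool (i \<noteq> j) * (w i * w j - N i j))"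
        unfolding w_def N_def using V disj G by (intro two_card_edges) auto
      also have "\<dots> = (\<Sum>i\<in>{1..r}. \<Sum>j\<in>{1..r}. of_bool (i \<noteq> j) * (w i * w j)) - (\<Sum>i\<in>{1..r}. \<Sum>j\<in>{1..r}. of_bool (i \<noteq> j) * N i j)"
        by (simp only: right_diff_distrib sum_subtractf)
      finally have e2: "(\<Sum>i\<in>{1..r}. \<Sum>j\<in>{1..r}. of_bool (i \<noteq> j) * N i j) =
         (\<Sum>i\<in>{1..r}. \<Sum>j\<in>{1..r}. of_bool (i \<noteq> j) * (w i * w j)) - 2 * real (card (edges G))" by linarith
      have in2: "inside {1..r} w \<rho> = (\<Sum>i\<in>{1..r}. \<Sum>j\<in>{1..r}. of_bool (i \<noteq> j) * (w i * w j))
         - (\<Sum>i\<in>{1..r}. \<Sum>j\<in>{1..r}. of_bool (\<rho> i \<noteq> \<rho> j) * (w i * w j))"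
        unfolding inside_def sum_subtractf[symmetric] by (intro sum.cong refl) auto
      have "tr.missing = (\<Sum>i\<in>B. \<Sum>j\<in>B. of_bool (i \<noteq> j) * N i j)"
        unfolding tr.missing_def tr.nonadj_def N_def adj_def by simp
      also have "\<dots> \<le> (\<Sum>i\<in>B. \<Sum>j\<in>{1..r}. of_bool (i \<noteq> j) * N i j)"
        using Br N0 by (intro sum_mono sum_mono2) auto
      also have "\<dots> \<le> (\<Sum>i\<in>{1..r}. \<Sum>j\<in>{1..r}. of_bool (i \<noteq> j) * N i j)"
        using Br N0 by (intro sum_mono2) (auto intro!: sum_nonneg)
      also have "\<dots> \<le> inside {1..r} w \<rho> + 2 * (\<delta> * m\<^sup>2)"
        unfolding e2 in2 using tu eG by (simp add: m_def t)
      also have "\<dots> \<le> inside B w \<tau> + (real r)\<^sup>2 * (\<gamma> (Suc l) * m\<^sup>2) + 2 * (\<delta> * m\<^sup>2)"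
        using ins \<sigma>_opt[OF \<tau>] by linarith
      \<comment> \<open>One quarter for the light classes, two for \<open>\<delta>\<close>, which is
        doubled because \<open>missing\<close> counts ordered pairs.\<close>
      also have "\<dots> \<le> inside B w \<tau> + D / 4 * m\<^sup>2 + 2 * (D / 4 * m\<^sup>2)"
      proof (intro add_mono order_refl mult_left_mono)
        have "\<gamma> (Suc l) \<le> D / (4 * (real r)\<^sup>2)" unfolding \<gamma>S step_def D_def by simp
        then have "(real r)\<^sup>2 * \<gamma> (Suc l) \<le> (real r)\<^sup>2 * (D / (4 * (real r)\<^sup>2))" by (intro mult_left_mono) auto
        also have "\<dots> = D / 4" using r by simp
        finally have "(real r)\<^sup>2 * \<gamma> (Suc l) * m\<^sup>2 \<le> D / 4 * m\<^sup>2" by (intro mult_right_mono) auto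
        then show "(real r)\<^sup>2 * (\<gamma> (Suc l) * m\<^sup>2) \<le> D / 4 * m\<^sup>2" by (simp add: mult.assoc)
        show "\<delta> * m\<^sup>2 \<le> D / 4 * m\<^sup>2" using \<delta>_le[OF l(1)] by (intro mult_right_mono) (auto simp: D_def)
      qed simp
      also have "\<dots> \<le> inside B w \<tau> + D * m\<^sup>2" using D(1) by simp
      finally show ?thesis .
    qed
    have "1 / D \<le> real (card (V k))"
    proof -
      have "\<delta> \<le> D" using \<delta>_le[OF l(1)] D(1) by (simp add: D_def)
      then have "1 / D \<le> 1 / \<delta>" using \<delta>_pos by (intro divide_left_mono) auto
      then show ?thesis using m Vk by (simp add: m_def)
    qed
    moreover have "\<forall>i\<in>{1..k}. card (V k) \<le> card (V i)"
      using w_k Vk by (simp add: m_def w_def)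
    moreover have "\<forall>i\<in>B - {1..k}. card (V i) \<le> card (V k)"
    proof
      fix i assume "i \<in> B - {1..k}"
      then have "w i \<le> m" using Br by (intro w_le) auto
      then show "card (V i) \<le> card (V k)" using Vk by (simp add: m_def w_def)
    qed
    moreover have "\<forall>i\<in>B. \<gamma> l * real (card (V k)) \<le> real (card (V i))"
      using Vk by (auto simp: B_def m_def w_def)
    moreover have "\<forall>\<tau>. \<tau> \<in> B \<rightarrow> {1..k} \<longrightarrow> tr.missing \<le> inside B (\<lambda>i. real (card (V i))) \<tau> + D * (real (card (V k)))\<^sup>2"
      using miss Vk by (simp add: m_def w_def[abs_def])
    ultimately obtain f X supp \<mu> where st: "approx_stable B k V f X supp \<mu>" and X: "real (card X) \<le> \<epsilon> / 2 * real (card (V k))"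
      and close: "\<forall>i\<in>B. \<forall>v\<in>V i - X. real (card {u \<in> (\<Union>j\<in>B - {i}. V j). \<not> (adj v u \<longleftrightarrow> f v \<noteq> f u)}) \<le> \<epsilon> / 2 * real (card (V k))"
      and low: "\<forall>b\<in>{1..k}. (1 - \<epsilon> / 2) * real (card (V k)) < real (\<Sum>i | i \<in> B \<and> supp i = {b}. card (V i - X))"
      using D(2)[unfolded core_def, rule_format, OF tr.transversals_axioms cB kB] blow by blast

    \<comment> \<open>Adding the light classes to the deleted set\<close>
    define X' where "X' = X \<union> (\<Union>i\<in>{1..r} - B. V i)"
    have X': "real (card X') \<le> \<epsilon> * real (card (V k))"
    proof -
      have "card X' \<le> card X + card (\<Union>i\<in>{1..r} - B. V i)" unfolding X'_def by (rule card_Un_le)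
      also have "card (\<Union>i\<in>{1..r} - B. V i) \<le> (\<Sum>i\<in>{1..r} - B. card (V i))" by (intro card_UN_le) auto
      finally have "real (card X') \<le> real (card X + (\<Sum>i\<in>{1..r} - B. card (V i)))" by (simp only: of_nat_le_iff)
      also have "\<dots> = real (card X) + (\<Sum>i\<in>{1..r} - B. w i)" by (simp add: w_def)
      also have "(\<Sum>i\<in>{1..r} - B. w i) \<le> (\<Sum>i\<in>{1..r} - B. \<gamma> (Suc l) * m)" using light by (intro sum_mono)
      also have "\<dots> \<le> (\<Sum>i\<in>{1..r}. \<gamma> (Suc l) * m)"
        using \<gamma>_pos[of "Suc l"] m0 by (intro sum_mono2) auto
      also have "\<dots> = (real r * \<gamma> (Suc l)) * m" by simp
      also have "\<dots> \<le> \<epsilon> / 2 * m"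
      proof (rule mult_right_mono)
        have "\<gamma> (Suc l) \<le> \<epsilon> / (2 * real r)" unfolding \<gamma>S step_def by simp
        then have "real r * \<gamma> (Suc l) \<le> real r * (\<epsilon> / (2 * real r))" using r by (intro mult_left_mono) auto
        then show "real r * \<gamma> (Suc l) \<le> \<epsilon> / 2" using r by simp
      qed (use m0 in simp)
      finally show ?thesis using X Vk by (simp add: m_def)
    qed
    define P where "P = (\<lambda>a. {v \<in> verts G. (if v \<in> (\<Union>i\<in>B. V i) then f v else 1) = a})"
    have half: "\<epsilon> / 2 * real (card (V k)) \<le> \<epsilon> * real (card (V k))" using assms(5) by (intro mult_right_mono) auto
    have V1: "\<forall>i\<in>{1..r}. finite (V i)" using V by blast
    note sp = stable_partition_if_approx_stable[OF k(1) Br V1 disj G st close[unfolded adj_def] half X'_def X', folded P_def]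
    show "\<exists>G' X P. spanning_subgraph G' G \<and>
       real (card (edges G')) \<ge> real (card (edges G)) - \<epsilon> * (real (n (t - 1)))\<^sup>2 \<and>
       stable_partition r t V X \<epsilon> G' P \<and>
       (\<forall>j\<in>{1..t - 1}.
          real (card (integral_part r (delete_family V X) (delete_family P X j))) > (1 - \<epsilon>) * real (n (t - 1)))"
    proof (intro exI[of _ G] exI[of _ X'] exI[of _ P] conjI ballI)
      show "spanning_subgraph G G" by (simp add: spanning_subgraph_def)
      show "real (card (edges G)) - \<epsilon> * (real (n (t - 1)))\<^sup>2 \<le> real (card (edges G))" using assms(5) by simp
      show "stable_partition r t V X' \<epsilon> G P" unfolding t by (rule sp(1))
      fix j assume "j \<in> {1..t - 1}"
      then have j: "j \<in> {1..k}" by (simp add: t)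
      have "(1 - \<epsilon>) * m \<le> (1 - \<epsilon> / 2) * m" using assms(5) m0 by (intro mult_right_mono) auto
      moreover have "(1 - \<epsilon> / 2) * m < real (card (integral_part r (delete_family V X') (delete_family P X' j)))"
        unfolding sp(2)[OF j] using low[rule_format, OF j] Vk by (simp only: m_def)
      ultimately show "(1 - \<epsilon>) * real (n (t - 1)) < real (card (integral_part r (delete_family V X') (delete_family P X' j)))"
        by (simp add: m_def t)
    qed
  qed
qed

end
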